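(* Let $\tau>0$ and $A_0,A_1\in\mathbb{R}^{n\times n}$. Suppose there exist $\epsilon>0$ and functions $S\in W_2^{n\times n}[-\tau,0]$ and $R\in W_2^{n\times n}[[-\tau,0]\times [-\tau,0]]$ where $R(s,\theta) = R(\theta,s)^T$ and $S(s)$ is symmetric, such that $\langle z,\mathcal{P}z\rangle_{L_2^{2n}} \ge\epsilon \|z\|_{L_2^{2n}}^2$ for all $z \in X$ and $$\left\langle\begin{bmatrix}x \\ \phi(-\tau) \\ \phi\end{bmatrix},\mathcal{D}\begin{bmatrix}x \\ \phi(-\tau) \\ \phi\end{bmatrix}\right\rangle_{L_2^{3n}}\le-\epsilon \left\|\begin{bmatrix}x \\ \phi\end{bmatrix}\right\|_{L_2^{2n}}^2$$ for all $\begin{bmatrix}x\\ \phi\end{bmatrix} \in X$, where $$\left(\mathcal{P}\begin{bmatrix}x \\ \phi\end{bmatrix}\right)(s):= \begin{bmatrix} \tau( R(0,0)+S(0))x + \int_{-\tau}^0 R(0,\theta)\phi(\theta)\,d \theta \\ \tau R(s,0)\phi(0) + \tau S(s)\phi(s) + \int_{-\tau}^0 R(s,\theta)\phi(\theta)\,d \theta \end{bmatrix}$$ and $$\left(\mathcal{D}\begin{bmatrix}x \\ y \\ \phi\end{bmatrix}\right)(s):= \begin{bmatrix} D_0 \begin{bmatrix}x \\ y\end{bmatrix} + \int_{-\tau}^0 V(\theta)\phi(\theta)\,d\theta\\ \tau V(s)^T\begin{bmatrix}x \\ y\end{bmatrix} + \tau \dot S(s)\phi(s) + \int_{-\tau}^0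 E(s,\theta)\phi(\theta)\,d \theta \end{bmatrix}$$ with $$D_0:=\begin{bmatrix}S_{11}+S_{11}^T & S_{12} \\ S_{12}^T & S_{22}\end{bmatrix},\qquad V(s)=\begin{bmatrix}S_{13}(s)\\0\end{bmatrix},$$ $$S_{11} := \tau A_0(R(0,0)+S(0)) + \tau A_1 R(-\tau,0) +\tfrac{1}{2} S(0),\qquad S_{12} := \tau A_1 S(-\tau), \qquad S_{22} := - S(-\tau),$$ $$S_{13}(s) := A_0 R(0,s)+A_1 R(-\tau,s)+\dot R(s,0)^T,\qquad E(s,\theta):=\frac{\partial}{\partial s}R(s,\theta) + \frac{\partial}{\partial\theta} R(s,\theta),$$ where $\dot R(s,0)=\frac{d}{ds}R(s,0)$. Then the system $\dot x(t)=A_0x(t)+A_1x(t-\tau)$, $t\ge 0$, $x(t)=\phi_0(t)$ for $t\in[-\tau,0]$ with $\phi_0\in\mathcal{C}[-\tau,0]$, is exponentially stable.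
   Context: $L_2^m[D]$ denotes the square-integrable functions $D\to\mathbb{R}^m$ and $W_2^m[D]=\{x: x,\dot x\in L_2^m[D]\}$; $W_2^{n\times m}$ is the matrix-valued analogue (for functions of two variables, first-order partial derivatives in $L_2$). Functions in $W_2$ are regarded as continuous, and kernels are assumed sufficiently smooth that the one-variable sections that occur (e.g. $s\mapsto R(s,0)$) are well defined and lie in $W_2$. $\mathcal{C}[-\tau,0]$ is the space of continuous functions $[-\tau,0]\to\mathbb{R}^n$. The state space is $X:=\{\begin{bmatrix} x\\ \phi\end{bmatrix} : x\in\mathbb{R}^n,\ \phi\in W_2^n[-\tau,0],\ \phi(0)=x\}$. Vectors in $\mathbb{R}^m$ appearing as components are regarded as constant functions on $[-\tau,0]$, so $\langle \begin{bmatrix} y\\ \psi\end{bmatrix},\begin{bmatrix} x\\ \phi\end{bmatrix}\rangle_{L_2^{m+n}}=\int_{-\tau}^0 (y^Tx+\psi(s)^T\phi(s))\,ds$ for $x,y\in\mathbb{R}^m$ (with $m=n$ for $L_2^{2n}$ and $m=2n$ for $L_2^{3n}$), with the corresponding norms. Exponential stability of the delay system: there are $M,\beta>0$ such that every solution satisfies $\|x(t)\|\le Me^{-\beta t}\sup_{s\in[-\tau,0]}\|\phi_0(s)\|$ for all $t\ge0$. *)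

theory Defs
  imports "HOL-Analysis.Analysis"
begin

section \<open>Square-integrable and Sobolev functions\<close>

text \<open>
  Elements of \<open>L\<^sub>2\<close> are represented by Borel measurable functions; every class of Lebesgue measurable
  functions modulo null sets has such a representative. Values outside \<open>D\<close> play no role.
\<close>

definition square_integrable :: "'a::euclidean_space set \<Rightarrow> ('a \<Rightarrow> 'b::euclidean_space) \<Rightarrow> bool" where
  "square_integrable D f \<longleftrightarrow>
     set_borel_measurable lborel D f \<and> set_integrable lborel D (\<lambda>x. (norm (f x))\<^sup>2)"

definition test_function :: "'a::euclidean_space set \<Rightarrow> ('a \<Rightarrow> real) \<Rightarrow> bool" where
  "test_function D \<eta> \<longleftrightarrow>
     (\<exists>K. compact K \<and> K \<subseteq> interior D \<and> (\<forall>x. x \<notin> K \<longrightarrow> \<eta> x = 0)) \<and>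
     (\<forall>x. \<eta> differentiable (at x)) \<and>
     (\<forall>v. continuous_on UNIV (\<lambda>x. frechet_derivative \<eta> (at x) v))"

text \<open>
  Distributional derivative of \<open>f\<close> in direction \<open>e\<close> on the interior of \<open>D\<close>. Test functions are
  \<open>C\<^sup>1\<close> with compact support, which gives the same notion as smooth ones (mollification).
\<close>

definition has_weak_derivative ::
  "'a::euclidean_space set \<Rightarrow> 'a \<Rightarrow> ('a \<Rightarrow> 'b::euclidean_space) \<Rightarrow> ('a \<Rightarrow> 'b) \<Rightarrow> bool" where
  "has_weak_derivative D e f g \<longleftrightarrow>
     (\<forall>\<eta>. test_function D \<eta> \<longrightarrow>
        (LBINT x:D. frechet_derivative \<eta> (at x) e *\<^sub>R f x) = - (LBINT x:D. \<eta> x *\<^sub>R g x))"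

text \<open>
  A representative of the weak derivative; it is determined only up to a null set, and is used only
  under integrals.
\<close>

definition weak_derivative ::
  "'a::euclidean_space set \<Rightarrow> 'a \<Rightarrow> ('a \<Rightarrow> 'b::euclidean_space) \<Rightarrow> 'a \<Rightarrow> 'b" where
  "weak_derivative D e f = (SOME g. square_integrable D g \<and> has_weak_derivative D e f g)"

text \<open>
  All first-order partial derivatives are in \<open>L\<^sub>2\<close>, and members are continuous up to the boundary,
  so that point values and one-variable sections make sense.
\<close>

definition W2 :: "'a::euclidean_space set \<Rightarrow> ('a \<Rightarrow> 'b::euclidean_space) set" where
  "W2 D = {f. continuous_on D f \<and> square_integrable D f \<and>
     (\<forall>e\<in>Basis. \<exists>g. square_integrable D g \<and> has_weak_derivative D e f g)}"

definition L2_inner :: "real \<Rightarrow> (real \<Rightarrow> 'b::euclidean_space) \<Rightarrow> (real \<Rightarrow> 'b) \<Rightarrow> real" where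
  "L2_inner \<tau> f g = (LBINT s:{-\<tau>..0}. f s \<bullet> g s)"

definition L2_norm :: "real \<Rightarrow> (real \<Rightarrow> 'b::euclidean_space) \<Rightarrow> real" where
  "L2_norm \<tau> f = sqrt (L2_inner \<tau> f f)"


section \<open>The delay system\<close>

text \<open>At \<open>t = 0\<close> the derivative is one-sided.\<close>

definition delay_solution ::
  "real \<Rightarrow> real^'n^'n \<Rightarrow> real^'n^'n \<Rightarrow> (real \<Rightarrow> real^'n) \<Rightarrow> (real \<Rightarrow> real^'n) \<Rightarrow> bool" where
  "delay_solution \<tau> A0 A1 \<phi>0 x \<longleftrightarrow>
     (\<forall>t\<in>{-\<tau>..0}. x t = \<phi>0 t) \<and>
     (\<forall>t\<ge>0. (x has_vector_derivative (A0 *v x t + A1 *v x (t - \<tau>))) (at t within {0..}))"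

definition exponentially_stable :: "real \<Rightarrow> real^'n^'n \<Rightarrow> real^'n^'n \<Rightarrow> bool" where
  "exponentially_stable \<tau> A0 A1 \<longleftrightarrow>
     (\<exists>M>0. \<exists>\<beta>>0. \<forall>\<phi>0 x.
        continuous_on {-\<tau>..0} \<phi>0 \<longrightarrow> delay_solution \<tau> A0 A1 \<phi>0 x \<longrightarrow>
        (\<forall>t\<ge>0. norm (x t) \<le> M * exp (- \<beta> * t) * (SUP s\<in>{-\<tau>..0}. norm (\<phi>0 s))))"

definition state_space :: "real \<Rightarrow> ((real^'n) \<times> (real \<Rightarrow> real^'n)) set" where
  "state_space \<tau> = {(x, \<phi>). \<phi> \<in> W2 {-\<tau>..0} \<and> \<phi> 0 = x}"


section \<open>The operators\<close>

text \<open>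
  Column vectors are pairs: the pair \<open>(x, \<phi> s)\<close> is the value at \<open>s\<close> of a function with values in
  \<open>\<real>\<^sup>n \<times> \<real>\<^sup>n = \<real>\<^sup>2\<^sup>n\<close>, whose first component is constant, and \<open>((x, y), \<phi> s)\<close> is the analogue
  for \<open>\<real>\<^sup>3\<^sup>n\<close>. The inner product of the product type is the sum of the componentwise ones.
\<close>

definition stack :: "'a \<times> (real \<Rightarrow> 'b) \<Rightarrow> real \<Rightarrow> 'a \<times> 'b" where
  "stack z = (\<lambda>s. (fst z, snd z s))"

definition op_P ::
  "real \<Rightarrow> (real \<Rightarrow> real^'n^'n) \<Rightarrow> (real \<times> real \<Rightarrow> real^'n^'n) \<Rightarrow>
   (real^'n) \<times> (real \<Rightarrow> real^'n) \<Rightarrow> real \<Rightarrow> (real^'n) \<times> (real^'n)" where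
  "op_P \<tau> S R = (\<lambda>(x, \<phi>) s.
     ((\<tau> *\<^sub>R (R (0, 0) + S 0)) *v x + (LBINT \<theta>:{-\<tau>..0}. R (0, \<theta>) *v \<phi> \<theta>),
      (\<tau> *\<^sub>R R (s, 0)) *v \<phi> 0 + (\<tau> *\<^sub>R S s) *v \<phi> s + (LBINT \<theta>:{-\<tau>..0}. R (s, \<theta>) *v \<phi> \<theta>)))"

definition S11 ::
  "real \<Rightarrow> real^'n^'n \<Rightarrow> real^'n^'n \<Rightarrow> (real \<Rightarrow> real^'n^'n) \<Rightarrow> (real \<times> real \<Rightarrow> real^'n^'n) \<Rightarrow>
   real^'n^'n" where
  "S11 \<tau> A0 A1 S R =
     \<tau> *\<^sub>R (A0 ** (R (0, 0) + S 0)) + \<tau> *\<^sub>R (A1 ** R (-\<tau>, 0)) + (1/2) *\<^sub>R S 0"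

definition S12 :: "real \<Rightarrow> real^'n^'n \<Rightarrow> (real \<Rightarrow> real^'n^'n) \<Rightarrow> real^'n^'n" where
  "S12 \<tau> A1 S = \<tau> *\<^sub>R (A1 ** S (-\<tau>))"

definition S22 :: "real \<Rightarrow> (real \<Rightarrow> real^'n^'n) \<Rightarrow> real^'n^'n" where
  "S22 \<tau> S = - S (-\<tau>)"

definition S13 ::
  "real \<Rightarrow> real^'n^'n \<Rightarrow> real^'n^'n \<Rightarrow> (real \<times> real \<Rightarrow> real^'n^'n) \<Rightarrow> real \<Rightarrow> real^'n^'n" where
  "S13 \<tau> A0 A1 R s =
     A0 ** R (0, s) + A1 ** R (-\<tau>, s) + transpose (weak_derivative {-\<tau>..0} 1 (\<lambda>\<sigma>. R (\<sigma>, 0)) s)"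

definition kernel_E :: "real \<Rightarrow> (real \<times> real \<Rightarrow> real^'n^'n) \<Rightarrow> real \<times> real \<Rightarrow> real^'n^'n" where
  "kernel_E \<tau> R p =
     weak_derivative ({-\<tau>..0} \<times> {-\<tau>..0}) (1, 0) R p + weak_derivative ({-\<tau>..0} \<times> {-\<tau>..0}) (0, 1) R p"

text \<open>
  The block matrices \<open>D\<^sub>0\<close>, \<open>V(s)\<close> and \<open>V(s)\<^sup>T\<close>, as maps on column vectors.
\<close>

definition map_D0 ::
  "real \<Rightarrow> real^'n^'n \<Rightarrow> real^'n^'n \<Rightarrow> (real \<Rightarrow> real^'n^'n) \<Rightarrow> (real \<times> real \<Rightarrow> real^'n^'n) \<Rightarrow>
   (real^'n) \<times> (real^'n) \<Rightarrow> (real^'n) \<times> (real^'n)" where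
  "map_D0 \<tau> A0 A1 S R = (\<lambda>(x, y).
     ((S11 \<tau> A0 A1 S R + transpose (S11 \<tau> A0 A1 S R)) *v x + S12 \<tau> A1 S *v y,
      transpose (S12 \<tau> A1 S) *v x + S22 \<tau> S *v y))"

definition map_V ::
  "real \<Rightarrow> real^'n^'n \<Rightarrow> real^'n^'n \<Rightarrow> (real \<times> real \<Rightarrow> real^'n^'n) \<Rightarrow> real \<Rightarrow>
   real^'n \<Rightarrow> (real^'n) \<times> (real^'n)" where
  "map_V \<tau> A0 A1 R s v = (S13 \<tau> A0 A1 R s *v v, 0)"

definition map_V_transpose ::
  "real \<Rightarrow> real^'n^'n \<Rightarrow> real^'n^'n \<Rightarrow> (real \<times> real \<Rightarrow> real^'n^'n) \<Rightarrow> real \<Rightarrow>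
   (real^'n) \<times> (real^'n) \<Rightarrow> real^'n" where
  "map_V_transpose \<tau> A0 A1 R s = (\<lambda>(x, y). transpose (S13 \<tau> A0 A1 R s) *v x)"

definition op_D ::
  "real \<Rightarrow> real^'n^'n \<Rightarrow> real^'n^'n \<Rightarrow> (real \<Rightarrow> real^'n^'n) \<Rightarrow> (real \<times> real \<Rightarrow> real^'n^'n) \<Rightarrow>
   ((real^'n) \<times> (real^'n)) \<times> (real \<Rightarrow> real^'n) \<Rightarrow> real \<Rightarrow> ((real^'n) \<times> (real^'n)) \<times> (real^'n)" where
  "op_D \<tau> A0 A1 S R = (\<lambda>((x, y), \<phi>) s.
     (map_D0 \<tau> A0 A1 S R (x, y) + (LBINT \<theta>:{-\<tau>..0}. map_V \<tau> A0 A1 R \<theta> (\<phi> \<theta>)),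
      \<tau> *\<^sub>R map_V_transpose \<tau> A0 A1 R s (x, y) + (\<tau> *\<^sub>R weak_derivative {-\<tau>..0} 1 S s) *v \<phi> s
        + (LBINT \<theta>:{-\<tau>..0}. kernel_E \<tau> R (s, \<theta>) *v \<phi> \<theta>)))"

end

theory Submission
  imports Defs
begin

text \<open>
  The operator \<open>P\<close> need not be inverted: \<open>\<langle>w, P w\<rangle>\<close> is a Lyapunov functional for the adjoint
  semigroup, i.e. for the transposed system \<open>y' = A\<^sub>0\<^sup>T y + A\<^sub>1\<^sup>T y(\<cdot> - \<tau>)\<close> with adjoint state
  \<open>w(t) = (y(t), \<phi>\<^sub>t)\<close>, \<open>\<phi>\<^sub>t(s) = \<tau> A\<^sub>1\<^sup>T y(t - \<tau> - s)\<close>. This state satisfies \<open>\<phi>\<^sub>t(-\<tau>) = \<tau> A\<^sub>1\<^sup>T y(t)\<close>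
  but not \<open>\<phi>\<^sub>t(0) = y(t)\<close>; since neither quadratic form involves \<open>\<phi>(0)\<close>, both inequalities extend to it by
  density. Integration by parts shows that the derivative of the functional is the quadratic form of \<open>D\<close> at
  \<open>(y(t), \<phi>\<^sub>t(-\<tau>), \<phi>\<^sub>t)\<close> minus \<open>\<tau> (\<phi>\<^sub>t(0) - y(t))\<^sup>T S(0) (\<phi>\<^sub>t(0) - y(t))\<close>, and \<open>S(0) \<ge> 0\<close>
  because \<open>P\<close> is coercive. Hence the fundamental solution of the transposed system decays
  exponentially, and the variation of constants formula carries the decay over to the original system.
\<close>

section \<open>Set integrals\<close>

text \<open>Why \<open>P\<close> and the transposed system fit together: for z in the state space
  the form of \<open>D\<close> equals 2<z, A P z>, where A(x, psi) = (A0 x + A1 psi(-\<tau>), psi')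
  is the generator of the given system. Moving A to the left factor gives 2<A* z, P z>, the
  derivative of <z, P z> along the adjoint flow. The adjoint state violates the matching condition
  at 0, and the resulting defect becomes a perfect square in S(0) thanks to the summand (1/2) S(0)
  of \<open>S11\<close>. Two regularity obstacles shape the rest. Weak derivatives may only be
  tested with functions vanishing near the boundary, so each boundary term has to be produced as the
  limit of cutoff functions whose derivatives act as point masses at the ends. The fundamental
  solution jumps at time 0 and is continuously differentiable only after time \<tau>, whereas the
  functional needs C^1 states. Hence its continuous primitive \<open>Y\<close> is constructed
  instead, the functional is used only from a later time on, and the initial stretch is absorbed
  into the constant.\<close>

lemma set_integrable_compact:
  fixes f :: "'a::euclidean_space \<Rightarrow> 'b::{banach, second_countable_topology}"
  assumes "compact A" "continuous_on A f"
  shows "set_integrable lborel A f"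
  unfolding set_integrable_def using assms by (rule borel_integrable_compact)

lemma set_borel_measurable_compact:
  fixes f :: "'a::euclidean_space \<Rightarrow> 'b::{banach, second_countable_topology}"
  assumes "compact A" "continuous_on A f"
  shows "set_borel_measurable lborel A f"
  using set_integrable_compact[OF assms] unfolding set_integrable_def set_borel_measurable_def
  by (rule borel_measurable_integrable)

lemma set_integral_dominated_convergence:
  fixes f :: "'a \<Rightarrow> 'b::{banach, second_countable_topology}" and w :: "'a \<Rightarrow> real"
  assumes "set_borel_measurable M A f" "\<And>k. set_borel_measurable M A (s k)"
    and "set_integrable M A w"
    and "AE x in M. x \<in> A \<longrightarrow> (\<lambda>k. s k x) \<longlonglongrightarrow> f x"
    and "\<And>k. AE x in M. x \<in> A \<longrightarrow> norm (s k x) \<le> w x"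
  shows "(\<lambda>k. set_lebesgue_integral M A (s k)) \<longlonglongrightarrow> set_lebesgue_integral M A f"
  unfolding set_lebesgue_integral_def
proof (rule integral_dominated_convergence)
  show "AE x in M. (\<lambda>k. indicat_real A x *\<^sub>R s k x) \<longlonglongrightarrow> indicat_real A x *\<^sub>R f x"
    using assms(4) by eventually_elim (auto simp: indicator_def)
  show "AE x in M. norm (indicat_real A x *\<^sub>R s k x) \<le> indicat_real A x *\<^sub>R w x" for k
    using assms(5)[of k] by eventually_elim (auto simp: indicator_def)
qed (use assms(1-3) in \<open>auto simp: set_borel_measurable_def set_integrable_def\<close>)

lemma set_integral_bounded_linear:
  assumes "bounded_linear T" "set_integrable M A f"
  shows "set_integrable M A (\<lambda>x. T (f x))"
    and "(LINT x:A|M. T (f x)) = T (LINT x:A|M. f x)"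
proof -
  interpret bounded_linear T by fact
  have *: "indicat_real A x *\<^sub>R T (f x) = T (indicat_real A x *\<^sub>R f x)" for x
    by (simp add: scaleR)
  show "set_integrable M A (\<lambda>x. T (f x))"
    using integrable_bounded_linear[OF assms(1) assms(2)[unfolded set_integrable_def]]
    unfolding set_integrable_def * .
  show "(LINT x:A|M. T (f x)) = T (LINT x:A|M. f x)"
    using integral_bounded_linear[OF assms(1) assms(2)[unfolded set_integrable_def]]
    unfolding set_lebesgue_integral_def * .
qed

lemma set_integral_sum:
  fixes f :: "'i \<Rightarrow> 'a \<Rightarrow> 'b::{banach, second_countable_topology}"
  assumes "\<And>i. i \<in> J \<Longrightarrow> set_integrable M A (f i)"
  shows "set_integrable M A (\<lambda>x. \<Sum>i\<in>J. f i x)"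
    and "(LINT x:A|M. (\<Sum>i\<in>J. f i x)) = (\<Sum>i\<in>J. LINT x:A|M. f i x)"
  using assms unfolding set_integrable_def set_lebesgue_integral_def
  by (simp_all add: scaleR_sum_right)

lemma set_integral_abs_le:
  fixes f g :: "'a \<Rightarrow> real"
  assumes "set_integrable M A f" "set_integrable M A g" "\<And>x. x \<in> A \<Longrightarrow> \<bar>f x\<bar> \<le> g x"
  shows "\<bar>LINT x:A|M. f x\<bar> \<le> (LINT x:A|M. g x)"
proof -
  have "(LINT x:A|M. f x) \<le> (LINT x:A|M. g x)"
    using assms by (intro set_integral_mono) (auto simp: abs_le_iff)
  moreover have "- (LINT x:A|M. f x) \<le> (LINT x:A|M. g x)"
  proof -
    have "(LINT x:A|M. - f x) \<le> (LINT x:A|M. g x)"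
      using assms by (intro set_integral_mono) (auto simp: abs_le_iff set_integrable_def)
    then show ?thesis using set_integral_uminus[OF assms(1)] by simp
  qed
  ultimately show ?thesis by (simp add: abs_le_iff)
qed

section \<open>Smooth cutoff functions\<close>

text \<open>The averaged function \<open>h' k\<close> may vary with \<open>k\<close>, because for
  kernels the boundary term still carries a cutoff in the other variable. Uniform convergence then
  costs one small error and continuity of \<open>h\<close> at \<open>z\<close> a second one.\<close>

lemma approximate_identity:
  fixes p h' :: "nat \<Rightarrow> real \<Rightarrow> real" and h :: "real \<Rightarrow> real"
  assumes z: "z \<in> {c..d}"
    and p: "\<And>k. continuous_on {c..d} (p k)" "\<And>k s. s \<in> {c..d} \<Longrightarrow> p k s \<ge> 0"
    and p1: "\<forall>\<^sub>F k in sequentially. (LBINT s:{c..d}. p k s) = 1"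
    and conc: "\<And>\<delta>. \<delta> > 0 \<Longrightarrow> \<forall>\<^sub>F k in sequentially. \<forall>s\<in>{c..d}. \<bar>s - z\<bar> \<ge> \<delta> \<longrightarrow> p k s = 0"
    and h: "continuous_on {c..d} h" "\<And>k. continuous_on {c..d} (h' k)"
    and u: "uniform_limit {c..d} h' h sequentially"
  shows "(\<lambda>k. LBINT s:{c..d}. p k s * h' k s) \<longlonglongrightarrow> h z"
proof (rule tendstoI)
  fix e :: real assume "e > 0"
  \<comment> \<open>The two errors add up to \<open>2 * e'\<close>, which stays strictly below
    \<open>e\<close>.\<close>
  define e' where "e' = e / 3"
  have e': "e' > 0" using \<open>e > 0\<close> by (simp add: e'_def)
  obtain \<delta> where \<delta>: "\<delta> > 0" "\<And>s. s \<in> {c..d} \<Longrightarrow> \<bar>s - z\<bar> < \<delta> \<Longrightarrow> \<bar>h s - h z\<bar> < e'"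
    using h(1) z e' unfolding continuous_on_iff dist_real_def by metis
  show "\<forall>\<^sub>F k in sequentially. dist (LBINT s:{c..d}. p k s * h' k s) (h z) < e"
    using p1 conc[OF \<delta>(1)] uniform_limitD[OF u e']
  proof eventually_elim
    case (elim k)
    have i1: "set_integrable lborel {c..d} (p k)"
      using p by (intro borel_integrable_atLeastAtMost')
    have i2: "set_integrable lborel {c..d} (\<lambda>s. p k s * h' k s)"
      using p h by (intro borel_integrable_atLeastAtMost' continuous_intros)
    have "(LBINT s:{c..d}. p k s * h' k s) - h z
        = (LBINT s:{c..d}. p k s * h' k s) - (LBINT s:{c..d}. p k s * h z)"
      using elim(1) by simp
    also have "\<dots> = (LBINT s:{c..d}. p k s * h' k s - p k s * h z)"
      using i1 i2 by (subst set_integral_diff(2)) auto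
    finally have *: "(LBINT s:{c..d}. p k s * h' k s) - h z
      = (LBINT s:{c..d}. p k s * h' k s - p k s * h z)" .
    have "\<bar>LBINT s:{c..d}. p k s * h' k s - p k s * h z\<bar> \<le> (LBINT s:{c..d}. p k s * (2 * e'))"
    proof (rule set_integral_abs_le)
      fix s assume s: "s \<in> {c..d}"
      show "\<bar>p k s * h' k s - p k s * h z\<bar> \<le> p k s * (2 * e')"
      proof (cases "\<bar>s - z\<bar> < \<delta>")
        case True
        have "\<bar>h' k s - h s\<bar> < e'" using elim(3) s by (auto simp: dist_real_def)
        then have "\<bar>h' k s - h z\<bar> \<le> 2 * e'" using \<delta>(2)[OF s True] by linarith
        then have "p k s * \<bar>h' k s - h z\<bar> \<le> p k s * (2 * e')"
          using p(2)[OF s] by (rule mult_left_mono)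
        then show ?thesis using p(2)[OF s]
          by (simp add: abs_mult right_diff_distrib[symmetric])
      next
        case False
        then show ?thesis using elim(2) s by auto
      qed
    qed (use i1 i2 in auto)
    also have "\<dots> = 2 * e'" using elim(1) by simp
    finally show ?case using e' * by (simp add: dist_real_def e'_def)
  qed
qed

text \<open>Squaring makes the positive part continuously differentiable, which is all the
  smoothness that \<open>test_function\<close> asks for.\<close>

definition pos_square :: "real \<Rightarrow> real" where
  "pos_square x = (max 0 x)\<^sup>2"

lemma pos_square_deriv: "(pos_square has_real_derivative 2 * max 0 x) (at x)"
proof -
  consider "x < 0" | "x > 0" | "x = 0" by linarith
  then show ?thesis
  proof cases
    case 1
    have "((\<lambda>_. 0) has_real_derivative 2 * max 0 x) (at x)" using 1 by simp
    then show ?thesis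
      by (rule has_field_derivative_transform_within_open[where S = "{..<0}"])
        (use 1 in \<open>auto simp: pos_square_def\<close>)
  next
    case 2
    have "((\<lambda>x. x\<^sup>2) has_real_derivative 2 * max 0 x) (at x)"
      using 2 by (auto intro!: derivative_eq_intros)
    then show ?thesis
      by (rule has_field_derivative_transform_within_open[where S = "{0<..}"])
        (use 2 in \<open>auto simp: pos_square_def\<close>)
  next
    case 3
    have "(\<lambda>h. (pos_square (0 + h) - pos_square 0) / h) \<midarrow>0\<rightarrow> 0"
    proof (rule Lim_null_comparison)
      show "\<forall>\<^sub>F h in at (0::real). norm ((pos_square (0 + h) - pos_square 0) / h) \<le> \<bar>h\<bar>"
        by (auto simp: pos_square_def power2_eq_square max_def eventually_at_filter)
      show "(\<lambda>h::real. \<bar>h\<bar>) \<midarrow>0\<rightarrow> 0"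
        by (rule tendsto_rabs_zero) (rule tendsto_ident_at)
    qed
    then show ?thesis using 3 by (simp add: DERIV_def)
  qed
qed

text \<open>On [0,1] this is 1 - (1 - x^2)^2, which joins the constants 0 and 1 with vanishing slope
  at both ends.\<close>

definition smooth_step :: "real \<Rightarrow> real" where
  "smooth_step x = 1 - pos_square (1 - pos_square x)"

definition smooth_step' :: "real \<Rightarrow> real" where
  "smooth_step' x = 4 * max 0 (1 - pos_square x) * max 0 x"

lemma smooth_step_deriv: "(smooth_step has_real_derivative smooth_step' x) (at x)"
  unfolding smooth_step_def[abs_def] smooth_step'_def
  by (auto intro!: derivative_eq_intros DERIV_chain2[OF pos_square_deriv])

lemma smooth_step_simps:
  "x \<le> 0 \<Longrightarrow> smooth_step x = 0" "x \<ge> 1 \<Longrightarrow> smooth_step x = 1"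
  "x \<ge> 1 \<Longrightarrow> smooth_step' x = 0" "x \<le> 0 \<Longrightarrow> smooth_step' x = 0"
  "0 \<le> smooth_step' x"
  by (auto simp: smooth_step_def smooth_step'_def pos_square_def)

lemma smooth_step_range: "0 \<le> smooth_step x" "smooth_step x \<le> 1"
  by (auto simp: smooth_step_def pos_square_def max_def abs_square_le_1 power_le_one)

lemma continuous_smooth_step':
  "continuous_on A f \<Longrightarrow> continuous_on A (\<lambda>x. smooth_step' (f x))"
  unfolding smooth_step'_def pos_square_def by (intro continuous_intros)

text \<open>The factor (s - a)(b - s) treats both ends of the interval at once. Subtracting 1 keeps
  the support where k(s - a)(b - s) is at least 1, hence away from the ends; the value 1 is reached
  where that product is at least 2.\<close>

definition cutoff :: "real \<Rightarrow> real \<Rightarrow> nat \<Rightarrow> real \<Rightarrow> real" where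
  "cutoff a b k s = smooth_step (real k * ((s - a) * (b - s)) - 1)"

definition cutoff' :: "real \<Rightarrow> real \<Rightarrow> nat \<Rightarrow> real \<Rightarrow> real" where
  "cutoff' a b k s = smooth_step' (real k * ((s - a) * (b - s)) - 1) * (real k * (a + b - 2 * s))"

lemma cutoff_deriv: "(cutoff a b k has_real_derivative cutoff' a b k s) (at s)"
  unfolding cutoff_def[abs_def] cutoff'_def
  by (rule DERIV_chain2[OF smooth_step_deriv])
    (auto intro!: derivative_eq_intros simp: algebra_simps)

lemma continuous_cutoff': "continuous_on A (cutoff' a b k)"
  unfolding cutoff'_def[abs_def] by (intro continuous_intros continuous_smooth_step')

lemma continuous_cutoff: "continuous_on A (cutoff a b k)"
  using cutoff_deriv by (meson DERIV_continuous_on has_field_derivative_at_within)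

lemma cutoff_range: "0 \<le> cutoff a b k s" "cutoff a b k s \<le> 1"
  unfolding cutoff_def by (rule smooth_step_range)+

lemma cutoff_support:
  assumes "a < b"
  shows "\<exists>K. compact K \<and> K \<subseteq> {a<..<b} \<and> (\<forall>s. s \<notin> K \<longrightarrow> cutoff a b k s = 0)"
proof -
  define K where "K = {s \<in> {a..b}. 1 \<le> real k * ((s - a) * (b - s))}"
  have cl: "closed ({a..b} \<inter> {s. 1 \<le> real k * ((s - a) * (b - s))})"
    by (intro closed_Int closed_Collect_le continuous_intros closed_atLeastAtMost)
  have "K = {a..b} \<inter> ({a..b} \<inter> {s. 1 \<le> real k * ((s - a) * (b - s))})"
    by (auto simp: K_def)
  then have "compact K" using compact_Int_closed[OF compact_Icc cl] by metis
  moreover have "K \<subseteq> {a<..<b}"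
  proof
    fix s assume s: "s \<in> K"
    then have "s \<noteq> a" "s \<noteq> b" by (auto simp: K_def)
    then show "s \<in> {a<..<b}" using s by (auto simp: K_def)
  qed
  moreover have "cutoff a b k s = 0" if "s \<notin> K" for s
  proof -
    have "real k * ((s - a) * (b - s)) - 1 \<le> 0"
    proof (cases "s \<in> {a..b}")
      case True then show ?thesis using that by (auto simp: K_def)
    next
      case False
      then have "(s - a) * (b - s) \<le> 0"
        using assms by (auto simp: mult_le_0_iff)
      then have "real k * ((s - a) * (b - s)) \<le> 0"
        by (simp add: mult_nonneg_nonpos)
      then show ?thesis by linarith
    qed
    then show ?thesis unfolding cutoff_def by (rule smooth_step_simps)
  qed
  ultimately show ?thesis by blast
qed

lemma cutoff_eventually_1:
  assumes "c > 0"
  shows "\<forall>\<^sub>F k in sequentially. \<forall>s. (s - a) * (b - s) \<ge> c \<longrightarrow> cutoff a b k s = 1 \<and> cutoff' a b k s = 0"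
proof -
  obtain N :: nat where N: "real N > 2 / c" using reals_Archimedean2 by blast
  show ?thesis
    using eventually_ge_at_top[of N]
  proof eventually_elim
    case (elim k)
    have "cutoff a b k s = 1 \<and> cutoff' a b k s = 0" if s: "(s - a) * (b - s) \<ge> c" for s
    proof -
      have "2 < real N * c" using N assms by (simp add: field_simps)
      also have "\<dots> \<le> real k * ((s - a) * (b - s))"
        using elim s assms by (intro mult_mono) auto
      finally show ?thesis unfolding cutoff_def cutoff'_def by (simp add: smooth_step_simps)
    qed
    then show ?case by blast
  qed
qed

lemma cutoff_tendsto:
  assumes "s \<in> {a<..<b}"
  shows "(\<lambda>k. cutoff a b k s) \<longlonglongrightarrow> 1"
proof (rule tendsto_eventually)
  have "(s - a) * (b - s) > 0" using assms by auto
  from cutoff_eventually_1[OF this, of a b]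
  show "\<forall>\<^sub>F k in sequentially. cutoff a b k s = 1" by eventually_elim auto
qed

text \<open>Up to the midpoint the derivative of the cutoff is nonnegative, concentrates at
  \<open>a\<close> and eventually has total mass 1 by the fundamental theorem of calculus. Past the
  midpoint its negative does the same at \<open>b\<close>. This is the source of all boundary terms
  in the integrations by parts.\<close>

lemma cutoff'_delta:
  fixes h :: "real \<Rightarrow> real"
  assumes "a < b" and h: "continuous_on {a..b} h" "\<And>k. continuous_on {a..b} (h' k)"
    and u: "uniform_limit {a..b} h' h sequentially"
  shows "(\<lambda>k. LBINT s:{a..b}. cutoff' a b k s * h' k s) \<longlonglongrightarrow> h a - h b"
proof -
  define m where "m = (a + b) / 2"
  have m: "a < m" "m < b" using assms by (auto simp: m_def)
  have ftc: "(LBINT s:{c..d}. cutoff' a b k s) = cutoff a b k d - cutoff a b k c" if "c \<le> d" for c d k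
    unfolding set_lebesgue_integral_def
    using that by (intro integral_FTC_atLeastAtMost continuous_cutoff')
      (auto simp: has_real_derivative_iff_has_vector_derivative[symmetric]
        intro: has_field_derivative_at_within cutoff_deriv)
  have ends: "cutoff a b k a = 0" "cutoff a b k b = 0" for k
    by (auto simp: cutoff_def smooth_step_simps)
  have "(m - a) * (b - m) > 0" using m by auto
  from cutoff_eventually_1[OF this, of a b]
  have mid: "\<forall>\<^sub>F k in sequentially. cutoff a b k m = 1" by eventually_elim auto
  have L: "(\<lambda>k. LBINT s:{a..m}. cutoff' a b k s * h' k s) \<longlonglongrightarrow> h a"
  proof (rule approximate_identity[where h = h and z = a])
    show "cutoff' a b k s \<ge> 0" if "s \<in> {a..m}" for k s
      unfolding cutoff'_def using that m
      by (intro mult_nonneg_nonneg smooth_step_simps) (auto simp: m_def)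
    show "\<forall>\<^sub>F k in sequentially. (LBINT s:{a..m}. cutoff' a b k s) = 1"
      using mid by eventually_elim (use m in \<open>simp add: ftc ends\<close>)
    show "\<forall>\<^sub>F k in sequentially. \<forall>s\<in>{a..m}. \<delta> \<le> \<bar>s - a\<bar> \<longrightarrow> cutoff' a b k s = 0" if "\<delta> > 0" for \<delta>
    proof -
      have "\<delta> * (b - m) > 0" using that m by auto
      note ev = cutoff_eventually_1[OF this, of a b]
      have le: "\<delta> * (b - m) \<le> (s - a) * (b - s)" if "s \<in> {a..m}" "\<delta> \<le> \<bar>s - a\<bar>" for s
        using that \<open>\<delta> > 0\<close> m by (intro mult_mono) auto
      show ?thesis
        using ev by eventually_elim (use le in blast)
    qed
    show "uniform_limit {a..m} h' h sequentially"
      using u by (rule uniform_limit_on_subset) (use m in auto)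
    show "continuous_on {a..m} h" by (rule continuous_on_subset[OF h(1)]) (use m in auto)
    show "continuous_on {a..m} (h' k)" for k by (rule continuous_on_subset[OF h(2)]) (use m in auto)
  qed (use m in \<open>auto intro: continuous_cutoff'\<close>)
  have R: "(\<lambda>k. LBINT s:{m..b}. - cutoff' a b k s * h' k s) \<longlonglongrightarrow> h b"
  proof (rule approximate_identity[where h = h and z = b])
    show "- cutoff' a b k s \<ge> 0" if "s \<in> {m..b}" for k s
    proof -
      have "0 \<le> smooth_step' (real k * ((s - a) * (b - s)) - 1) * (real k * (2 * s - a - b))"
        using that m by (intro mult_nonneg_nonneg smooth_step_simps) (auto simp: m_def)
      then show ?thesis unfolding cutoff'_def by (simp add: algebra_simps)
    qed
    show "\<forall>\<^sub>F k in sequentially. (LBINT s:{m..b}. - cutoff' a b k s) = 1"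
      using mid
    proof eventually_elim
      case (elim k)
      have "(LBINT s:{m..b}. - cutoff' a b k s) = - (LBINT s:{m..b}. cutoff' a b k s)"
        by (intro set_integral_uminus borel_integrable_atLeastAtMost' continuous_cutoff')
      then show ?case using elim m by (simp add: ftc ends)
    qed
    show "\<forall>\<^sub>F k in sequentially. \<forall>s\<in>{m..b}. \<delta> \<le> \<bar>s - b\<bar> \<longrightarrow> - cutoff' a b k s = 0" if "\<delta> > 0" for \<delta>
    proof -
      have "(m - a) * \<delta> > 0" using that m by auto
      note ev = cutoff_eventually_1[OF this, of a b]
      have le: "(m - a) * \<delta> \<le> (s - a) * (b - s)" if "s \<in> {m..b}" "\<delta> \<le> \<bar>s - b\<bar>" for s
        using that \<open>\<delta> > 0\<close> m by (intro mult_mono) auto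
      show ?thesis
        using ev by eventually_elim (use le in auto)
    qed
    show "uniform_limit {m..b} h' h sequentially"
      using u by (rule uniform_limit_on_subset) (use m in auto)
    show "continuous_on {m..b} h" by (rule continuous_on_subset[OF h(1)]) (use m in auto)
    show "continuous_on {m..b} (h' k)" for k by (rule continuous_on_subset[OF h(2)]) (use m in auto)
  qed (use m in \<open>auto intro!: continuous_cutoff' continuous_intros\<close>)
  have split: "(LBINT s:{a..b}. cutoff' a b k s * h' k s)
      = (LBINT s:{a..m}. cutoff' a b k s * h' k s) - (LBINT s:{m..b}. - cutoff' a b k s * h' k s)" for k
  proof -
    have c: "continuous_on {a..b} (\<lambda>s. cutoff' a b k s * h' k s)"
      by (intro continuous_intros continuous_cutoff' h)
    have il: "set_integrable lborel {a..m} (\<lambda>s. cutoff' a b k s * h' k s)"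
      and ir: "set_integrable lborel {m..b} (\<lambda>s. cutoff' a b k s * h' k s)"
      using c m by (auto intro!: borel_integrable_atLeastAtMost' elim: continuous_on_subset)
    have "{a..b} = {a..m} \<union> {m..b}" using m by auto
    moreover have "(LBINT s:{a..m} \<union> {m..b}. cutoff' a b k s * h' k s)
       = (LBINT s:{a..m}. cutoff' a b k s * h' k s) + (LBINT s:{m..b}. cutoff' a b k s * h' k s)"
    proof (rule set_integral_Un_AE[OF _ _ _ il ir])
      show "AE x in lborel. \<not> (x \<in> {a..m} \<and> x \<in> {m..b})"
        using AE_lborel_singleton[of m] by eventually_elim auto
    qed auto
    moreover have "(LBINT s:{m..b}. - cutoff' a b k s * h' k s) = - (LBINT s:{m..b}. cutoff' a b k s * h' k s)"
      using set_integral_uminus[OF ir] by simp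
    ultimately show ?thesis by simp
  qed
  show ?thesis unfolding split by (intro tendsto_diff L R)
qed

section \<open>Integration by parts for weak derivatives\<close>

lemma square_integrable_imp_integrable:
  assumes "square_integrable D f" "D \<in> sets lborel" "emeasure lborel D < \<infinity>"
  shows "set_integrable lborel D f"
proof (rule set_integrable_bound)
  show "set_integrable lborel D (\<lambda>x. 1 + (norm (f x))\<^sup>2)"
    using assms by (intro set_integral_add(1))
      (auto simp: square_integrable_def set_integrable_def less_top)
  show "set_borel_measurable lborel D f" using assms by (simp add: square_integrable_def)
  have "u \<le> 1 + u\<^sup>2" for u :: real
  proof -
    have "0 \<le> (u - 1)\<^sup>2 + u\<^sup>2 + 1" by simp
    then show ?thesis by (simp add: power2_eq_square algebra_simps)
  qed
  then show "AE x in lborel. x \<in> D \<longrightarrow> norm (f x) \<le> norm (1 + (norm (f x))\<^sup>2)"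
    by (auto intro!: AE_I2 order_trans[OF _ abs_ge_self])
qed

lemma weak_derivative:
  assumes "f \<in> W2 D" "e \<in> Basis"
  shows "square_integrable D (weak_derivative D e f)"
    and "has_weak_derivative D e f (weak_derivative D e f)"
proof -
  from assms have "\<exists>g. square_integrable D g \<and> has_weak_derivative D e f g"
    by (auto simp: W2_def)
  from someI_ex[OF this] show "square_integrable D (weak_derivative D e f)"
    and "has_weak_derivative D e f (weak_derivative D e f)"
    by (simp_all add: weak_derivative_def)
qed

text \<open>Provides the concrete states to which the two operator inequalities are applied. The
  weak derivative is the classical one: integrate the derivative of the product with a test
  function, which vanishes at both ends.\<close>

lemma C1_in_W2:
  fixes \<phi> :: "real \<Rightarrow> 'b::euclidean_space"
  assumes d: "\<And>s. (\<phi> has_vector_derivative \<phi>' s) (at s)" and c: "continuous_on UNIV \<phi>'"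
    and ab: "a \<le> b"
  shows "\<phi> \<in> W2 {a..b}"
proof -
  have c\<phi>: "continuous_on A \<phi>" for A
    using d by (auto intro!: continuous_at_imp_continuous_on has_vector_derivative_continuous)
  have c\<phi>': "continuous_on A \<phi>'" for A using c continuous_on_subset by blast
  have sq: "square_integrable {a..b} f" if "continuous_on {a..b} f" for f :: "real \<Rightarrow> 'b"
    using that unfolding square_integrable_def
    by (auto intro!: set_borel_measurable_compact set_integrable_compact continuous_intros)
  have "has_weak_derivative {a..b} 1 \<phi> \<phi>'"
    unfolding has_weak_derivative_def
  proof (intro allI impI)
    fix \<eta> :: "real \<Rightarrow> real" assume \<eta>: "test_function {a..b} \<eta>"
    define \<eta>' where "\<eta>' s = frechet_derivative \<eta> (at s) 1" for s
    have d\<eta>: "(\<eta> has_vector_derivative \<eta>' s) (at s)" for s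
    proof -
      have "\<eta> differentiable (at s)" using \<eta> by (simp add: test_function_def)
      then have *: "(\<eta> has_derivative frechet_derivative \<eta> (at s)) (at s)"
        by (simp add: frechet_derivative_works)
      then have "frechet_derivative \<eta> (at s) h = h *\<^sub>R \<eta>' s" for h
        using linear_simps(5)[OF has_derivative_bounded_linear[OF *], of h 1] by (simp add: \<eta>'_def)
      then have "frechet_derivative \<eta> (at s) = (\<lambda>h. h *\<^sub>R \<eta>' s)" by blast
      with * show ?thesis by (simp add: has_vector_derivative_def)
    qed
    have c\<eta>': "continuous_on {a..b} \<eta>'"
      using \<eta> unfolding test_function_def \<eta>'_def by (blast intro: continuous_on_subset)
    have c\<eta>: "continuous_on {a..b} \<eta>"
      using d\<eta> by (auto intro!: continuous_at_imp_continuous_on has_vector_derivative_continuous)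
    have "\<eta> s = 0" if "s \<notin> {a<..<b}" for s
      using \<eta> that by (auto simp: test_function_def interior_atLeastAtMost_real)
    then have "\<eta> a = 0" "\<eta> b = 0" by auto
    have "(LBINT s:{a..b}. \<eta> s *\<^sub>R \<phi>' s + \<eta>' s *\<^sub>R \<phi> s) = \<eta> b *\<^sub>R \<phi> b - \<eta> a *\<^sub>R \<phi> a"
      unfolding set_lebesgue_integral_def
    proof (rule integral_FTC_atLeastAtMost[OF ab])
      show "((\<lambda>s. \<eta> s *\<^sub>R \<phi> s) has_vector_derivative \<eta> x *\<^sub>R \<phi>' x + \<eta>' x *\<^sub>R \<phi> x) (at x within {a..b})" for x
        using d d\<eta> unfolding has_real_derivative_iff_has_vector_derivative[symmetric]
        by (intro has_vector_derivative_at_within[OF has_vector_derivative_scaleR])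
    qed (intro continuous_intros c\<phi> c\<phi>' c\<eta> c\<eta>')
    then have "(LBINT s:{a..b}. \<eta> s *\<^sub>R \<phi>' s) + (LBINT s:{a..b}. \<eta>' s *\<^sub>R \<phi> s) = 0"
      using \<open>\<eta> a = 0\<close> \<open>\<eta> b = 0\<close>
      by (subst (asm) set_integral_add(2))
        (auto intro!: set_integrable_compact continuous_intros c\<phi> c\<phi>' c\<eta> c\<eta>')
    then show "(LBINT x:{a..b}. frechet_derivative \<eta> (at x) 1 *\<^sub>R \<phi> x) = - (LBINT x:{a..b}. \<eta> x *\<^sub>R \<phi>' x)"
      by (simp add: \<eta>'_def add_eq_0_iff)
  qed
  then show ?thesis using sq[OF c\<phi>] sq[OF c\<phi>'] c\<phi> by (auto simp: W2_def)
qed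

lemma set_borel_measurable_mult_continuous:
  fixes f :: "'a::euclidean_space \<Rightarrow> 'b::euclidean_space" and \<eta> :: "'a \<Rightarrow> real"
  assumes "set_borel_measurable lborel A f" "continuous_on A \<eta>" "compact A"
  shows "set_borel_measurable lborel A (\<lambda>x. \<eta> x *\<^sub>R f x)"
proof -
  have "(\<lambda>x. (indicator A x *\<^sub>R \<eta> x) *\<^sub>R (indicator A x *\<^sub>R f x)) \<in> borel_measurable lborel"
    using assms(1) set_borel_measurable_compact[OF assms(3,2)] unfolding set_borel_measurable_def
    by (rule borel_measurable_scaleR[rotated])
  also have "(\<lambda>x. (indicator A x *\<^sub>R \<eta> x) *\<^sub>R (indicator A x *\<^sub>R f x)) = (\<lambda>x. indicator A x *\<^sub>R (\<eta> x *\<^sub>R f x))"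
    by (auto simp: indicator_def)
  finally show ?thesis unfolding set_borel_measurable_def .
qed

lemma set_integrable_mult_continuous:
  fixes f :: "'a::euclidean_space \<Rightarrow> 'b::euclidean_space" and \<eta> :: "'a \<Rightarrow> real"
  assumes "set_integrable lborel A f" "continuous_on A \<eta>" "compact A"
  shows "set_integrable lborel A (\<lambda>x. \<eta> x *\<^sub>R f x)"
proof -
  have m: "set_borel_measurable lborel A f"
    using assms(1) by (simp add: set_integrable_def set_borel_measurable_def)
  have "compact (\<eta> ` A)" using assms by (intro compact_continuous_image)
  then obtain C where C: "\<And>x. x \<in> A \<Longrightarrow> \<bar>\<eta> x\<bar> \<le> C"
    by (fastforce dest: compact_imp_bounded simp: bounded_iff)
  show ?thesis
  proof (rule set_integrable_bound)
    show "set_integrable lborel A (\<lambda>x. C *\<^sub>R f x)" using assms by simp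
    show "AE x in lborel. x \<in> A \<longrightarrow> norm (\<eta> x *\<^sub>R f x) \<le> norm (C *\<^sub>R f x)"
      using C by (auto intro!: AE_I2 mult_right_mono order_trans[OF _ abs_ge_self])
  qed (rule set_borel_measurable_mult_continuous[OF m assms(2,3)])
qed

text \<open>Here \<eta> need not vanish at the ends. The weak derivative is tested with \<eta> times
  a cutoff; the term in which the cutoff is differentiated converges to the boundary values, the
  others converge by dominated convergence. The functional \<open>T\<close> reduces vector-valued
  functions to scalar ones.\<close>

lemma weak_integration_by_parts:
  fixes f g :: "real \<Rightarrow> 'b::euclidean_space" and \<eta> \<eta>' :: "real \<Rightarrow> real" and T :: "'b \<Rightarrow> real"
  assumes ab: "a < b" and f: "continuous_on {a..b} f" and g: "set_integrable lborel {a..b} g"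
    and w: "has_weak_derivative {a..b} 1 f g" and T: "bounded_linear T"
    and \<eta>: "\<And>s. (\<eta> has_real_derivative \<eta>' s) (at s)" and c: "continuous_on UNIV \<eta>'"
  shows "(LBINT s:{a..b}. \<eta>' s * T (f s)) = \<eta> b * T (f b) - \<eta> a * T (f a) - (LBINT s:{a..b}. \<eta> s * T (g s))"
proof -
  note lin = linear_simps[OF T]
  have c\<eta>: "continuous_on A \<eta>" for A using \<eta> by (meson DERIV_continuous_on has_field_derivative_at_within)
  have c\<eta>': "continuous_on A \<eta>'" for A using c continuous_on_subset by blast
  have cT: "continuous_on {a..b} (\<lambda>s. T (f s))"
    using T f by (simp add: linear_continuous_on_compose bounded_linear.linear)
  have mTg: "set_integrable lborel {a..b} (\<lambda>s. T (g s))"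
    by (rule set_integral_bounded_linear[OF T g])
  let ?\<chi> = "cutoff a b" and ?\<chi>' = "cutoff' a b"
  have eq: "(LBINT s:{a..b}. ?\<chi>' k s * (\<eta> s * T (f s))) + (LBINT s:{a..b}. ?\<chi> k s * (\<eta>' s * T (f s)))
      = - (LBINT s:{a..b}. ?\<chi> k s * (\<eta> s * T (g s)))" for k
  proof -
    define p where "p s = ?\<chi> k s * \<eta> s" for s
    define p' where "p' s = ?\<chi>' k s * \<eta> s + ?\<chi> k s * \<eta>' s" for s
    have dp: "(p has_real_derivative p' s) (at s)" for s
      unfolding p_def[abs_def] p'_def
      by (auto intro!: derivative_eq_intros cutoff_deriv \<eta>)
    have fp: "frechet_derivative p (at s) = (\<lambda>h. p' s * h)" for s
      using dp[of s] by (simp add: has_field_derivative_def frechet_derivative_at[symmetric])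
    have cp': "continuous_on A p'" for A
      unfolding p'_def by (intro continuous_intros continuous_cutoff continuous_cutoff' c\<eta> c\<eta>')
    have "test_function {a..b} p"
      unfolding test_function_def
    proof (intro conjI allI)
      show "\<exists>K. compact K \<and> K \<subseteq> interior {a..b} \<and> (\<forall>x. x \<notin> K \<longrightarrow> p x = 0)"
        using cutoff_support[OF ab, of k] by (auto simp: p_def interior_atLeastAtMost_real)
      show "p differentiable (at x)" for x using dp real_differentiable_def by blast
      show "continuous_on UNIV (\<lambda>x. frechet_derivative p (at x) v)" for v
        unfolding fp by (intro continuous_intros cp')
    qed
    with w have "(LBINT s:{a..b}. frechet_derivative p (at s) 1 *\<^sub>R f s) = - (LBINT s:{a..b}. p s *\<^sub>R g s)"
      unfolding has_weak_derivative_def by blast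
    then have *: "(LBINT s:{a..b}. p' s *\<^sub>R f s) = - (LBINT s:{a..b}. p s *\<^sub>R g s)"
      unfolding fp by simp
    have i1: "set_integrable lborel {a..b} (\<lambda>s. p' s *\<^sub>R f s)"
      by (intro borel_integrable_atLeastAtMost' continuous_intros cp' f)
    have i2: "set_integrable lborel {a..b} (\<lambda>s. p s *\<^sub>R g s)"
      unfolding p_def by (intro set_integrable_mult_continuous g continuous_intros continuous_cutoff c\<eta>) auto
    from arg_cong[OF *, of T] have "(LBINT s:{a..b}. p' s * T (f s)) = - (LBINT s:{a..b}. p s * T (g s))"
      by (simp add: set_integral_bounded_linear(2)[OF T i1, symmetric]
          set_integral_bounded_linear(2)[OF T i2, symmetric] lin)
    moreover have "(LBINT s:{a..b}. p' s * T (f s)) = (LBINT s:{a..b}. ?\<chi>' k s * (\<eta> s * T (f s)) + ?\<chi> k s * (\<eta>' s * T (f s)))"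
      by (simp add: p'_def algebra_simps)
    moreover have "\<dots> = (LBINT s:{a..b}. ?\<chi>' k s * (\<eta> s * T (f s))) + (LBINT s:{a..b}. ?\<chi> k s * (\<eta>' s * T (f s)))"
      by (intro set_integral_add borel_integrable_atLeastAtMost' continuous_intros continuous_cutoff continuous_cutoff' c\<eta> c\<eta>' cT)
    ultimately show ?thesis by (simp add: p_def algebra_simps)
  qed
  have L1: "(\<lambda>k. LBINT s:{a..b}. ?\<chi>' k s * (\<eta> s * T (f s))) \<longlonglongrightarrow> \<eta> a * T (f a) - \<eta> b * T (f b)"
    by (rule cutoff'_delta[OF ab, where h = "\<lambda>s. \<eta> s * T (f s)"])
      (auto intro!: continuous_intros c\<eta> cT uniform_limit_const)
  have dom: "(\<lambda>k. LBINT s:{a..b}. ?\<chi> k s * u s) \<longlonglongrightarrow> (LBINT s:{a..b}. u s)"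
    if u: "set_integrable lborel {a..b} u" for u :: "real \<Rightarrow> real"
  proof (rule set_integral_dominated_convergence[where w = "\<lambda>s. \<bar>u s\<bar>"])
    have m: "set_borel_measurable lborel {a..b} u"
      using u by (simp add: set_integrable_def set_borel_measurable_def)
    show "set_borel_measurable lborel {a..b} u" by fact
    show "set_borel_measurable lborel {a..b} (\<lambda>s. ?\<chi> k s * u s)" for k
      using set_borel_measurable_mult_continuous[OF m continuous_cutoff[of _ a b k]] by simp
    show "set_integrable lborel {a..b} (\<lambda>s. \<bar>u s\<bar>)" by (rule set_integrable_abs[OF u])
    show "AE s in lborel. s \<in> {a..b} \<longrightarrow> (\<lambda>k. ?\<chi> k s * u s) \<longlonglongrightarrow> u s"
      using AE_lborel_singleton[of a] AE_lborel_singleton[of b]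
    proof eventually_elim
      case (elim s)
      show ?case
      proof
        assume "s \<in> {a..b}"
        with elim have "s \<in> {a<..<b}" by auto
        from tendsto_mult[OF cutoff_tendsto[OF this] tendsto_const[of "u s"]]
        show "(\<lambda>k. ?\<chi> k s * u s) \<longlonglongrightarrow> u s" by simp
      qed
    qed
    show "AE s in lborel. s \<in> {a..b} \<longrightarrow> norm (?\<chi> k s * u s) \<le> \<bar>u s\<bar>" for k
      using cutoff_range[of a b k] by (auto intro!: AE_I2 mult_left_le_one_le simp: abs_mult)
  qed
  have L2: "(\<lambda>k. LBINT s:{a..b}. ?\<chi> k s * (\<eta>' s * T (f s))) \<longlonglongrightarrow> (LBINT s:{a..b}. \<eta>' s * T (f s))"
    by (intro dom borel_integrable_atLeastAtMost' continuous_intros c\<eta>' cT)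
  have L3: "(\<lambda>k. - (LBINT s:{a..b}. ?\<chi> k s * (\<eta> s * T (g s)))) \<longlonglongrightarrow> - (LBINT s:{a..b}. \<eta> s * T (g s))"
    using set_integrable_mult_continuous[OF mTg c\<eta>] by (intro tendsto_minus dom) auto
  have "(\<lambda>k. - (LBINT s:{a..b}. ?\<chi> k s * (\<eta> s * T (g s)))) \<longlonglongrightarrow>
       (\<eta> a * T (f a) - \<eta> b * T (f b)) + (LBINT s:{a..b}. \<eta>' s * T (f s))"
    using tendsto_add[OF L1 L2] unfolding eq .
  from LIMSEQ_unique[OF this L3] show ?thesis by simp
qed

section \<open>Matrix-valued integration by parts, on an interval and on a square\<close>

lemma inner_matrix_vector_sum:
  fixes u :: "real^'n" and v :: "real^'m"
  shows "u \<bullet> (M *v v) = (\<Sum>i\<in>UNIV. \<Sum>j\<in>UNIV. (u $ i * v $ j) * M $ i $ j)"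
  by (simp add: inner_vec_def matrix_vector_mult_def sum_distrib_left mult_ac)

lemma bounded_linear_entry: "bounded_linear (\<lambda>M. M $ i $ j :: real)"
  by (intro bounded_linear_compose[OF bounded_linear_vec_nth] bounded_linear_vec_nth)

lemma has_vector_derivative_component:
  fixes u :: "real \<Rightarrow> real^'n"
  assumes "(u has_vector_derivative u') F"
  shows "((\<lambda>t. u t $ i) has_real_derivative u' $ i) F"
  using bounded_linear.has_vector_derivative[OF bounded_linear_vec_nth assms]
  by (simp add: has_real_derivative_iff_has_vector_derivative)

text \<open>Expanding into entries reduces to the scalar rule with \<eta> = u_i v_j and
  \<open>T\<close> the (i,j) entry. This way no product rule for weak derivatives is required: the
  smooth vectors go into \<eta> and only \<open>M\<close> is differentiated weakly.\<close>

lemma weak_integration_by_parts_matrix: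
  fixes M M' :: "real \<Rightarrow> real^'n^'n" and u v u' v' :: "real \<Rightarrow> real^'n"
  assumes ab: "a < b" and M: "continuous_on {a..b} M" and M': "set_integrable lborel {a..b} M'"
    and w: "has_weak_derivative {a..b} 1 M M'"
    and u: "\<And>s. (u has_vector_derivative u' s) (at s)" "continuous_on UNIV u'"
    and v: "\<And>s. (v has_vector_derivative v' s) (at s)" "continuous_on UNIV v'"
  shows "(LBINT s:{a..b}. u' s \<bullet> (M s *v v s) + u s \<bullet> (M s *v v' s))
    = u b \<bullet> (M b *v v b) - u a \<bullet> (M a *v v a) - (LBINT s:{a..b}. u s \<bullet> (M' s *v v s))"
proof -
  have cu: "continuous_on A u" and cv: "continuous_on A v" for A
    using u v by (auto intro!: continuous_at_imp_continuous_on has_vector_derivative_continuous)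
  have cu': "continuous_on A u'" and cv': "continuous_on A v'" for A
    using u v continuous_on_subset by blast+
  have ibp: "(LBINT s:{a..b}. (u' s $ i * v s $ j + u s $ i * v' s $ j) * M s $ i $ j)
     = (u b $ i * v b $ j) * M b $ i $ j - (u a $ i * v a $ j) * M a $ i $ j
       - (LBINT s:{a..b}. (u s $ i * v s $ j) * M' s $ i $ j)" for i j
    by (rule weak_integration_by_parts[OF ab M M' w bounded_linear_entry])
      (auto intro!: derivative_eq_intros has_vector_derivative_component u v continuous_intros cu cv cu' cv')
  have i1: "set_integrable lborel {a..b} (\<lambda>s. (u' s $ i * v s $ j + u s $ i * v' s $ j) * M s $ i $ j)" for i j
    by (intro borel_integrable_atLeastAtMost' continuous_intros cu cv cu' cv' M)
  have i2: "set_integrable lborel {a..b} (\<lambda>s. (u s $ i * v s $ j) * M' s $ i $ j)" for i j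
    unfolding real_scaleR_def[symmetric]
    by (intro set_integrable_mult_continuous set_integral_bounded_linear(1)[OF bounded_linear_entry M'])
      (auto intro!: continuous_intros cu cv)
  have "(LBINT s:{a..b}. u' s \<bullet> (M s *v v s) + u s \<bullet> (M s *v v' s))
     = (LBINT s:{a..b}. (\<Sum>i\<in>UNIV. \<Sum>j\<in>UNIV. (u' s $ i * v s $ j + u s $ i * v' s $ j) * M s $ i $ j))"
    by (simp add: inner_matrix_vector_sum sum.distrib[symmetric] distrib_right)
  also have "\<dots> = (\<Sum>i\<in>UNIV. \<Sum>j\<in>UNIV. LBINT s:{a..b}. (u' s $ i * v s $ j + u s $ i * v' s $ j) * M s $ i $ j)"
    by (simp add: set_integral_sum i1)
  also have "\<dots> = u b \<bullet> (M b *v v b) - u a \<bullet> (M a *v v a) - (\<Sum>i\<in>UNIV. \<Sum>j\<in>UNIV. LBINT s:{a..b}. (u s $ i * v s $ j) * M' s $ i $ j)"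
    by (simp add: ibp inner_matrix_vector_sum sum_subtractf)
  also have "(\<Sum>i\<in>UNIV. \<Sum>j\<in>UNIV. LBINT s:{a..b}. (u s $ i * v s $ j) * M' s $ i $ j) = (LBINT s:{a..b}. u s \<bullet> (M' s *v v s))"
    by (simp add: inner_matrix_vector_sum set_integral_sum i2)
  finally show ?thesis .
qed

lemma set_Fubini:
  fixes f :: "'a::euclidean_space \<times> 'b::euclidean_space \<Rightarrow> 'c::{banach, second_countable_topology}"
  assumes "set_integrable lborel (A \<times> B) f"
  shows "(LBINT x:A. LBINT y:B. f (x, y)) = (LBINT z:A \<times> B. f z)"
    and "set_integrable lborel A (\<lambda>x. LBINT y:B. f (x, y))"
proof -
  have i: "integrable (lborel \<Otimes>\<^sub>M lborel) (\<lambda>(x, y). indicator (A \<times> B) (x, y) *\<^sub>R f (x, y))"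
    using assms unfolding set_integrable_def lborel_prod by (simp only: case_prod_beta' prod.collapse)
  have eq: "(\<integral>y. indicat_real (A \<times> B) (x, y) *\<^sub>R f (x, y) \<partial>lborel) = indicator A x *\<^sub>R (LBINT y:B. f (x, y))" for x
    by (cases "x \<in> A") (simp_all add: indicator_times set_lebesgue_integral_def)
  show "(LBINT x:A. LBINT y:B. f (x, y)) = (LBINT z:A \<times> B. f z)"
    using lborel_pair.integral_fst[OF i] unfolding eq lborel_prod
    by (simp add: set_lebesgue_integral_def case_prod_beta')
  show "set_integrable lborel A (\<lambda>x. LBINT y:B. f (x, y))"
    using lborel_pair.integrable_fst[OF i] unfolding eq set_integrable_def .
qed

lemma norm_matrix_vector_mult_le:
  fixes M :: "real^'n^'m" and x :: "real^'n"
  shows "norm (M *v x) \<le> norm M * norm x"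
proof -
  have "norm (M *v x) \<le> L2_set (\<lambda>i. norm (M $ i) * norm x) UNIV"
    unfolding norm_vec_def[of "M *v x"]
    by (rule L2_set_mono) (simp_all add: matrix_vector_mul_component Cauchy_Schwarz_ineq2)
  also have "\<dots> = norm M * norm x"
    by (simp add: norm_vec_def[of M] L2_set_left_distrib)
  finally show ?thesis .
qed

lemma bounded_bilinear_matrix_vector_mult:
  "bounded_bilinear ((*v) :: real^'n^'m \<Rightarrow> real^'n \<Rightarrow> real^'m)"
proof
  show "\<exists>K. \<forall>(M::real^'n^'m) x. norm (M *v x) \<le> norm M * norm x * K"
    using norm_matrix_vector_mult_le by (metis mult.right_neutral)
qed (simp_all add: matrix_vector_mult_add_rdistrib matrix_vector_right_distrib
      matrix_vector_mult_scaleR scaleR_matrix_vector_assoc)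

lemmas continuous_on_matrix_vector_mult [continuous_intros] =
  bounded_bilinear.continuous_on[OF bounded_bilinear_matrix_vector_mult]

lemma inner_transpose_mult:
  fixes u :: "real^'n" and v :: "real^'n"
  shows "u \<bullet> (transpose M *v v) = v \<bullet> (M *v u)"
  by (simp add: transpose_matrix_vector inner_commute[of u] dot_lmul_matrix)

lemma set_integral_swap:
  fixes f :: "'a::euclidean_space \<times> 'a \<Rightarrow> 'b::{banach, second_countable_topology}"
  assumes "set_integrable lborel (A \<times> A) f"
  shows "(LBINT z:A \<times> A. f (snd z, fst z)) = (LBINT z:A \<times> A. f z)"
proof -
  have m: "(\<lambda>z. indicat_real (A \<times> A) z *\<^sub>R f z) \<in> borel_measurable (lborel \<Otimes>\<^sub>M lborel)"
    using borel_measurable_integrable[OF assms[unfolded set_integrable_def]] by (simp add: lborel_prod)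
  have eq: "(\<lambda>(x, y). indicat_real (A \<times> A) (y, x) *\<^sub>R f (y, x))
      = (\<lambda>z. indicat_real (A \<times> A) z *\<^sub>R f (snd z, fst z))"
    by (auto simp: indicator_def)
  show ?thesis
    using lborel_pair.integral_product_swap[OF m] unfolding eq
    by (simp add: lborel_prod set_lebesgue_integral_def)
qed

text \<open>Reflecting the square in its diagonal exchanges \<open>u\<close> and \<open>v\<close>,
  and the transpose produced by the symmetry of the kernel moves the matrix back to the other
  factor.\<close>

lemma symmetric_kernel_swap:
  fixes R :: "real \<times> real \<Rightarrow> real^'n^'n" and u v :: "real \<Rightarrow> real^'n"
  assumes Rc: "continuous_on ({a..b} \<times> {a..b}) R"
    and sym: "\<And>s \<theta>. s \<in> {a..b} \<Longrightarrow> \<theta> \<in> {a..b} \<Longrightarrow> R (s, \<theta>) = transpose (R (\<theta>, s))"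
    and u: "continuous_on {a..b} u" and v: "continuous_on {a..b} v"
  shows "(LBINT z:{a..b} \<times> {a..b}. u (fst z) \<bullet> (R z *v v (snd z)))
    = (LBINT z:{a..b} \<times> {a..b}. v (fst z) \<bullet> (R z *v u (snd z)))"
proof -
  let ?Q = "{a..b} \<times> {a..b}"
  have "continuous_on ?Q (\<lambda>z. u (fst z))" "continuous_on ?Q (\<lambda>z. v (snd z))"
    by (auto intro!: continuous_on_compose2[OF u] continuous_on_compose2[OF v] continuous_intros)
  then have "set_integrable lborel ?Q (\<lambda>z. u (fst z) \<bullet> (R z *v v (snd z)))"
    by (intro set_integrable_compact compact_Times compact_Icc continuous_intros Rc)
  from set_integral_swap[OF this]
  have "(LBINT z:?Q. u (fst z) \<bullet> (R z *v v (snd z))) = (LBINT z:?Q. u (snd z) \<bullet> (R (snd z, fst z) *v v (fst z)))"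
    by simp
  also have "\<dots> = (LBINT z:?Q. v (fst z) \<bullet> (R z *v u (snd z)))"
  proof (rule set_lebesgue_integral_cong)
    have "u \<theta> \<bullet> (R (\<theta>, s) *v v s) = v s \<bullet> (R (s, \<theta>) *v u \<theta>)" if "s \<in> {a..b}" "\<theta> \<in> {a..b}" for s \<theta>
      unfolding sym[OF that] by (rule inner_transpose_mult[symmetric])
    then show "\<forall>z. z \<in> ?Q \<longrightarrow> u (snd z) \<bullet> (R (snd z, fst z) *v v (fst z)) = v (fst z) \<bullet> (R z *v u (snd z))"
      by auto
  qed (auto intro: borel_compact compact_Times)
  finally show ?thesis .
qed

text \<open>Products p_i(s) p_j(\<theta>) are test functions on the square, so each partial
  derivative can be tested entrywise. The two identities have equal left sides by symmetry of
  \<open>R\<close>; adding them yields the factor 2 and the sum of the partial derivatives, which is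
  the kernel E.\<close>

lemma weak_kernel_test:
  fixes R G1 G2 :: "real \<times> real \<Rightarrow> real^'n^'n" and p p' :: "real \<Rightarrow> real^'n"
  assumes Rc: "continuous_on ({a..b} \<times> {a..b}) R"
    and G1: "set_integrable lborel ({a..b} \<times> {a..b}) G1" "has_weak_derivative ({a..b} \<times> {a..b}) (1, 0) R G1"
    and G2: "set_integrable lborel ({a..b} \<times> {a..b}) G2" "has_weak_derivative ({a..b} \<times> {a..b}) (0, 1) R G2"
    and sym: "\<And>s \<theta>. s \<in> {a..b} \<Longrightarrow> \<theta> \<in> {a..b} \<Longrightarrow> R (s, \<theta>) = transpose (R (\<theta>, s))"
    and p: "\<And>s. (p has_vector_derivative p' s) (at s)" "continuous_on UNIV p'"
    and K: "compact K" "K \<subseteq> {a<..<b}" "\<And>s. s \<notin> K \<Longrightarrow> p s = 0"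
  shows "2 * (LBINT z:{a..b} \<times> {a..b}. p' (fst z) \<bullet> (R z *v p (snd z)))
    = - (LBINT z:{a..b} \<times> {a..b}. p (fst z) \<bullet> ((G1 z + G2 z) *v p (snd z)))"
proof -
  let ?Q = "{a..b} \<times> {a..b}"
  have Q: "compact ?Q" by (intro compact_Times compact_Icc)
  have cp: "continuous_on A p" for A
    using p by (auto intro!: continuous_at_imp_continuous_on has_vector_derivative_continuous)
  have cp': "continuous_on A p'" for A using p continuous_on_subset by blast
  have cc: "continuous_on A (\<lambda>z. p (fst z) $ i)" "continuous_on A (\<lambda>z. p (snd z) $ i)"
    "continuous_on A (\<lambda>z. p' (fst z) $ i)" "continuous_on A (\<lambda>z. p' (snd z) $ i)" for i and A :: "(real \<times> real) set"
    by (auto intro!: continuous_intros continuous_on_compose2[OF cp[of UNIV]] continuous_on_compose2[OF cp'[of UNIV]])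
  \<comment> \<open>One computation for both directions: \<open>e\<close> = (1, 0) keeps only the
    first summand of the derivative of the product, \<open>e\<close> = (0, 1) only the
    second.\<close>
  have base: "(LBINT z:?Q. (p' (fst z) $ i * fst e * p (snd z) $ j + p (fst z) $ i * (p' (snd z) $ j * snd e)) * R z $ i $ j)
    = - (LBINT z:?Q. (p (fst z) $ i * p (snd z) $ j) * G z $ i $ j)"
    if G: "set_integrable lborel ?Q G" "has_weak_derivative ?Q e R G" for e and G :: "real \<times> real \<Rightarrow> real^'n^'n" and i j
  proof -
    define \<eta> where "\<eta> z = p (fst z) $ i * p (snd z) $ j" for z
    define D where "D z h = p' (fst z) $ i * fst h * p (snd z) $ j + p (fst z) $ i * (p' (snd z) $ j * snd h)" for z h
    have dc: "((\<lambda>s. p s $ i) has_real_derivative p' s $ i) (at s)" for s i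
      by (rule has_vector_derivative_component[OF p(1)])
    have d: "(\<eta> has_derivative D z) (at z)" for z
    proof -
      have "((\<lambda>z. p (fst z) $ i) has_derivative (\<lambda>h. p' (fst z) $ i * fst h)) (at z)"
        "((\<lambda>z. p (snd z) $ j) has_derivative (\<lambda>h. p' (snd z) $ j * snd h)) (at z)"
        by (rule has_derivative_compose[OF has_derivative_fst[OF has_derivative_ident] dc[unfolded has_field_derivative_def]],
            rule has_derivative_compose[OF has_derivative_snd[OF has_derivative_ident] dc[unfolded has_field_derivative_def]])
      from has_derivative_mult[OF this] show ?thesis
        unfolding \<eta>_def[abs_def] D_def[abs_def] by (simp add: algebra_simps)
    qed
    have fd: "frechet_derivative \<eta> (at z) = D z" for z
      using d[of z] by (rule frechet_derivative_at[symmetric])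
    have cD: "continuous_on A (\<lambda>z. D z h)" for A h
      unfolding D_def by (intro continuous_intros cc)
    have c\<eta>: "continuous_on A \<eta>" for A
      unfolding \<eta>_def by (intro continuous_intros cc)
    have "test_function ?Q \<eta>"
      unfolding test_function_def
    proof (intro conjI allI)
      show "\<exists>K. compact K \<and> K \<subseteq> interior ?Q \<and> (\<forall>x. x \<notin> K \<longrightarrow> \<eta> x = 0)"
        using K by (intro exI[of _ "K \<times> K"])
          (auto simp: \<eta>_def interior_Times interior_atLeastAtMost_real intro!: compact_Times)
      show "\<eta> differentiable (at x)" for x using d differentiable_def by blast
      show "continuous_on UNIV (\<lambda>x. frechet_derivative \<eta> (at x) v)" for v
        unfolding fd by (rule cD)
    qed
    with G(2) have *: "(LBINT z:?Q. frechet_derivative \<eta> (at z) e *\<^sub>R R z) = - (LBINT z:?Q. \<eta> z *\<^sub>R G z)"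
      unfolding has_weak_derivative_def by blast
    have i1: "set_integrable lborel ?Q (\<lambda>z. D z e *\<^sub>R R z)"
      by (intro set_integrable_compact Q continuous_intros cD Rc)
    have i2: "set_integrable lborel ?Q (\<lambda>z. \<eta> z *\<^sub>R G z)"
      by (intro set_integrable_mult_continuous G c\<eta> Q)
    have "(LBINT z:?Q. (D z e *\<^sub>R R z) $ i $ j) = - (LBINT z:?Q. (\<eta> z *\<^sub>R G z) $ i $ j)"
      using arg_cong[OF *[unfolded fd], of "\<lambda>M. M $ i $ j"]
      by (simp only: set_integral_bounded_linear(2)[OF bounded_linear_entry i1]
          set_integral_bounded_linear(2)[OF bounded_linear_entry i2]) simp
    then show ?thesis by (simp add: D_def \<eta>_def)
  qed
  have iG: "set_integrable lborel ?Q (\<lambda>z. (p (fst z) $ i * p (snd z) $ j) * G z $ i $ j)"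
    if "set_integrable lborel ?Q G" for G :: "real \<times> real \<Rightarrow> real^'n^'n" and i j
    unfolding real_scaleR_def[symmetric]
    by (intro set_integrable_mult_continuous set_integral_bounded_linear(1)[OF bounded_linear_entry] that Q)
      (auto intro!: continuous_intros cc)
  have iR: "set_integrable lborel ?Q (\<lambda>z. (p' (fst z) $ i * p (snd z) $ j) * R z $ i $ j)"
    "set_integrable lborel ?Q (\<lambda>z. (p (fst z) $ i * p' (snd z) $ j) * R z $ i $ j)" for i j
    by (intro set_integrable_compact Q continuous_intros cc Rc)+
  have E: "(LBINT z:?Q. p (fst z) \<bullet> (G z *v p (snd z)))
       = (\<Sum>i\<in>UNIV. \<Sum>j\<in>UNIV. LBINT z:?Q. (p (fst z) $ i * p (snd z) $ j) * G z $ i $ j)"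
    if "set_integrable lborel ?Q G" for G :: "real \<times> real \<Rightarrow> real^'n^'n"
    by (simp add: inner_matrix_vector_sum set_integral_sum iG[OF that])
  have 1: "(LBINT z:?Q. p' (fst z) \<bullet> (R z *v p (snd z))) = - (LBINT z:?Q. p (fst z) \<bullet> (G1 z *v p (snd z)))"
    unfolding E[OF G1(1)] using base[OF G1] by (simp add: inner_matrix_vector_sum set_integral_sum iR sum_negf)
  have 2: "(LBINT z:?Q. p (fst z) \<bullet> (R z *v p' (snd z))) = - (LBINT z:?Q. p (fst z) \<bullet> (G2 z *v p (snd z)))"
    unfolding E[OF G2(1)] using base[OF G2] by (simp add: inner_matrix_vector_sum set_integral_sum iR sum_negf)
  have 3: "(LBINT z:?Q. p (fst z) \<bullet> (R z *v p' (snd z))) = (LBINT z:?Q. p' (fst z) \<bullet> (R z *v p (snd z)))"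
    by (rule symmetric_kernel_swap[OF Rc sym cp cp'])
  have "(LBINT z:?Q. p (fst z) \<bullet> ((G1 z + G2 z) *v p (snd z)))
     = (LBINT z:?Q. p (fst z) \<bullet> (G1 z *v p (snd z))) + (LBINT z:?Q. p (fst z) \<bullet> (G2 z *v p (snd z)))"
    unfolding matrix_vector_mult_add_rdistrib inner_add_right
    by (rule set_integral_add(2))
      (simp_all add: inner_matrix_vector_sum set_integral_sum iG G1 G2)
  then show ?thesis using 1 2 3 by simp
qed

lemma continuous_on_set_integral_param:
  fixes f :: "real \<times> real \<Rightarrow> 'b::euclidean_space"
  assumes "continuous_on ({a..b} \<times> {c..d}) f"
  shows "continuous_on {a..b} (\<lambda>s. LBINT \<theta>:{c..d}. f (s, \<theta>))"
proof -
  have "continuous_on {a..b} (\<lambda>s. integral (cbox c d) (\<lambda>\<theta>. f (s, \<theta>)))"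
    by (rule integral_continuous_on_param) (use assms in \<open>simp add: case_prod_beta'\<close>)
  moreover have "integral {c..d} (\<lambda>\<theta>. f (s, \<theta>)) = (LBINT \<theta>:{c..d}. f (s, \<theta>))" if "s \<in> {a..b}" for s
    using that
    by (intro set_borel_integral_eq_integral(2)[symmetric] set_integrable_compact compact_Icc
        continuous_on_compose2[OF assms] continuous_intros) auto
  ultimately show ?thesis
    by (simp only: cbox_interval cong: continuous_on_cong)
qed

text \<open>Multiplying a function bounded by C by the cutoff changes its integral by at most C
  times this quantity. Such a bound is uniform in any further parameter.\<close>

lemma cutoff_integral_tendsto:
  assumes "a < b"
  shows "(\<lambda>k. LBINT s:{a..b}. 1 - cutoff a b k s) \<longlonglongrightarrow> 0"
proof -
  have "(\<lambda>k. LBINT s:{a..b}. 1 - cutoff a b k s) \<longlonglongrightarrow> (LBINT s:{a..b}. (0::real))"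
  proof (rule set_integral_dominated_convergence[where w = "\<lambda>_. 1"])
    show "AE s in lborel. s \<in> {a..b} \<longrightarrow> (\<lambda>k. 1 - cutoff a b k s) \<longlonglongrightarrow> 0"
      using AE_lborel_singleton[of a] AE_lborel_singleton[of b]
    proof eventually_elim
      case (elim s)
      show ?case
      proof
        assume "s \<in> {a..b}"
        with elim have "s \<in> {a<..<b}" by auto
        from tendsto_diff[OF tendsto_const[of 1] cutoff_tendsto[OF this]]
        show "(\<lambda>k. 1 - cutoff a b k s) \<longlonglongrightarrow> 0" by simp
      qed
    qed
    show "AE s in lborel. s \<in> {a..b} \<longrightarrow> norm (1 - cutoff a b k s) \<le> 1" for k
      using cutoff_range[of a b k] by (auto simp: abs_le_iff)
  qed (auto intro!: set_borel_measurable_compact set_integrable_compact continuous_intros continuous_cutoff)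
  then show ?thesis by simp
qed

text \<open>Extends the compactly supported case to arbitrary C^1 functions by testing with cutoff
  times \<phi>. Where the derivative falls on the cutoff, the first variable is forced to the ends,
  while the second variable still carries its own cutoff. Both limits are taken simultaneously,
  which is why \<open>cutoff'_delta\<close> admits a varying function.\<close>

lemma weak_kernel_by_parts:
  fixes R G1 G2 :: "real \<times> real \<Rightarrow> real^'n^'n" and \<phi> \<phi>' :: "real \<Rightarrow> real^'n"
  assumes ab: "a < b"
    and Rc: "continuous_on ({a..b} \<times> {a..b}) R"
    and G1: "set_integrable lborel ({a..b} \<times> {a..b}) G1" "has_weak_derivative ({a..b} \<times> {a..b}) (1, 0) R G1"
    and G2: "set_integrable lborel ({a..b} \<times> {a..b}) G2" "has_weak_derivative ({a..b} \<times> {a..b}) (0, 1) R G2"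
    and sym: "\<And>s \<theta>. s \<in> {a..b} \<Longrightarrow> \<theta> \<in> {a..b} \<Longrightarrow> R (s, \<theta>) = transpose (R (\<theta>, s))"
    and \<phi>: "\<And>s. (\<phi> has_vector_derivative \<phi>' s) (at s)" "continuous_on UNIV \<phi>'"
  shows "2 * (LBINT z:{a..b} \<times> {a..b}. \<phi>' (fst z) \<bullet> (R z *v \<phi> (snd z)))
    = 2 * ((LBINT \<theta>:{a..b}. \<phi> b \<bullet> (R (b, \<theta>) *v \<phi> \<theta>)) - (LBINT \<theta>:{a..b}. \<phi> a \<bullet> (R (a, \<theta>) *v \<phi> \<theta>)))
      - (LBINT z:{a..b} \<times> {a..b}. \<phi> (fst z) \<bullet> ((G1 z + G2 z) *v \<phi> (snd z)))"
proof -
  let ?Q = "{a..b} \<times> {a..b}"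
  let ?\<chi> = "cutoff a b" and ?\<chi>' = "cutoff' a b"
  have Q: "compact ?Q" by (intro compact_Times compact_Icc)
  have c\<phi>: "continuous_on A \<phi>" for A
    using \<phi> by (auto intro!: continuous_at_imp_continuous_on has_vector_derivative_continuous)
  have c\<phi>': "continuous_on A \<phi>'" for A using \<phi> continuous_on_subset by blast
  note cont = continuous_intros continuous_on_compose2[OF c\<phi>[of UNIV]] continuous_on_compose2[OF c\<phi>'[of UNIV]]
    continuous_on_compose2[OF continuous_cutoff[of UNIV]] continuous_on_compose2[OF continuous_cutoff'[of UNIV]]
    subset_UNIV Rc
  \<comment> \<open>The cutoffs tend to 1 only in the open square; its boundary lies on four lines
    and is a null set.\<close>
  have AEQ: "AE z in lborel. z \<in> ?Q \<longrightarrow> fst z \<in> {a<..<b} \<and> snd z \<in> {a<..<b}"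
  proof -
    have B: "(1, 0) \<in> (Basis :: (real \<times> real) set)" "(0, 1) \<in> (Basis :: (real \<times> real) set)"
      by (auto simp: Basis_prod_def)
    show ?thesis
      using AE_lborel_inner_neq[OF B(1), of a] AE_lborel_inner_neq[OF B(1), of b]
        AE_lborel_inner_neq[OF B(2), of a] AE_lborel_inner_neq[OF B(2), of b]
      by eventually_elim (auto simp: inner_prod_def less_le)
  qed
  have dom: "(\<lambda>k. LBINT z:?Q. (?\<chi> k (fst z) * ?\<chi> k (snd z)) * u z) \<longlonglongrightarrow> (LBINT z:?Q. u z)"
    if u: "set_integrable lborel ?Q u" for u :: "real \<times> real \<Rightarrow> real"
  proof (rule set_integral_dominated_convergence[where w = "\<lambda>z. \<bar>u z\<bar>"])
    show m: "set_borel_measurable lborel ?Q u"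
      using u by (simp add: set_integrable_def set_borel_measurable_def)
    show "set_borel_measurable lborel ?Q (\<lambda>z. (?\<chi> k (fst z) * ?\<chi> k (snd z)) * u z)" for k
      unfolding real_scaleR_def[symmetric, of "?\<chi> k (fst _) * ?\<chi> k (snd _)"]
      by (intro set_borel_measurable_mult_continuous m Q cont)
    show "set_integrable lborel ?Q (\<lambda>z. \<bar>u z\<bar>)" by (rule set_integrable_abs[OF u])
    show "AE z in lborel. z \<in> ?Q \<longrightarrow> (\<lambda>k. (?\<chi> k (fst z) * ?\<chi> k (snd z)) * u z) \<longlonglongrightarrow> u z"
      using AEQ
    proof eventually_elim
      case (elim z)
      show ?case
      proof
        assume "z \<in> ?Q"
        with elim have "fst z \<in> {a<..<b}" "snd z \<in> {a<..<b}" by auto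
        from tendsto_mult[OF tendsto_mult[OF cutoff_tendsto[OF this(1)] cutoff_tendsto[OF this(2)]] tendsto_const[of "u z"]]
        show "(\<lambda>k. (?\<chi> k (fst z) * ?\<chi> k (snd z)) * u z) \<longlonglongrightarrow> u z" by simp
      qed
    qed
    show "AE z in lborel. z \<in> ?Q \<longrightarrow> norm ((?\<chi> k (fst z) * ?\<chi> k (snd z)) * u z) \<le> \<bar>u z\<bar>" for k
      using cutoff_range[of a b k]
      by (auto intro!: AE_I2 mult_left_le_one_le mult_le_one simp: abs_mult)
  qed
  define h where "h s = (LBINT \<theta>:{a..b}. \<phi> s \<bullet> (R (s, \<theta>) *v \<phi> \<theta>))" for s
  define hk where "hk k s = (LBINT \<theta>:{a..b}. ?\<chi> k \<theta> * (\<phi> s \<bullet> (R (s, \<theta>) *v \<phi> \<theta>)))" for k s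
  have cf: "continuous_on ?Q (\<lambda>z. \<phi> (fst z) \<bullet> (R z *v \<phi> (snd z)))"
    by (intro cont)
  have ch: "continuous_on {a..b} h"
    unfolding h_def using continuous_on_set_integral_param[OF cf] by simp
  have chk0: "continuous_on ?Q (\<lambda>z. ?\<chi> k (snd z) * (\<phi> (fst z) \<bullet> (R z *v \<phi> (snd z))))" for k
    by (intro cont)
  have chk: "continuous_on {a..b} (hk k)" for k
    unfolding hk_def using continuous_on_set_integral_param[OF chk0] by simp
  have "compact ((\<lambda>z. \<phi> (fst z) \<bullet> (R z *v \<phi> (snd z))) ` ?Q)"
    by (rule compact_continuous_image[OF cf Q])
  then obtain C where C: "\<And>z. z \<in> ?Q \<Longrightarrow> \<bar>\<phi> (fst z) \<bullet> (R z *v \<phi> (snd z))\<bar> \<le> C"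
    by (fastforce dest: compact_imp_bounded simp: bounded_iff)
  \<comment> \<open>\<open>C\<close> bounds the integrand on the whole square, so the error made by
    the cutoff in \<theta> is bounded independently of \<open>s\<close>.\<close>
  have unif: "uniform_limit {a..b} hk h sequentially"
  proof (rule uniform_limitI)
    fix e :: real assume "e > 0"
    have "(\<lambda>k. C * (LBINT s:{a..b}. 1 - ?\<chi> k s)) \<longlonglongrightarrow> C * 0"
      by (intro tendsto_mult tendsto_const cutoff_integral_tendsto[OF ab])
    then have "\<forall>\<^sub>F k in sequentially. C * (LBINT s:{a..b}. 1 - ?\<chi> k s) < e"
      using \<open>e > 0\<close> by (intro order_tendstoD(2)) auto
    then show "\<forall>\<^sub>F k in sequentially. \<forall>s\<in>{a..b}. dist (hk k s) (h s) < e"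
    proof eventually_elim
      case (elim k)
      have "dist (hk k s) (h s) \<le> C * (LBINT s:{a..b}. 1 - ?\<chi> k s)" if s: "s \<in> {a..b}" for s
      proof -
        have cs: "continuous_on {a..b} (\<lambda>\<theta>. \<phi> s \<bullet> (R (s, \<theta>) *v \<phi> \<theta>))"
          using s by (intro cont continuous_on_compose2[OF Rc]) auto
        have "hk k s - h s = (LBINT \<theta>:{a..b}. ?\<chi> k \<theta> * (\<phi> s \<bullet> (R (s, \<theta>) *v \<phi> \<theta>)) - \<phi> s \<bullet> (R (s, \<theta>) *v \<phi> \<theta>))"
          unfolding hk_def h_def
          by (subst set_integral_diff(2)) (auto intro!: set_integrable_compact cs cont continuous_cutoff)
        also have "\<bar>\<dots>\<bar> \<le> (LBINT \<theta>:{a..b}. C * (1 - ?\<chi> k \<theta>))"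
        proof (rule set_integral_abs_le)
          fix \<theta> assume \<theta>: "\<theta> \<in> {a..b}"
          let ?f = "\<phi> s \<bullet> (R (s, \<theta>) *v \<phi> \<theta>)"
          have "?\<chi> k \<theta> * ?f - ?f = - ((1 - ?\<chi> k \<theta>) * ?f)" by (simp add: algebra_simps)
          then have "\<bar>?\<chi> k \<theta> * ?f - ?f\<bar> = (1 - ?\<chi> k \<theta>) * \<bar>?f\<bar>"
            using cutoff_range[of a b k \<theta>] by (simp add: abs_mult)
          also have "\<dots> \<le> (1 - ?\<chi> k \<theta>) * C"
            using cutoff_range[of a b k \<theta>] C[of "(s, \<theta>)"] s \<theta> by (intro mult_left_mono) auto
          finally show "\<bar>?\<chi> k \<theta> * ?f - ?f\<bar> \<le> C * (1 - ?\<chi> k \<theta>)" by (simp add: mult.commute)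
        qed (auto intro!: set_integrable_compact set_integral_diff cs cont continuous_cutoff)
        finally show ?thesis by (simp add: dist_real_def)
      qed
      then show ?case using elim by fastforce
    qed
  qed
  have L1: "(\<lambda>k. LBINT s:{a..b}. ?\<chi>' k s * hk k s) \<longlonglongrightarrow> h a - h b"
    by (rule cutoff'_delta[OF ab ch chk unif])
  have L2: "(\<lambda>k. LBINT z:?Q. (?\<chi> k (fst z) * ?\<chi> k (snd z)) * (\<phi>' (fst z) \<bullet> (R z *v \<phi> (snd z))))
      \<longlonglongrightarrow> (LBINT z:?Q. \<phi>' (fst z) \<bullet> (R z *v \<phi> (snd z)))"
    by (intro dom set_integrable_compact Q cont)
  have iG: "set_integrable lborel ?Q (\<lambda>z. \<phi> (fst z) \<bullet> ((G1 z + G2 z) *v \<phi> (snd z)))"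
  proof -
    have i: "set_integrable lborel ?Q (\<lambda>z. G1 z + G2 z)" using G1 G2 by auto
    show ?thesis
      unfolding inner_matrix_vector_sum
    proof (intro set_integral_sum)
      fix i j
      show "set_integrable lborel ?Q (\<lambda>z. \<phi> (fst z) $ i * \<phi> (snd z) $ j * (G1 z + G2 z) $ i $ j)"
        unfolding real_scaleR_def[symmetric, of "\<phi> (fst _) $ i * \<phi> (snd _) $ j"]
        by (intro set_integrable_mult_continuous set_integral_bounded_linear(1)[OF bounded_linear_entry] i Q cont)
    qed
  qed
  have L3: "(\<lambda>k. LBINT z:?Q. (?\<chi> k (fst z) * ?\<chi> k (snd z)) * (\<phi> (fst z) \<bullet> ((G1 z + G2 z) *v \<phi> (snd z))))
      \<longlonglongrightarrow> (LBINT z:?Q. \<phi> (fst z) \<bullet> ((G1 z + G2 z) *v \<phi> (snd z)))"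
    by (rule dom[OF iG])
  have eq: "2 * ((LBINT s:{a..b}. ?\<chi>' k s * hk k s)
        + (LBINT z:?Q. (?\<chi> k (fst z) * ?\<chi> k (snd z)) * (\<phi>' (fst z) \<bullet> (R z *v \<phi> (snd z)))))
      = - (LBINT z:?Q. (?\<chi> k (fst z) * ?\<chi> k (snd z)) * (\<phi> (fst z) \<bullet> ((G1 z + G2 z) *v \<phi> (snd z))))" for k
  proof -
    obtain K where K: "compact K" "K \<subseteq> {a<..<b}" "\<And>s. s \<notin> K \<Longrightarrow> ?\<chi> k s = 0"
      using cutoff_support[OF ab, of k] by blast
    define p where "p s = ?\<chi> k s *\<^sub>R \<phi> s" for s
    define p' where "p' s = ?\<chi> k s *\<^sub>R \<phi>' s + ?\<chi>' k s *\<^sub>R \<phi> s" for s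
    have dp: "(p has_vector_derivative p' s) (at s)" for s
      unfolding p_def[abs_def] p'_def
      by (intro has_vector_derivative_scaleR cutoff_deriv \<phi>)
    have cp': "continuous_on UNIV p'"
      unfolding p'_def by (intro continuous_intros continuous_cutoff continuous_cutoff' c\<phi> c\<phi>')
    have *: "2 * (LBINT z:?Q. p' (fst z) \<bullet> (R z *v p (snd z)))
        = - (LBINT z:?Q. p (fst z) \<bullet> ((G1 z + G2 z) *v p (snd z)))"
      by (rule weak_kernel_test[OF Rc G1 G2 sym dp cp' K(1,2)]) (use K(3) in \<open>auto simp: p_def\<close>)
    have "(LBINT s:{a..b}. ?\<chi>' k s * hk k s)
        = (LBINT s:{a..b}. LBINT \<theta>:{a..b}. ?\<chi>' k (fst (s, \<theta>)) * (?\<chi> k (snd (s, \<theta>)) * (\<phi> (fst (s, \<theta>)) \<bullet> (R (s, \<theta>) *v \<phi> (snd (s, \<theta>))))))"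
      by (simp add: hk_def)
    also have "\<dots> = (LBINT z:?Q. ?\<chi>' k (fst z) * (?\<chi> k (snd z) * (\<phi> (fst z) \<bullet> (R z *v \<phi> (snd z)))))"
      by (rule set_Fubini(1)) (intro set_integrable_compact Q cont)
    finally have "(LBINT s:{a..b}. ?\<chi>' k s * hk k s)
        + (LBINT z:?Q. (?\<chi> k (fst z) * ?\<chi> k (snd z)) * (\<phi>' (fst z) \<bullet> (R z *v \<phi> (snd z))))
      = (LBINT z:?Q. ?\<chi>' k (fst z) * (?\<chi> k (snd z) * (\<phi> (fst z) \<bullet> (R z *v \<phi> (snd z))))
         + (?\<chi> k (fst z) * ?\<chi> k (snd z)) * (\<phi>' (fst z) \<bullet> (R z *v \<phi> (snd z))))"
      by (subst set_integral_add(2)) (auto intro!: set_integrable_compact Q cont)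
    also have "\<dots> = (LBINT z:?Q. p' (fst z) \<bullet> (R z *v p (snd z)))"
      by (simp add: p_def p'_def inner_add_left matrix_vector_mult_scaleR algebra_simps)
    finally show ?thesis
      using * by (simp add: p_def matrix_vector_mult_scaleR mult_ac)
  qed
  have "2 * ((h a - h b) + (LBINT z:?Q. \<phi>' (fst z) \<bullet> (R z *v \<phi> (snd z))))
      = - (LBINT z:?Q. \<phi> (fst z) \<bullet> ((G1 z + G2 z) *v \<phi> (snd z)))"
  proof (rule LIMSEQ_unique)
    show "(\<lambda>k. 2 * ((LBINT s:{a..b}. ?\<chi>' k s * hk k s)
        + (LBINT z:?Q. (?\<chi> k (fst z) * ?\<chi> k (snd z)) * (\<phi>' (fst z) \<bullet> (R z *v \<phi> (snd z))))))
        \<longlonglongrightarrow> 2 * ((h a - h b) + (LBINT z:?Q. \<phi>' (fst z) \<bullet> (R z *v \<phi> (snd z))))"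
      by (intro tendsto_intros L1 L2)
    show "(\<lambda>k. 2 * ((LBINT s:{a..b}. ?\<chi>' k s * hk k s)
        + (LBINT z:?Q. (?\<chi> k (fst z) * ?\<chi> k (snd z)) * (\<phi>' (fst z) \<bullet> (R z *v \<phi> (snd z))))))
        \<longlonglongrightarrow> - (LBINT z:?Q. \<phi> (fst z) \<bullet> ((G1 z + G2 z) *v \<phi> (snd z)))"
      unfolding eq by (intro tendsto_minus L3)
  qed
  then show ?thesis by (simp add: h_def)
qed

section \<open>Fundamental solution and duality\<close>

text \<open>In the norm weighted by exp(-l t), integration over time has gain 1/l. A large
  \<open>l\<close> therefore makes the integral operator contracting on the whole half-line.\<close>

lemma weighted_integral_bound:
  fixes g :: "real \<Rightarrow> 'b::euclidean_space"
  assumes l: "l > 0" and t: "t \<ge> 0" and g: "continuous_on {0..t} g"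
    and b: "\<And>r. r \<in> {0..t} \<Longrightarrow> norm (g r) \<le> C * exp (l * r)" and C: "C \<ge> 0"
  shows "norm (exp (- l * t) *\<^sub>R integral {0..t} g) \<le> C / l"
proof -
  have "((\<lambda>r. C * exp (l * r)) has_integral (C / l * exp (l * t) - C / l * exp (l * 0))) {0..t}"
    by (rule fundamental_theorem_of_calculus[OF t])
      (use l in \<open>auto intro!: derivative_eq_intros simp: has_real_derivative_iff_has_vector_derivative[symmetric]\<close>)
  then have i: "(\<lambda>r. C * exp (l * r)) integrable_on {0..t}"
    "integral {0..t} (\<lambda>r. C * exp (l * r)) = C / l * exp (l * t) - C / l"
    by (auto simp: has_integral_integrable_integral)
  have "norm (integral {0..t} g) \<le> C / l * exp (l * t) - C / l"
    using integral_norm_bound_integral[OF integrable_continuous_real[OF g] i(1) b] i(2) by simp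
  also have "\<dots> \<le> C / l * exp (l * t)" using l C by simp
  finally have "exp (- l * t) * norm (integral {0..t} g) \<le> exp (- l * t) * (C / l * exp (l * t))"
    by (intro mult_left_mono) auto
  also have "\<dots> = C / l" by (simp add: exp_minus field_simps)
  finally show ?thesis by simp
qed

text \<open>Freezing the upper limit at 0 for negative times lets the fixed point operator act on
  functions on the whole line and gives the zero history without a separate condition.\<close>

lemma continuous_on_integral_max:
  fixes g :: "real \<Rightarrow> 'b::euclidean_space"
  assumes g: "continuous_on UNIV g"
  shows "continuous_on UNIV (\<lambda>t. integral {0..max 0 t} g)"
proof -
  have "continuous_on {0..} (\<lambda>t. integral {0..t} g)"
    unfolding continuous_on_eq_continuous_within
  proof
    fix t :: real assume "t \<in> {0..}"
    have "continuous_on {0..t+1} (\<lambda>t. integral {0..t} g)"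
      by (intro indefinite_integral_continuous_1 integrable_continuous_real continuous_on_subset[OF g]) auto
    then have "continuous (at t within {0..t+1}) (\<lambda>t. integral {0..t} g)"
      using \<open>t \<in> {0..}\<close> by (auto simp: continuous_on_eq_continuous_within)
    moreover have "at t within {0..} = at t within {0..t+1}"
      by (rule at_within_nhd[where S = "{..<t+1}"]) auto
    ultimately show "continuous (at t within {0..}) (\<lambda>t. integral {0..t} g)" by simp
  qed
  then show ?thesis
    by (rule continuous_on_compose2[where f = "\<lambda>t. max 0 t"]) (auto intro!: continuous_intros)
qed

text \<open>Banach's fixed point theorem on bounded continuous functions with an exponential weight,
  so one application yields the solution for all times. With zero history and constant forcing
  \<open>e\<close>, the solution is the primitive of the fundamental solution with initial value
  \<open>e\<close>. It is continuous, while the fundamental solution itself jumps at time 0.\<close>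

lemma delay_equation_exists:
  fixes B0 B1 :: "real^'n^'n" and e :: "real^'n"
  assumes "\<tau> > 0"
  shows "\<exists>Y. continuous_on UNIV Y \<and> (\<forall>t\<le>0. Y t = 0) \<and>
    (\<forall>t\<ge>0. (Y has_vector_derivative (e + B0 *v Y t + B1 *v Y (t - \<tau>))) (at t within {0..}))"
proof -
  define L where "L = norm B0 + norm B1"
  \<comment> \<open>Makes the contraction factor \<open>L / l\<close> at most 1/2; the added 1 keeps
    \<open>l\<close> positive when both matrices vanish.\<close>
  define l where "l = 2 * L + 1"
  have "L \<ge> 0" by (simp add: L_def)
  then have L: "L \<ge> 0" "l > 0" "L / l \<le> 1/2" by (auto simp: l_def field_simps)
  \<comment> \<open>The right-hand side in terms of the weighted unknown z(t) = exp(-l t) Y(t),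
    which is the one that stays bounded.\<close>
  define g where "g z r = e + B0 *v (exp (l * r) *\<^sub>R z r) + B1 *v (exp (l * (r - \<tau>)) *\<^sub>R z (r - \<tau>))"
    for z :: "real \<Rightarrow> real^'n" and r
  define F where "F z t = exp (- l * max 0 t) *\<^sub>R integral {0..max 0 t} (g z)" for z t
  have expm: "exp (l * (r - \<tau>)) \<le> exp (l * r)" for r using assms L by simp
  have lin: "norm (B0 *v (exp (l * r) *\<^sub>R u) + B1 *v (exp (l * (r - \<tau>)) *\<^sub>R v)) \<le> (L * d) * exp (l * r)"
    if "norm u \<le> d" "norm v \<le> d" for u v r d
  proof -
    have d: "d \<ge> 0" using order_trans[OF norm_ge_zero that(1)] .
    have "norm (B0 *v (exp (l * r) *\<^sub>R u)) \<le> norm B0 * (exp (l * r) * d)"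
      using norm_matrix_vector_mult_le[of B0 "exp (l * r) *\<^sub>R u"] that
      by (elim order_trans) (auto intro!: mult_left_mono)
    moreover have "norm (B1 *v (exp (l * (r - \<tau>)) *\<^sub>R v)) \<le> norm B1 * (exp (l * r) * d)"
      using norm_matrix_vector_mult_le[of B1 "exp (l * (r - \<tau>)) *\<^sub>R v"] that expm d L assms
      by (elim order_trans) (auto intro!: mult_left_mono mult_mono)
    moreover have "(L * d) * exp (l * r) = norm B0 * (exp (l * r) * d) + norm B1 * (exp (l * r) * d)"
      by (simp add: L_def algebra_simps)
    ultimately show ?thesis by (simp only: norm_triangle_mono)
  qed
  have cg: "continuous_on A (g z)" if "continuous_on UNIV z" for z A
    unfolding g_def by (intro continuous_intros continuous_on_compose2[OF that]) auto
  have cF: "continuous_on UNIV (F z)" if "continuous_on UNIV z" for z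
    unfolding F_def by (intro continuous_intros continuous_on_integral_max cg that)
  have Fb: "F (apply_bcontfun z) \<in> bcontfun" for z :: "real \<Rightarrow>\<^sub>C (real^'n)"
  proof (rule bcontfun_normI)
    show "continuous_on UNIV (F (apply_bcontfun z))" by (intro cF) auto
    fix t
    have "norm (g (apply_bcontfun z) r) \<le> (norm e + L * norm z) * exp (l * r)" if "r \<ge> 0" for r
    proof -
      have "norm (g (apply_bcontfun z) r) \<le> norm e + (L * norm z) * exp (l * r)"
        unfolding g_def add.assoc by (intro norm_triangle_mono lin norm_bounded order_refl)
      also have "norm e \<le> norm e * exp (l * r)"
        using that L by (simp add: mult_le_cancel_left1)
      finally show ?thesis by (simp add: algebra_simps)
    qed
    then show "norm (F (apply_bcontfun z) t) \<le> (norm e + L * norm z) / l"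
      unfolding F_def using L by (intro weighted_integral_bound cg) auto
  qed
  define \<Phi> where "\<Phi> z = Bcontfun (F (apply_bcontfun z))" for z
  have \<Phi>: "apply_bcontfun (\<Phi> z) = F (apply_bcontfun z)" for z
    unfolding \<Phi>_def by (rule Bcontfun_inverse[OF Fb])
  have "\<exists>!z. \<Phi> z = z"
  proof (rule banach_fix_type[of "1/2"])
    show "\<forall>z w. dist (\<Phi> z) (\<Phi> w) \<le> 1/2 * dist z w"
    proof (intro allI)
      fix z w
      show "dist (\<Phi> z) (\<Phi> w) \<le> 1/2 * dist z w"
      proof (rule dist_bound)
        fix t
        let ?d = "dist z w"
        have nb: "norm (apply_bcontfun z r - apply_bcontfun w r) \<le> ?d" for r
          using dist_bounded[of z r w] by (simp add: dist_norm)
        have "g (apply_bcontfun z) r - g (apply_bcontfun w) r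
           = B0 *v (exp (l * r) *\<^sub>R (apply_bcontfun z r - apply_bcontfun w r))
           + B1 *v (exp (l * (r - \<tau>)) *\<^sub>R (apply_bcontfun z (r - \<tau>) - apply_bcontfun w (r - \<tau>)))" for r
          by (simp add: g_def scaleR_diff_right matrix_vector_mult_diff_distrib)
        then have gb: "norm (g (apply_bcontfun z) r - g (apply_bcontfun w) r) \<le> (L * ?d) * exp (l * r)" for r
          using lin[OF nb nb] by simp
        have "F (apply_bcontfun z) t - F (apply_bcontfun w) t
          = exp (- l * max 0 t) *\<^sub>R integral {0..max 0 t} (\<lambda>r. g (apply_bcontfun z) r - g (apply_bcontfun w) r)"
          unfolding F_def scaleR_diff_right[symmetric]
          by (subst integral_diff) (auto intro!: integrable_continuous_real cg)
        also have "norm \<dots> \<le> L * ?d / l"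
          using L gb by (intro weighted_integral_bound continuous_intros cg) auto
        also have "\<dots> \<le> 1/2 * ?d" using mult_right_mono[OF L(3), of ?d] by simp
        finally show "dist (apply_bcontfun (\<Phi> z) t) (apply_bcontfun (\<Phi> w) t) \<le> 1/2 * ?d"
          by (simp add: \<Phi> dist_norm)
      qed
    qed
  qed auto
  then obtain z where z: "\<Phi> z = z" by blast
  define Y where "Y t = exp (l * t) *\<^sub>R apply_bcontfun z t" for t
  have Yeq: "Y t = integral {0..t} (\<lambda>r. e + B0 *v Y r + B1 *v Y (r - \<tau>))" if "t \<ge> 0" for t
  proof -
    have "apply_bcontfun z t = exp (- l * t) *\<^sub>R integral {0..t} (g (apply_bcontfun z))"
      using fun_cong[OF \<Phi>[of z], of t] that unfolding z by (simp add: F_def)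
    then have "Y t = integral {0..t} (g (apply_bcontfun z))"
      by (simp add: Y_def exp_minus)
    then show ?thesis by (simp add: Y_def g_def[abs_def])
  qed
  have cY: "continuous_on A Y" for A unfolding Y_def by (intro continuous_intros) auto
  have Y0: "Y t = 0" if "t \<le> 0" for t
    using that fun_cong[OF \<Phi>[of z], of t] unfolding z by (simp add: Y_def F_def max_def)
  have "(Y has_vector_derivative (e + B0 *v Y t + B1 *v Y (t - \<tau>))) (at t within {0..})" if t: "t \<ge> 0" for t
  proof -
    have c: "continuous_on A (\<lambda>r. e + B0 *v Y r + B1 *v Y (r - \<tau>))" for A
      by (intro continuous_intros continuous_on_compose2[OF cY[of UNIV]]) auto
    have "((\<lambda>u. integral {0..u} (\<lambda>r. e + B0 *v Y r + B1 *v Y (r - \<tau>))) has_vector_derivative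
        (e + B0 *v Y t + B1 *v Y (t - \<tau>))) (at t within {0..t+1})"
      by (rule integral_has_vector_derivative[OF c]) (use t in auto)
    then have "(Y has_vector_derivative (e + B0 *v Y t + B1 *v Y (t - \<tau>))) (at t within {0..t+1})"
      by (rule has_vector_derivative_transform[rotated 2]) (use t Yeq in auto)
    moreover have "at t within {0..} = at t within {0..t+1}"
      by (rule at_within_nhd[where S = "{..<t+1}"]) auto
    ultimately show ?thesis by simp
  qed
  then show ?thesis using cY Y0 by blast
qed

section \<open>Duality between the fundamental solution and solutions of the original system\<close>

lemma delay_solution_continuous:
  assumes "delay_solution \<tau> A0 A1 \<phi>0 x" "continuous_on {-\<tau>..0} \<phi>0" "\<tau> > 0"
  shows "continuous_on {-\<tau>..} x"
proof -
  have "continuous_on {-\<tau>..0} x"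
    using assms by (subst continuous_on_cong[OF refl, of _ _ \<phi>0]) (auto simp: delay_solution_def)
  moreover have "continuous_on {0..} x"
    using assms(1) unfolding delay_solution_def
    by (auto simp: continuous_on_eq_continuous_within intro!: has_vector_derivative_continuous)
  ultimately have "continuous_on ({-\<tau>..0} \<union> {0..}) x"
    by (intro continuous_on_closed_Un) auto
  moreover have "{-\<tau>..0} \<union> {0..} = {-\<tau>..}" using assms(3) by auto
  ultimately show ?thesis by simp
qed

lemma indefinite_integral_has_vector_derivative:
  fixes h :: "real \<Rightarrow> 'b::euclidean_space"
  assumes "continuous_on {c..} h" "c < u"
  shows "((\<lambda>u. integral {c..u} h) has_vector_derivative h u) (at u)"
proof -
  have "((\<lambda>u. integral {c..u} h) has_vector_derivative h u) (at u within {c..u+1})"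
    using assms by (intro integral_has_vector_derivative continuous_on_subset[OF assms(1)]) auto
  moreover have "at u within {c..u+1} = at u"
    using assms by (intro at_within_interior) auto
  ultimately show ?thesis by simp
qed

text \<open>A variation of constants formula. The pairing of y(T - t) with x(t), corrected by an
  integral over the current delay window, does not change with t. At t = T the window is empty and
  \<open>y 0\<close> = \<open>e\<close>; at t = 0 only the initial history enters.\<close>

lemma delay_duality:
  fixes \<tau> :: real and A0 A1 :: "real^'n^'n" and x Y :: "real \<Rightarrow> real^'n" and e :: "real^'n"
  defines "y \<equiv> \<lambda>t. e + transpose A0 *v Y t + transpose A1 *v Y (t - \<tau>)"
  assumes \<tau>: "\<tau> > 0" and x: "delay_solution \<tau> A0 A1 \<phi>0 x" and \<phi>0: "continuous_on {-\<tau>..0} \<phi>0"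
    and Yc: "continuous_on UNIV Y" and Y0: "\<forall>t\<le>0. Y t = 0"
    and Yd: "\<forall>t\<ge>0. (Y has_vector_derivative y t) (at t within {0..})"
    and T: "T \<ge> 0"
  shows "e \<bullet> x T = y T \<bullet> x 0 + integral {-\<tau>..min 0 (T - \<tau>)} (\<lambda>r. y (T - r - \<tau>) \<bullet> (A1 *v x r))"
proof -
  have cx: "continuous_on {-\<tau>..} x" by (rule delay_solution_continuous[OF x \<phi>0 \<tau>])
  have cy: "continuous_on UNIV y"
    unfolding y_def by (intro continuous_intros continuous_on_compose2[OF Yc]) auto
  have y0: "y 0 = e" using Y0 \<tau> by (simp add: y_def)
  have dY: "(Y has_vector_derivative (if t > 0 then y t else 0)) (at t)" if "t \<noteq> 0" for t
  proof (cases "t > 0")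
    case True
    moreover have "at t within {0..} = at t" using True by (intro at_within_interior) auto
    ultimately show ?thesis using Yd[rule_format, of t] by simp
  next
    case False
    have "((\<lambda>_. 0 :: real^'n) has_vector_derivative 0) (at t)" by simp
    then have "(Y has_vector_derivative 0) (at t)"
      by (rule has_vector_derivative_transform_within_open[where S = "{..<0}"]) (use False that Y0 in auto)
    then show ?thesis using False by simp
  qed
  have mv: "((\<lambda>t. M *v f t) has_vector_derivative M *v f') F"
    if "(f has_vector_derivative f') F" for M :: "real^'n^'n" and f f' F
    by (rule bounded_linear.has_vector_derivative[OF _ that]) simp
  have dy: "(y has_vector_derivative (transpose A0 *v y t + transpose A1 *v (if t > \<tau> then y (t - \<tau>) else 0))) (at t)"
    if "t > 0" "t \<noteq> \<tau>" for t
  proof -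
    have 1: "(Y has_vector_derivative y t) (at t)" using dY[of t] that by simp
    have "((\<lambda>t. Y (t - \<tau>)) has_vector_derivative (1::real) *\<^sub>R (if t - \<tau> > 0 then y (t - \<tau>) else 0)) (at t)"
      by (rule vector_diff_chain_at[of "\<lambda>t. t - \<tau>", unfolded o_def])
        (use dY[of "t - \<tau>"] that in \<open>auto intro!: derivative_eq_intros\<close>)
    then have 2: "((\<lambda>t. Y (t - \<tau>)) has_vector_derivative (if t > \<tau> then y (t - \<tau>) else 0)) (at t)" by simp
    have "(y has_vector_derivative (0 + transpose A0 *v y t + transpose A1 *v (if t > \<tau> then y (t - \<tau>) else 0))) (at t)"
      unfolding y_def
      by (intro has_vector_derivative_add has_vector_derivative_const mv 1[unfolded y_def] 2[unfolded y_def])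
    then show ?thesis by simp
  qed
  define h where "h r = y (T - r - \<tau>) \<bullet> (A1 *v x r)" for r
  have ch: "continuous_on {-\<tau>..} h"
    unfolding h_def by (intro continuous_intros continuous_on_compose2[OF cy] cx) auto
  define H where "H u = integral {-\<tau>..u} h" for u
  have dH: "(H has_vector_derivative h u) (at u)" if "u > - \<tau>" for u
    unfolding H_def using ch that by (rule indefinite_integral_has_vector_derivative)
  have cH: "continuous_on {-\<tau>..T} H"
    unfolding H_def
    by (intro indefinite_integral_continuous_1 integrable_continuous_real continuous_on_subset[OF ch]) auto
  \<comment> \<open>The \<open>H\<close> terms are the integral of \<open>h\<close> from t - \<tau>
    to min t (T - \<tau>). The minimum discards negative arguments of \<open>y\<close>, where the
    fundamental solution should be 0 but the formula defining \<open>y\<close> gives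
    \<open>e\<close>.\<close>
  define F where "F t = y (T - t) \<bullet> x t + H (min t (T - \<tau>)) - H (t - \<tau>)" for t
  have cF: "continuous_on {0..T} F"
    unfolding F_def using \<tau> T
    by (intro continuous_intros continuous_on_compose2[OF cy] continuous_on_compose2[OF cH]
        continuous_on_subset[OF cx]) auto
  have "F T = F 0"
  \<comment> \<open>Finitely many exceptional points are allowed for a continuous function. At t = T
    - \<tau> the reversed \<open>y\<close> has a kink, because \<open>Y\<close> has a corner at 0;
    at 0 and T only one-sided derivatives exist.\<close>
  proof (rule has_derivative_zero_unique_strong_interval[of "{0, T - \<tau>, T}" 0 T F "F 0"])
    fix t assume "t \<in> {0..T} - {0, T - \<tau>, T}"
    then have t: "0 < t" "t < T" "t \<noteq> T - \<tau>" by auto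
    have dx: "(x has_vector_derivative (A0 *v x t + A1 *v x (t - \<tau>))) (at t)"
    proof -
      have "at t within {0..} = at t" using t by (intro at_within_interior) auto
      moreover have "\<forall>t\<ge>0. (x has_vector_derivative (A0 *v x t + A1 *v x (t - \<tau>))) (at t within {0..})"
        using x by (simp add: delay_solution_def)
      ultimately show ?thesis using t by (metis less_imp_le)
    qed
    define y' where "y' = transpose A0 *v y (T - t) + transpose A1 *v (if T - t > \<tau> then y (T - t - \<tau>) else 0)"
    have "((\<lambda>t. y (T - t)) has_vector_derivative (-1) *\<^sub>R y') (at t)"
      unfolding y'_def
      by (rule vector_diff_chain_at[of "\<lambda>t. T - t", unfolded o_def])
        (use dy[of "T - t"] t in \<open>auto intro!: derivative_eq_intros\<close>)
    then have 1: "((\<lambda>t. y (T - t) \<bullet> x t) has_vector_derivative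
        (y (T - t) \<bullet> (A0 *v x t + A1 *v x (t - \<tau>)) + ((-1) *\<^sub>R y') \<bullet> x t)) (at t)"
      by (rule bounded_bilinear.has_vector_derivative[OF bounded_bilinear_inner _ dx])
    have 2: "((\<lambda>t. H (min t (T - \<tau>))) has_vector_derivative (if T - t > \<tau> then h t else 0)) (at t)"
    proof (cases "T - t > \<tau>")
      case True
      have "(H has_vector_derivative h t) (at t)" using t \<tau> by (intro dH) auto
      then have "((\<lambda>t. H (min t (T - \<tau>))) has_vector_derivative h t) (at t)"
        by (rule has_vector_derivative_transform_within_open[where S = "{..<T - \<tau>}"]) (use True in auto)
      then show ?thesis using True by simp
    next
      case False
      have "((\<lambda>_. H (T - \<tau>)) has_vector_derivative 0) (at t)" by simp
      then have "((\<lambda>t. H (min t (T - \<tau>))) has_vector_derivative 0) (at t)"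
        by (rule has_vector_derivative_transform_within_open[where S = "{T - \<tau><..}"]) (use False t in auto)
      then show ?thesis using False by simp
    qed
    have 3: "((\<lambda>t. H (t - \<tau>)) has_vector_derivative 1 *\<^sub>R h (t - \<tau>)) (at t)"
      by (rule vector_diff_chain_at[of "\<lambda>t. t - \<tau>", unfolded o_def])
        (use dH[of "t - \<tau>"] t in \<open>auto intro!: derivative_eq_intros\<close>)
    have "(F has_vector_derivative (y (T - t) \<bullet> (A0 *v x t + A1 *v x (t - \<tau>)) + ((-1) *\<^sub>R y') \<bullet> x t
        + (if T - t > \<tau> then h t else 0) - 1 *\<^sub>R h (t - \<tau>))) (at t)"
      unfolding F_def by (intro has_vector_derivative_diff has_vector_derivative_add 1 2 3)
    moreover have "y (T - t) \<bullet> (A0 *v x t + A1 *v x (t - \<tau>)) + ((-1) *\<^sub>R y') \<bullet> x t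
        + (if T - t > \<tau> then h t else 0) - 1 *\<^sub>R h (t - \<tau>) = 0"
      by (simp add: y'_def h_def inner_add_right inner_add_left inner_diff_right inner_commute[of _ "x t"] inner_transpose_mult
          del: transpose_matrix_vector)
    ultimately show "(F has_derivative (\<lambda>h. 0)) (at t within {0..T})"
      by (simp add: has_vector_derivative_def has_derivative_at_withinI)
  qed (use T cF in auto)
  moreover have "F T = e \<bullet> x T" using \<tau> by (simp add: F_def y0)
  moreover have "F 0 = y T \<bullet> x 0 + H (min 0 (T - \<tau>))" by (simp add: F_def H_def)
  ultimately show ?thesis by (simp add: H_def h_def[abs_def])
qed

text \<open>Estimates the duality formula directly: the window has length at most \<tau>, and there
  r \<le> 0, so \<open>y\<close> is evaluated at a time no earlier than T - \<tau>. The delay thus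
  costs the factors \<tau> and exp(\<beta> \<tau>).\<close>

lemma component_decay:
  fixes \<tau> :: real and A0 A1 :: "real^'n^'n" and x Y :: "real \<Rightarrow> real^'n" and e :: "real^'n"
  defines "y \<equiv> \<lambda>t. e + transpose A0 *v Y t + transpose A1 *v Y (t - \<tau>)"
  assumes \<tau>: "\<tau> > 0" and x: "delay_solution \<tau> A0 A1 \<phi>0 x" and \<phi>0: "continuous_on {-\<tau>..0} \<phi>0"
    and Yc: "continuous_on UNIV Y" and Y0: "\<forall>t\<le>0. Y t = 0"
    and Yd: "\<forall>t\<ge>0. (Y has_vector_derivative y t) (at t within {0..})"
    and decay: "\<And>t. t \<ge> 0 \<Longrightarrow> norm (y t) \<le> M * exp (- \<beta> * t)" and \<beta>: "\<beta> \<ge> 0"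
    and T: "T \<ge> 0"
  shows "\<bar>e \<bullet> x T\<bar> \<le> M * (1 + \<tau> * norm A1 * exp (\<beta> * \<tau>)) * exp (- \<beta> * T) * (SUP s\<in>{-\<tau>..0}. norm (\<phi>0 s))"
proof -
  define N where "N = (SUP s\<in>{-\<tau>..0}. norm (\<phi>0 s))"
  have "compact ((\<lambda>s. norm (\<phi>0 s)) ` {-\<tau>..0})"
    by (intro compact_continuous_image continuous_intros \<phi>0 compact_Icc)
  then have bdd: "bdd_above ((\<lambda>s. norm (\<phi>0 s)) ` {-\<tau>..0})"
    by (intro bounded_imp_bdd_above compact_imp_bounded)
  have N: "norm (x s) \<le> N" if "s \<in> {-\<tau>..0}" for s
    using cSUP_upper[OF that bdd] that x by (simp add: N_def delay_solution_def)
  have N0: "N \<ge> 0" using order_trans[OF norm_ge_zero N[of 0]] \<tau> by simp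
  have M0: "M \<ge> 0" using order_trans[OF norm_ge_zero decay[of 0]] by simp
  have cx: "continuous_on {-\<tau>..} x" by (rule delay_solution_continuous[OF x \<phi>0 \<tau>])
  have cy: "continuous_on UNIV y"
    unfolding y_def by (intro continuous_intros continuous_on_compose2[OF Yc]) auto
  let ?u = "min 0 (T - \<tau>)" and ?h = "\<lambda>r. y (T - r - \<tau>) \<bullet> (A1 *v x r)"
  let ?B = "M * exp (- \<beta> * (T - \<tau>)) * (norm A1 * N)"
  have ex: "exp (- \<beta> * (T - \<tau>)) = exp (\<beta> * \<tau>) * exp (- \<beta> * T)"
    unfolding exp_add[symmetric] by (simp add: algebra_simps)
  have "norm (integral {-\<tau>..?u} ?h) \<le> ?B * (?u - (- \<tau>))"
  proof (rule integral_bound)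
    show "- \<tau> \<le> ?u" using T \<tau> by auto
    show "continuous_on {-\<tau>..?u} ?h"
      by (intro continuous_intros continuous_on_compose2[OF cy] continuous_on_subset[OF cx]) auto
    fix r assume r: "r \<in> {-\<tau>..?u}"
    have "norm (y (T - r - \<tau>)) \<le> M * exp (- \<beta> * (T - r - \<tau>))" using r by (intro decay) auto
    also have "\<dots> \<le> M * exp (- \<beta> * (T - \<tau>))"
      using r \<beta> M0 by (intro mult_left_mono) (auto simp: algebra_simps mult_nonneg_nonpos)
    finally have 1: "norm (y (T - r - \<tau>)) \<le> M * exp (- \<beta> * (T - \<tau>))" .
    have "norm (A1 *v x r) \<le> norm A1 * norm (x r)" by (rule norm_matrix_vector_mult_le)
    also have "\<dots> \<le> norm A1 * N" using r N by (intro mult_left_mono) auto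
    finally have 2: "norm (A1 *v x r) \<le> norm A1 * N" .
    have "norm (?h r) \<le> norm (y (T - r - \<tau>)) * norm (A1 *v x r)" by (simp add: Cauchy_Schwarz_ineq2)
    also have "\<dots> \<le> ?B" using 1 2 M0 by (intro mult_mono) auto
    finally show "norm (?h r) \<le> ?B" .
  qed
  also have "\<dots> \<le> ?B * \<tau>"
    using M0 N0 by (intro mult_left_mono) auto
  also have "?B * \<tau> = M * (\<tau> * norm A1 * exp (\<beta> * \<tau>)) * exp (- \<beta> * T) * N"
    unfolding ex by (simp only: mult_ac)
  finally have i: "\<bar>integral {-\<tau>..?u} ?h\<bar> \<le> M * (\<tau> * norm A1 * exp (\<beta> * \<tau>)) * exp (- \<beta> * T) * N" by simp
  have "\<bar>y T \<bullet> x 0\<bar> \<le> norm (y T) * norm (x 0)" by (rule Cauchy_Schwarz_ineq2)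
  also have "\<dots> \<le> M * exp (- \<beta> * T) * N"
    using decay[OF T] N[of 0] \<tau> M0 by (intro mult_mono) auto
  finally have "\<bar>y T \<bullet> x 0\<bar> \<le> M * exp (- \<beta> * T) * N" .
  moreover have "e \<bullet> x T = y T \<bullet> x 0 + integral {-\<tau>..?u} ?h"
    unfolding y_def by (rule delay_duality[OF \<tau> x \<phi>0 Yc Y0 Yd[unfolded y_def] T])
  ultimately show ?thesis using i unfolding N_def[symmetric] by (simp add: algebra_simps)
qed

section \<open>Quadratic integral forms\<close>

lemma set_integrable_quadratic:
  fixes M :: "'a::euclidean_space \<Rightarrow> real^'n^'m" and u :: "'a \<Rightarrow> real^'m" and v :: "'a \<Rightarrow> real^'n"
  assumes "compact A" "set_integrable lborel A M" "continuous_on A u" "continuous_on A v"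
  shows "set_integrable lborel A (\<lambda>z. u z \<bullet> (M z *v v z))"
  unfolding inner_matrix_vector_sum
proof (intro set_integral_sum)
  fix i j
  show "set_integrable lborel A (\<lambda>z. (u z $ i * v z $ j) * M z $ i $ j)"
    unfolding real_scaleR_def[symmetric, of "u _ $ i * v _ $ j"]
    by (intro set_integrable_mult_continuous set_integral_bounded_linear(1)[OF bounded_linear_entry]
        assms continuous_intros)
qed

lemma set_integrable_matrix_vector:
  fixes M :: "'a::euclidean_space \<Rightarrow> real^'n^'m" and v :: "'a \<Rightarrow> real^'n"
  assumes "compact A" "set_integrable lborel A M" "continuous_on A v"
  shows "set_integrable lborel A (\<lambda>z. M z *v v z)"
proof -
  have bl: "bounded_linear (\<lambda>M :: real^'n^'m. M *v axis j 1)" for j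
    by (rule bounded_bilinear.bounded_linear_left[OF bounded_bilinear_matrix_vector_mult])
  have "M z *v v z = (\<Sum>j\<in>UNIV. v z $ j *\<^sub>R (M z *v axis j 1))" for z
    by (simp add: matrix_mult_sum[of "M z" "v z"] scalar_mult_eq_scaleR matrix_vector_mul_component
        matrix_vector_mult_basis)
  then show ?thesis
    using assms
    by (auto intro!: set_integral_sum set_integrable_mult_continuous set_integral_bounded_linear(1)[OF bl]
        continuous_intros)
qed

text \<open>\<open>M\<close> is merely integrable, since it will also stand for weak derivatives.
  The vectors therefore have to converge boundedly almost everywhere, with dominating function C^2
  times the norm of \<open>M\<close>.\<close>

lemma set_integral_quadratic_tendsto:
  fixes M :: "'a::euclidean_space \<Rightarrow> real^'n^'m"
    and u :: "'a \<Rightarrow> real^'m" and v :: "'a \<Rightarrow> real^'n"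
  assumes A: "compact A" and M: "set_integrable lborel A M"
    and c: "\<And>k. continuous_on A (uk k)" "\<And>k. continuous_on A (vk k)" "continuous_on A u" "continuous_on A v"
    and b: "\<And>k z. z \<in> A \<Longrightarrow> norm (uk k z) \<le> C" "\<And>k z. z \<in> A \<Longrightarrow> norm (vk k z) \<le> C"
    and lim: "AE z in lborel. z \<in> A \<longrightarrow> (\<lambda>k. uk k z) \<longlonglongrightarrow> u z \<and> (\<lambda>k. vk k z) \<longlonglongrightarrow> v z"
  shows "(\<lambda>k. LBINT z:A. uk k z \<bullet> (M z *v vk k z)) \<longlonglongrightarrow> (LBINT z:A. u z \<bullet> (M z *v v z))"
proof (rule set_integral_dominated_convergence[where w = "\<lambda>z. C * C * norm (M z)"])
  show "set_borel_measurable lborel A (\<lambda>z. u z \<bullet> (M z *v v z))"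
    "set_borel_measurable lborel A (\<lambda>z. uk k z \<bullet> (M z *v vk k z))" for k
    using set_integrable_quadratic[OF A M] c
    by (simp_all add: set_integrable_def set_borel_measurable_def)
  have "set_integrable lborel A (\<lambda>z. norm (M z))"
    using integrable_norm[OF M[unfolded set_integrable_def]] by (simp add: set_integrable_def)
  then show "set_integrable lborel A (\<lambda>z. C * C * norm (M z))" by simp
  show "AE z in lborel. z \<in> A \<longrightarrow> (\<lambda>k. uk k z \<bullet> (M z *v vk k z)) \<longlonglongrightarrow> u z \<bullet> (M z *v v z)"
    using lim
    by eventually_elim
      (auto intro!: tendsto_inner bounded_bilinear.tendsto[OF bounded_bilinear_matrix_vector_mult])
  show "AE z in lborel. z \<in> A \<longrightarrow> norm (uk k z \<bullet> (M z *v vk k z)) \<le> C * C * norm (M z)" for k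
  proof (intro AE_I2 impI)
    fix z assume z: "z \<in> A"
    have C: "C \<ge> 0" using order_trans[OF norm_ge_zero b(1)[OF z]] .
    have "norm (uk k z \<bullet> (M z *v vk k z)) \<le> norm (uk k z) * norm (M z *v vk k z)"
      by (simp add: Cauchy_Schwarz_ineq2)
    also have "\<dots> \<le> C * (norm (M z) * C)"
      using b[OF z] C by (intro mult_mono order_trans[OF norm_matrix_vector_mult_le] mult_left_mono) auto
    finally show "norm (uk k z \<bullet> (M z *v vk k z)) \<le> C * C * norm (M z)" by (simp add: mult_ac)
  qed
qed

text \<open>For a kernel that is only integrable, the section in \<theta> is integrable for almost
  every s only. Hence \<phi>(s) can be pulled into the inner integral only almost everywhere, and
  integrability of the outer integrand is obtained from its coordinates.\<close>

lemma set_integral_inner_iterated: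
  fixes F :: "real \<times> real \<Rightarrow> 'b::euclidean_space"
  assumes F: "set_integrable lborel (A \<times> B) F" and A: "compact A" and B: "compact B" and c: "continuous_on A \<phi>"
  shows "set_integrable lborel A (\<lambda>s. \<phi> s \<bullet> (LBINT \<theta>:B. F (s, \<theta>)))"
    and "(LBINT s:A. \<phi> s \<bullet> (LBINT \<theta>:B. F (s, \<theta>))) = (LBINT z:A \<times> B. \<phi> (fst z) \<bullet> F z)"
proof -
  have Q: "compact (A \<times> B)" using A B by (rule compact_Times)
  have i: "integrable (lborel \<Otimes>\<^sub>M lborel) (\<lambda>(x, y). indicator (A \<times> B) (x, y) *\<^sub>R F (x, y))"
    using F unfolding set_integrable_def lborel_prod by (simp only: case_prod_beta' prod.collapse)
  have comp: "set_integrable lborel A (\<lambda>s. (\<phi> s \<bullet> b) *\<^sub>R (LBINT \<theta>:B. F (s, \<theta>)) \<bullet> b)" if "b \<in> Basis" for b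
  proof -
    have "set_integrable lborel A (\<lambda>s. (\<phi> s \<bullet> b) *\<^sub>R (LBINT \<theta>:B. F (s, \<theta>)))"
      by (intro set_integrable_mult_continuous set_Fubini(2) F continuous_intros c A)
    from set_integral_bounded_linear(1)[OF bounded_linear_inner_left this] show ?thesis by simp
  qed
  have "set_integrable lborel A (\<lambda>s. \<Sum>b\<in>Basis. (\<phi> s \<bullet> b) *\<^sub>R (LBINT \<theta>:B. F (s, \<theta>)) \<bullet> b)"
    using comp by (rule set_integral_sum)
  then show i1: "set_integrable lborel A (\<lambda>s. \<phi> s \<bullet> (LBINT \<theta>:B. F (s, \<theta>)))"
    by (simp add: euclidean_inner[symmetric])
  have "set_integrable lborel (A \<times> B) (\<lambda>z. \<Sum>b\<in>Basis. ((\<phi> (fst z) \<bullet> b) *\<^sub>R F z) \<bullet> b)"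
    by (intro set_integral_sum set_integral_bounded_linear(1)[OF bounded_linear_inner_left]
        set_integrable_mult_continuous F Q continuous_intros continuous_on_compose2[OF c]) auto
  then have i2: "set_integrable lborel (A \<times> B) (\<lambda>z. \<phi> (fst z) \<bullet> F z)"
    by (simp add: euclidean_inner[symmetric])
  \<comment> \<open>Fubini supplies integrable sections outside a null set of s.\<close>
  have ae: "AE s in lborel. s \<in> A \<longrightarrow> \<phi> s \<bullet> (LBINT \<theta>:B. F (s, \<theta>)) = (LBINT \<theta>:B. \<phi> s \<bullet> F (s, \<theta>))"
    using lborel_pair.AE_integrable_fst[OF i]
  proof eventually_elim
    case (elim s)
    show ?case
    proof
      assume "s \<in> A"
      with elim have "set_integrable lborel B (\<lambda>\<theta>. F (s, \<theta>))"
        by (simp add: set_integrable_def indicator_times)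
      from set_integral_bounded_linear(2)[OF bounded_linear_inner_right this]
      show "\<phi> s \<bullet> (LBINT \<theta>:B. F (s, \<theta>)) = (LBINT \<theta>:B. \<phi> s \<bullet> F (s, \<theta>))" by simp
    qed
  qed
  have i3: "set_integrable lborel A (\<lambda>s. LBINT \<theta>:B. \<phi> s \<bullet> F (s, \<theta>))"
    using set_Fubini(2)[OF i2] by simp
  have "(LBINT s:A. \<phi> s \<bullet> (LBINT \<theta>:B. F (s, \<theta>))) = (LBINT s:A. LBINT \<theta>:B. \<phi> s \<bullet> F (s, \<theta>))"
    unfolding set_lebesgue_integral_def[of _ A]
  proof (rule integral_cong_AE)
    show "(\<lambda>s. indicat_real A s *\<^sub>R (\<phi> s \<bullet> (LBINT \<theta>:B. F (s, \<theta>)))) \<in> borel_measurable lborel"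
      using i1 unfolding set_integrable_def by (rule borel_measurable_integrable)
    show "(\<lambda>s. indicat_real A s *\<^sub>R (LBINT \<theta>:B. \<phi> s \<bullet> F (s, \<theta>))) \<in> borel_measurable lborel"
      using i3 unfolding set_integrable_def by (rule borel_measurable_integrable)
    show "AE s in lborel. indicat_real A s *\<^sub>R (\<phi> s \<bullet> (LBINT \<theta>:B. F (s, \<theta>)))
        = indicat_real A s *\<^sub>R (LBINT \<theta>:B. \<phi> s \<bullet> F (s, \<theta>))"
      using ae by eventually_elim (auto simp: indicator_def)
  qed
  also have "\<dots> = (LBINT z:A \<times> B. \<phi> (fst z) \<bullet> F z)"
    using set_Fubini(1)[OF i2] by simp
  finally show "(LBINT s:A. \<phi> s \<bullet> (LBINT \<theta>:B. F (s, \<theta>))) = (LBINT z:A \<times> B. \<phi> (fst z) \<bullet> F z)" .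
qed

lemma set_integral_const_Icc:
  fixes c :: "'b::{banach, second_countable_topology}" and a b :: real
  assumes "a \<le> b"
  shows "(LBINT s:{a..b}. c) = (b - a) *\<^sub>R c"
  using assms by (subst set_integral_const) auto

text \<open>The exact rate matters when functions concentrate at 0: the ramp to the power 2n has
  mass of order 1/n, while the square of the mass of its n-th power is of order 1/n^2.\<close>

lemma polynomial_ramp_integral:
  assumes "\<tau> > 0"
  shows "(LBINT s:{-\<tau>..0}. (1 + s / \<tau>) ^ n) = \<tau> / (real n + 1)"
proof -
  have "(LBINT s:{-\<tau>..0}. (1 + s / \<tau>) ^ n)
      = \<tau> / (real n + 1) * (1 + 0 / \<tau>) ^ Suc n - \<tau> / (real n + 1) * (1 + (-\<tau>) / \<tau>) ^ Suc n"
    unfolding set_lebesgue_integral_def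
  proof (rule integral_FTC_atLeastAtMost)
    fix x
    have [simp]: "\<tau> \<noteq> 0" using assms by simp
    have "((\<lambda>s. 1 + s / \<tau>) has_real_derivative 1 / \<tau>) (at x within {-\<tau>..0})"
      by (auto intro!: derivative_eq_intros)
    from DERIV_cmult[OF DERIV_power_Suc[OF this, of n], of "\<tau> / (real n + 1)"]
    have "((\<lambda>s. \<tau> / (real n + 1) * (1 + s / \<tau>) ^ Suc n) has_real_derivative
        \<tau> / (real n + 1) * ((1 + real n) * (1 / \<tau> * (1 + x / \<tau>) ^ n))) (at x within {-\<tau>..0})" .
    moreover have "\<tau> / (real n + 1) * ((1 + real n) * (1 / \<tau> * p)) = p" for p
      by (simp add: divide_simps)
    ultimately show "((\<lambda>s. \<tau> / (real n + 1) * (1 + s / \<tau>) ^ Suc n) has_vector_derivative (1 + x / \<tau>) ^ n)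
        (at x within {-\<tau>..0})"
      by (simp only: has_real_derivative_iff_has_vector_derivative[symmetric])
  qed (use assms in \<open>auto intro!: continuous_intros\<close>)
  then show ?thesis using assms by simp
qed

lemma leibniz_quadratic:
  fixes M :: "'a::euclidean_space \<Rightarrow> real^'n^'m"
    and u u' :: "real \<Rightarrow> 'a \<Rightarrow> real^'m" and v v' :: "real \<Rightarrow> 'a \<Rightarrow> real^'n"
  assumes M: "continuous_on (cbox a b) M"
    and du: "\<And>t z. ((\<lambda>t. u t z) has_vector_derivative u' t z) (at t)"
    and dv: "\<And>t z. ((\<lambda>t. v t z) has_vector_derivative v' t z) (at t)"
    and c: "continuous_on UNIV (\<lambda>p. u (fst p) (snd p))" "continuous_on UNIV (\<lambda>p. u' (fst p) (snd p))"
      "continuous_on UNIV (\<lambda>p. v (fst p) (snd p))" "continuous_on UNIV (\<lambda>p. v' (fst p) (snd p))"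
  shows "((\<lambda>t. LBINT z:cbox a b. u t z \<bullet> (M z *v v t z)) has_real_derivative
    (LBINT z:cbox a b. u' t z \<bullet> (M z *v v t z) + u t z \<bullet> (M z *v v' t z))) (at t)"
proof -
  note cc = continuous_on_compose2[OF c(1), of _ "\<lambda>z. (t, z)" for t, simplified]
    continuous_on_compose2[OF c(2), of _ "\<lambda>z. (t, z)" for t, simplified]
    continuous_on_compose2[OF c(3), of _ "\<lambda>z. (t, z)" for t, simplified]
    continuous_on_compose2[OF c(4), of _ "\<lambda>z. (t, z)" for t, simplified]
  have cf: "continuous_on (cbox a b) (\<lambda>z. u t z \<bullet> (M z *v v t z))" for t
    by (intro continuous_intros M cc)
  have cf': "continuous_on (cbox a b) (\<lambda>z. u' t z \<bullet> (M z *v v t z) + u t z \<bullet> (M z *v v' t z))" for t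
    by (intro continuous_intros M cc)
  have "((\<lambda>t. integral (cbox a b) (\<lambda>z. u t z \<bullet> (M z *v v t z))) has_real_derivative
    integral (cbox a b) (\<lambda>z. u' t z \<bullet> (M z *v v t z) + u t z \<bullet> (M z *v v' t z))) (at t within UNIV)"
  proof (rule leibniz_rule_field_derivative)
    show "((\<lambda>t. u t z \<bullet> (M z *v v t z)) has_real_derivative
        u' t z \<bullet> (M z *v v t z) + u t z \<bullet> (M z *v v' t z)) (at t within UNIV)" for t z
    proof -
      have "((\<lambda>t. M z *v v t z) has_vector_derivative M z *v v' t z) (at t)"
        by (rule bounded_linear.has_vector_derivative[OF _ dv]) simp
      from bounded_bilinear.has_vector_derivative[OF bounded_bilinear_inner du this]
      show ?thesis by (simp add: has_real_derivative_iff_has_vector_derivative add.commute)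
    qed
    show "(\<lambda>z. u t z \<bullet> (M z *v v t z)) integrable_on cbox a b" for t
      using cf by (rule integrable_continuous)
    have cM: "continuous_on (UNIV \<times> cbox a b) (\<lambda>p. M (snd p))"
      by (rule continuous_on_compose2[OF M]) (auto intro!: continuous_intros)
    show "continuous_on (UNIV \<times> cbox a b) (\<lambda>(t, z). u' t z \<bullet> (M z *v v t z) + u t z \<bullet> (M z *v v' t z))"
      unfolding case_prod_beta'
      by (intro continuous_intros cM continuous_on_subset[OF c(1)] continuous_on_subset[OF c(2)]
          continuous_on_subset[OF c(3)] continuous_on_subset[OF c(4)] subset_UNIV)
  qed auto
  then show ?thesis
    using cf cf' by (simp add: set_borel_integral_eq_integral(2)[OF set_integrable_compact])
qed

lemma bounded_linear_matrix_mult_right: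
  "bounded_linear (\<lambda>M :: real^'k^'m. (A :: real^'m^'n) ** M)"
  unfolding linear_conv_bounded_linear[symmetric]
  by (rule linearI) (simp_all add: vec_eq_iff matrix_matrix_mult_def
      sum_distrib_left sum.distrib distrib_left mult_ac)

lemma bounded_linear_transpose: "bounded_linear (transpose :: real^'n^'m \<Rightarrow> real^'m^'n)"
  unfolding linear_conv_bounded_linear[symmetric]
  by (rule linearI) (simp_all add: vec_eq_iff transpose_def)

lemma AE_lborel_Times_nonzero: "AE z in lborel. fst z \<noteq> (0::real) \<and> snd z \<noteq> (0::real)"
proof -
  have B: "(1, 0) \<in> (Basis :: (real \<times> real) set)" "(0, 1) \<in> (Basis :: (real \<times> real) set)"
    by (auto simp: Basis_prod_def)
  show ?thesis
    using AE_lborel_inner_neq[OF B(1), of 0] AE_lborel_inner_neq[OF B(2), of 0]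
    by eventually_elim (auto simp: inner_prod_def)
qed

lemma quadratic_form_le:
  fixes M :: "real^'n^'m"
  assumes "norm M \<le> r"
  shows "\<bar>u \<bullet> (M *v v)\<bar> \<le> r * ((u \<bullet> u + v \<bullet> v) / 2)"
proof -
  have "\<bar>u \<bullet> (M *v v)\<bar> \<le> norm u * norm (M *v v)" by (rule Cauchy_Schwarz_ineq2)
  also have "\<dots> \<le> norm u * (r * norm v)"
    using assms by (intro mult_left_mono order_trans[OF norm_matrix_vector_mult_le] mult_right_mono) auto
  also have "\<dots> = r * (norm u * norm v)" by simp
  also have "\<dots> \<le> r * ((u \<bullet> u + v \<bullet> v) / 2)"
  proof (rule mult_left_mono)
    have "0 \<le> (norm u - norm v)\<^sup>2" by simp
    then show "norm u * norm v \<le> (u \<bullet> u + v \<bullet> v) / 2"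
      by (simp add: power2_diff power2_norm_eq_inner)
    show "0 \<le> r" using order_trans[OF norm_ge_zero assms] .
  qed
  finally show ?thesis .
qed

lemma set_integral_Times_fst_snd:
  fixes f :: "real \<Rightarrow> real"
  assumes f: "continuous_on {a..b} f" and ab: "a \<le> b"
  shows "(LBINT z:{a..b} \<times> {a..b}. f (fst z)) = (b - a) * (LBINT s:{a..b}. f s)"
    and "(LBINT z:{a..b} \<times> {a..b}. f (snd z)) = (b - a) * (LBINT s:{a..b}. f s)"
    and "(LBINT z:{a..b} \<times> {a..b}. f (fst z) * f (snd z)) = (LBINT s:{a..b}. f s)\<^sup>2"
    and "set_integrable lborel ({a..b} \<times> {a..b}) (\<lambda>z. f (fst z))"
    and "set_integrable lborel ({a..b} \<times> {a..b}) (\<lambda>z. f (snd z))"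
    and "set_integrable lborel ({a..b} \<times> {a..b}) (\<lambda>z. f (fst z) * f (snd z))"
proof -
  have c: "continuous_on ({a..b} \<times> {a..b}) (\<lambda>z. f (fst z))" "continuous_on ({a..b} \<times> {a..b}) (\<lambda>z. f (snd z))"
    by (auto intro!: continuous_on_compose2[OF f] continuous_intros)
  show i: "set_integrable lborel ({a..b} \<times> {a..b}) (\<lambda>z. f (fst z))"
    "set_integrable lborel ({a..b} \<times> {a..b}) (\<lambda>z. f (snd z))"
    "set_integrable lborel ({a..b} \<times> {a..b}) (\<lambda>z. f (fst z) * f (snd z))"
    using c by (auto intro!: set_integrable_compact compact_Times continuous_intros)
  show "(LBINT z:{a..b} \<times> {a..b}. f (fst z)) = (b - a) * (LBINT s:{a..b}. f s)"
    using set_Fubini(1)[OF i(1)] ab by (simp add: set_integral_const_Icc)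
  show "(LBINT z:{a..b} \<times> {a..b}. f (snd z)) = (b - a) * (LBINT s:{a..b}. f s)"
    using set_Fubini(1)[OF i(2)] ab by (simp add: set_integral_const_Icc)
  show "(LBINT z:{a..b} \<times> {a..b}. f (fst z) * f (snd z)) = (LBINT s:{a..b}. f s)\<^sup>2"
    using set_Fubini(1)[OF i(3)] by (simp add: power2_eq_square)
qed

lemma inner_matrix_mult_mult:
  fixes A :: "real^'n^'n" and M :: "real^'n^'n"
  shows "x \<bullet> ((A ** M) *v w) = (transpose A *v x) \<bullet> (M *v w)"
  by (metis inner_commute inner_transpose_mult matrix_vector_mul_assoc)

text \<open>This is the subsequence m = 2n of m q^m + q^m. The factor 2n + 1 is the reciprocal mass,
  up to \<tau>, of the concentrating functions used to determine the sign of S(0).\<close>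

lemma weighted_power_decay:
  assumes "0 \<le> q" "q < (1::real)"
  shows "(\<lambda>n. (2 * real n + 1) * q ^ (2 * n)) \<longlonglongrightarrow> 0"
proof -
  have "(\<lambda>m. real m * q ^ m + q ^ m) \<longlonglongrightarrow> 0 + 0"
    using assms by (intro tendsto_add powser_times_n_limit_0 LIMSEQ_power_zero) auto
  then have "(\<lambda>m. real m * q ^ m + q ^ m) \<longlonglongrightarrow> 0" by simp
  from LIMSEQ_subseq_LIMSEQ[OF this, of "\<lambda>n. 2 * n"]
  show ?thesis by (simp add: strict_mono_def o_def algebra_simps)
qed

section \<open>The Lyapunov functional\<close>

locale dual_lyapunov =
  fixes \<tau> \<epsilon> :: real
    and A0 A1 :: "real^'n^'n"
    and S :: "real \<Rightarrow> real^'n^'n"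
    and R :: "real \<times> real \<Rightarrow> real^'n^'n"
  assumes tau: "\<tau> > 0" and eps: "\<epsilon> > 0"
    and S_W2: "S \<in> W2 {-\<tau>..0}"
    and R_W2: "R \<in> W2 ({-\<tau>..0} \<times> {-\<tau>..0})"
    and R0_W2: "(\<lambda>s. R (s, 0)) \<in> W2 {-\<tau>..0}"
    and R_sym: "\<forall>s\<in>{-\<tau>..0}. \<forall>\<theta>\<in>{-\<tau>..0}. R (s, \<theta>) = transpose (R (\<theta>, s))"
    and S_sym: "\<forall>s\<in>{-\<tau>..0}. transpose (S s) = S s"
    and P_coercive: "\<forall>z\<in>state_space \<tau>.
           L2_inner \<tau> (stack z) (op_P \<tau> S R z) \<ge> \<epsilon> * (L2_norm \<tau> (stack z))\<^sup>2"
    and D_negative: "\<forall>(x, \<phi>)\<in>state_space \<tau>.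
           L2_inner \<tau> (stack ((x, \<phi> (-\<tau>)), \<phi>)) (op_D \<tau> A0 A1 S R ((x, \<phi> (-\<tau>)), \<phi>))
             \<le> - \<epsilon> * (L2_norm \<tau> (stack (x, \<phi>)))\<^sup>2"
begin

abbreviation J :: "real set" where "J \<equiv> {-\<tau>..0}"
abbreviation Q :: "(real \<times> real) set" where "Q \<equiv> J \<times> J"
abbreviation S' :: "real \<Rightarrow> real^'n^'n" where "S' \<equiv> weak_derivative J 1 S"
abbreviation R0' :: "real \<Rightarrow> real^'n^'n" where "R0' \<equiv> weak_derivative J 1 (\<lambda>s. R (s, 0))"

text \<open>The form of \<open>op_P\<close> with \<phi>(0) replaced by \<open>x\<close>, so that it
  also makes sense for pairs that do not match at 0. Integrating the constant component over the
  interval supplies one factor \<tau>; the two mixed terms coincide by symmetry of \<open>R\<close>,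
  hence the factor 2\<tau>.\<close>

definition form_P :: "real^'n \<Rightarrow> (real \<Rightarrow> real^'n) \<Rightarrow> real" where
  "form_P x \<phi> = \<tau>\<^sup>2 * (x \<bullet> ((R (0, 0) + S 0) *v x)) + 2 * \<tau> * (LBINT \<theta>:J. x \<bullet> (R (0, \<theta>) *v \<phi> \<theta>))
     + \<tau> * (LBINT s:J. \<phi> s \<bullet> (S s *v \<phi> s)) + (LBINT z:Q. \<phi> (fst z) \<bullet> (R z *v \<phi> (snd z)))"

text \<open>The symmetrised blocks are folded together: \<open>S11\<close> and its transpose,
  \<open>S12\<close> and its transpose, V and its transpose each contribute equal terms. The value
  \<open>y\<close> at the delay is a free argument, so that \<phi> can be approximated while
  \<open>y\<close> stays fixed.\<close>

definition form_D :: "real^'n \<Rightarrow> real^'n \<Rightarrow> (real \<Rightarrow> real^'n) \<Rightarrow> real" where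
  "form_D x y \<phi> = \<tau> * (2 * (x \<bullet> (S11 \<tau> A0 A1 S R *v x)) + 2 * (x \<bullet> (S12 \<tau> A1 S *v y)) + y \<bullet> (S22 \<tau> S *v y))
     + 2 * \<tau> * (LBINT \<theta>:J. x \<bullet> (S13 \<tau> A0 A1 R \<theta> *v \<phi> \<theta>))
     + \<tau> * (LBINT s:J. \<phi> s \<bullet> (S' s *v \<phi> s)) + (LBINT z:Q. \<phi> (fst z) \<bullet> (kernel_E \<tau> R z *v \<phi> (snd z)))"

definition sq_norm :: "real^'n \<Rightarrow> (real \<Rightarrow> real^'n) \<Rightarrow> real" where
  "sq_norm x \<phi> = \<tau> * (x \<bullet> x) + (LBINT s:J. \<phi> s \<bullet> \<phi> s)"

section \<open>Regularity and integrability of the data\<close>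

lemma R_symD: "s \<in> J \<Longrightarrow> \<theta> \<in> J \<Longrightarrow> R (s, \<theta>) = transpose (R (\<theta>, s))"
  using R_sym by blast

lemma compact_J: "compact J" and compact_Q: "compact Q"
  by (simp_all add: compact_Times)

lemma J_finite: "J \<in> sets lborel" "emeasure lborel J < \<infinity>" "Q \<in> sets lborel" "emeasure lborel Q < \<infinity>"
  using borel_compact[OF compact_Q] emeasure_bounded_finite[OF compact_imp_bounded[OF compact_J]]
    emeasure_bounded_finite[OF compact_imp_bounded[OF compact_Q]] by simp_all

lemma S_cont: "continuous_on J S" and R_cont: "continuous_on Q R"
  using S_W2 R_W2 by (auto simp: W2_def)

lemma R0_cont: "continuous_on J (\<lambda>\<theta>. R (0, \<theta>))" "continuous_on J (\<lambda>\<theta>. R (-\<tau>, \<theta>))"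
  "continuous_on J (\<lambda>\<theta>. R (\<theta>, 0))"
  using tau by (auto intro!: continuous_on_compose2[OF R_cont] continuous_intros)

lemma S'_integrable: "set_integrable lborel J S'"
  and S'_weak: "has_weak_derivative J 1 S S'"
  using weak_derivative[OF S_W2, of 1] J_finite by (auto intro: square_integrable_imp_integrable)

lemma R0'_integrable: "set_integrable lborel J R0'"
  and R0'_weak: "has_weak_derivative J 1 (\<lambda>s. R (s, 0)) R0'"
  using weak_derivative[OF R0_W2, of 1] J_finite by (auto intro: square_integrable_imp_integrable)

lemma R_partial:
  "set_integrable lborel Q (weak_derivative Q (1, 0) R)" "has_weak_derivative Q (1, 0) R (weak_derivative Q (1, 0) R)"
  "set_integrable lborel Q (weak_derivative Q (0, 1) R)" "has_weak_derivative Q (0, 1) R (weak_derivative Q (0, 1) R)"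
proof -
  have B: "(1, 0) \<in> (Basis :: (real \<times> real) set)" "(0, 1) \<in> (Basis :: (real \<times> real) set)"
    by (auto simp: Basis_prod_def)
  show "set_integrable lborel Q (weak_derivative Q (1, 0) R)" "has_weak_derivative Q (1, 0) R (weak_derivative Q (1, 0) R)"
    "set_integrable lborel Q (weak_derivative Q (0, 1) R)" "has_weak_derivative Q (0, 1) R (weak_derivative Q (0, 1) R)"
    using weak_derivative[OF R_W2 B(1)] weak_derivative[OF R_W2 B(2)] J_finite
    by (auto intro: square_integrable_imp_integrable)
qed

lemma E_integrable: "set_integrable lborel Q (kernel_E \<tau> R)"
  unfolding kernel_E_def[abs_def] using R_partial by (intro set_integral_add)

lemma S13_integrable: "set_integrable lborel J (S13 \<tau> A0 A1 R)"
  unfolding S13_def[abs_def]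
  by (intro set_integral_add set_integral_bounded_linear(1)[OF bounded_linear_matrix_mult_right]
      set_integral_bounded_linear(1)[OF bounded_linear_transpose] R0'_integrable
      set_integrable_compact compact_J R0_cont)

lemma S_integrable: "set_integrable lborel J S" and R_integrable: "set_integrable lborel Q R"
  and R0_integrable: "set_integrable lborel J (\<lambda>\<theta>. R (0, \<theta>))" "set_integrable lborel J (\<lambda>\<theta>. R (-\<tau>, \<theta>))"
  by (intro set_integrable_compact compact_J compact_Q S_cont R_cont R0_cont)+

section \<open>The operator inequalities as inequalities between forms, and their extension by
  density\<close>

lemma L2_stack: "(L2_norm \<tau> (stack (x, \<phi>)))\<^sup>2 = sq_norm x \<phi>" if c: "continuous_on J \<phi>"
proof -
  have i: "set_integrable lborel J (\<lambda>s. \<phi> s \<bullet> \<phi> s)"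
    by (intro set_integrable_compact compact_J continuous_intros c)
  have i0: "set_integrable lborel J (\<lambda>s. x \<bullet> x)"
    by (intro set_integrable_compact compact_J continuous_intros)
  have eq: "L2_inner \<tau> (stack (x, \<phi>)) (stack (x, \<phi>)) = sq_norm x \<phi>"
    using tau by (simp add: L2_inner_def stack_def inner_prod_def set_integral_add(2)[OF i0 i]
        set_integral_const_Icc sq_norm_def)
  have "0 \<le> (LBINT s:J. \<phi> s \<bullet> \<phi> s)"
    unfolding set_lebesgue_integral_def by (intro integral_nonneg_AE) auto
  then have "sq_norm x \<phi> \<ge> 0" using tau by (simp add: sq_norm_def)
  then show ?thesis unfolding L2_norm_def eq by simp
qed

lemma op_P_form:
  assumes c: "continuous_on J \<phi>" and x: "\<phi> 0 = x"
  shows "L2_inner \<tau> (stack (x, \<phi>)) (op_P \<tau> S R (x, \<phi>)) = form_P x \<phi>"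
proof -
  let ?a = "x \<bullet> ((\<tau> *\<^sub>R (R (0, 0) + S 0)) *v x) + x \<bullet> (LBINT \<theta>:J. R (0, \<theta>) *v \<phi> \<theta>)"
  have iF: "set_integrable lborel Q (\<lambda>z. R z *v \<phi> (snd z))"
    by (intro set_integrable_matrix_vector compact_Q R_integrable continuous_on_compose2[OF c] continuous_intros) auto
  note it = set_integral_inner_iterated[OF iF compact_J compact_J c, simplified]
  have i1: "set_integrable lborel J (\<lambda>s. ?a)"
    by (intro set_integrable_compact compact_J continuous_intros)
  have i2: "set_integrable lborel J (\<lambda>s. \<tau> * (x \<bullet> (R (0, s) *v \<phi> s)))"
    by (intro set_integrable_mult_right set_integrable_quadratic compact_J R0_integrable c continuous_intros)
  have i3: "set_integrable lborel J (\<lambda>s. \<tau> * (\<phi> s \<bullet> (S s *v \<phi> s)))"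
    by (intro set_integrable_mult_right set_integrable_quadratic compact_J S_integrable c)
  have "L2_inner \<tau> (stack (x, \<phi>)) (op_P \<tau> S R (x, \<phi>))
      = (LBINT s:J. ?a + \<tau> * (x \<bullet> (R (0, s) *v \<phi> s)) + \<tau> * (\<phi> s \<bullet> (S s *v \<phi> s))
          + \<phi> s \<bullet> (LBINT \<theta>:J. R (s, \<theta>) *v \<phi> \<theta>))"
    unfolding L2_inner_def
  proof (rule set_lebesgue_integral_cong[OF J_finite(1)], intro allI impI)
    fix s assume s: "s \<in> J"
    have "R (s, 0) = transpose (R (0, s))" by (rule R_symD[OF s]) (use tau in simp)
    then have "\<phi> s \<bullet> (R (s, 0) *v x) = x \<bullet> (R (0, s) *v \<phi> s)"
      by (simp only: inner_transpose_mult)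
    then show "stack (x, \<phi>) s \<bullet> op_P \<tau> S R (x, \<phi>) s
      = ?a + \<tau> * (x \<bullet> (R (0, s) *v \<phi> s)) + \<tau> * (\<phi> s \<bullet> (S s *v \<phi> s))
          + \<phi> s \<bullet> (LBINT \<theta>:J. R (s, \<theta>) *v \<phi> \<theta>)"
      by (simp add: stack_def op_P_def x inner_add_right scaleR_matrix_vector_assoc[symmetric])
  qed
  also have "\<dots> = \<tau> * ?a + \<tau> * (LBINT s:J. x \<bullet> (R (0, s) *v \<phi> s)) + \<tau> * (LBINT s:J. \<phi> s \<bullet> (S s *v \<phi> s))
      + (LBINT z:Q. \<phi> (fst z) \<bullet> (R z *v \<phi> (snd z)))"
    using tau by (simp add: set_integral_add i1 i2 i3 it set_integral_const_Icc)
  also have "x \<bullet> (LBINT \<theta>:J. R (0, \<theta>) *v \<phi> \<theta>) = (LBINT \<theta>:J. x \<bullet> (R (0, \<theta>) *v \<phi> \<theta>))"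
    by (intro set_integral_bounded_linear(2)[symmetric] bounded_linear_inner_right
        set_integrable_matrix_vector compact_J R0_integrable c)
  finally show ?thesis
    by (simp add: form_P_def scaleR_matrix_vector_assoc[symmetric] power2_eq_square algebra_simps)
qed

lemma op_D_form:
  assumes c: "continuous_on J \<phi>"
  shows "L2_inner \<tau> (stack ((x, y), \<phi>)) (op_D \<tau> A0 A1 S R ((x, y), \<phi>)) = form_D x y \<phi>"
proof -
  let ?b = "(x, y) \<bullet> (LBINT \<theta>:J. map_V \<tau> A0 A1 R \<theta> (\<phi> \<theta>))"
  let ?a = "(x, y) \<bullet> map_D0 \<tau> A0 A1 S R (x, y) + ?b"
  have iF: "set_integrable lborel Q (\<lambda>z. kernel_E \<tau> R z *v \<phi> (snd z))"
    by (intro set_integrable_matrix_vector compact_Q E_integrable continuous_on_compose2[OF c] continuous_intros) auto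
  note it = set_integral_inner_iterated[OF iF compact_J compact_J c, simplified]
  have i1: "set_integrable lborel J (\<lambda>s. ?a)"
    by (intro set_integrable_compact compact_J continuous_intros)
  have i2: "set_integrable lborel J (\<lambda>s. \<tau> * (x \<bullet> (S13 \<tau> A0 A1 R s *v \<phi> s)))"
    by (intro set_integrable_mult_right set_integrable_quadratic compact_J S13_integrable c continuous_intros)
  have i3: "set_integrable lborel J (\<lambda>s. \<tau> * (\<phi> s \<bullet> (S' s *v \<phi> s)))"
    by (intro set_integrable_mult_right set_integrable_quadratic compact_J S'_integrable c)
  have "L2_inner \<tau> (stack ((x, y), \<phi>)) (op_D \<tau> A0 A1 S R ((x, y), \<phi>))
      = (LBINT s:J. ?a + \<tau> * (x \<bullet> (S13 \<tau> A0 A1 R s *v \<phi> s)) + \<tau> * (\<phi> s \<bullet> (S' s *v \<phi> s))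
          + \<phi> s \<bullet> (LBINT \<theta>:J. kernel_E \<tau> R (s, \<theta>) *v \<phi> \<theta>))"
    unfolding L2_inner_def
    by (rule set_lebesgue_integral_cong[OF J_finite(1)])
      (simp add: stack_def op_D_def map_V_transpose_def inner_add_right scaleR_matrix_vector_assoc[symmetric]
        inner_transpose_mult del: transpose_matrix_vector)
  also have "\<dots> = \<tau> * ?a + \<tau> * (LBINT s:J. x \<bullet> (S13 \<tau> A0 A1 R s *v \<phi> s)) + \<tau> * (LBINT s:J. \<phi> s \<bullet> (S' s *v \<phi> s))
      + (LBINT z:Q. \<phi> (fst z) \<bullet> (kernel_E \<tau> R z *v \<phi> (snd z)))"
    using tau by (simp add: set_integral_add i1 i2 i3 it set_integral_const_Icc)
  also have "?b = (LBINT \<theta>:J. x \<bullet> (S13 \<tau> A0 A1 R \<theta> *v \<phi> \<theta>))"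
  proof -
    have "bounded_linear (\<lambda>w :: real^'n. (w, 0 :: real^'n))"
      by (intro bounded_linear_Pair bounded_linear_ident bounded_linear_zero)
    then have "set_integrable lborel J (\<lambda>\<theta>. map_V \<tau> A0 A1 R \<theta> (\<phi> \<theta>))"
      unfolding map_V_def
      by (intro set_integral_bounded_linear(1)[where T = "\<lambda>w. (w, 0)"] set_integrable_matrix_vector
          compact_J S13_integrable c)
    from set_integral_bounded_linear(2)[OF bounded_linear_inner_right this, symmetric]
    show ?thesis by (simp add: map_V_def)
  qed
  also have "(x, y) \<bullet> map_D0 \<tau> A0 A1 S R (x, y)
      = 2 * (x \<bullet> (S11 \<tau> A0 A1 S R *v x)) + 2 * (x \<bullet> (S12 \<tau> A1 S *v y)) + y \<bullet> (S22 \<tau> S *v y)"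
    by (simp add: map_D0_def inner_add_right matrix_vector_mult_add_rdistrib inner_transpose_mult
        del: transpose_matrix_vector)
  finally show ?thesis by (simp add: form_D_def algebra_simps)
qed

text \<open>Changes \<phi> so that it takes the value \<open>x\<close> at 0. For large
  \<open>k\<close> the correction is concentrated near 0. The exponent is at least 1, so the
  correction vanishes at -\<tau> and the delayed value, which the form of \<open>D\<close> does see,
  is preserved.\<close>

definition ramp :: "real^'n \<Rightarrow> (real \<Rightarrow> real^'n) \<Rightarrow> nat \<Rightarrow> real \<Rightarrow> real^'n" where
  "ramp x \<phi> k s = \<phi> s + (1 + s / \<tau>) ^ Suc k *\<^sub>R (x - \<phi> 0)"

lemma ramp_ends: "ramp x \<phi> k 0 = x" "ramp x \<phi> k (-\<tau>) = \<phi> (-\<tau>)"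
  using tau by (auto simp: ramp_def)

lemma ramp_C1:
  assumes d: "\<And>s. (\<phi> has_vector_derivative \<phi>' s) (at s)" and c: "continuous_on UNIV \<phi>'"
  shows "ramp x \<phi> k \<in> W2 J"
proof (rule C1_in_W2)
  have [simp]: "\<tau> \<noteq> 0" using tau by simp
  show "continuous_on UNIV (\<lambda>s. \<phi>' s + ((1 + real k) * (1 / \<tau> * (1 + s / \<tau>) ^ k)) *\<^sub>R (x - \<phi> 0))"
    by (intro continuous_intros c) auto
  fix s
  have "((\<lambda>s. (1 + s / \<tau>) ^ Suc k) has_real_derivative (1 + real k) * (1 / \<tau> * (1 + s / \<tau>) ^ k)) (at s)"
    by (rule DERIV_power_Suc) (auto intro!: derivative_eq_intros)
  from has_vector_derivative_add[OF d has_vector_derivative_scaleR[OF this has_vector_derivative_const]]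
  show "(ramp x \<phi> k has_vector_derivative
      \<phi>' s + ((1 + real k) * (1 / \<tau> * (1 + s / \<tau>) ^ k)) *\<^sub>R (x - \<phi> 0)) (at s)"
    unfolding ramp_def[abs_def] by simp
qed (use tau in simp)

lemma ramp_bounds:
  assumes "s \<in> J"
  shows "norm (ramp x \<phi> k s) \<le> norm (\<phi> s) + norm (x - \<phi> 0)"
    and "s \<noteq> 0 \<Longrightarrow> (\<lambda>k. ramp x \<phi> k s) \<longlonglongrightarrow> \<phi> s"
proof -
  have r: "0 \<le> 1 + s / \<tau>" "1 + s / \<tau> \<le> 1" using assms tau by (auto simp: field_simps)
  have "norm ((1 + s / \<tau>) ^ Suc k *\<^sub>R (x - \<phi> 0)) \<le> 1 * norm (x - \<phi> 0)"
    unfolding norm_scaleR using r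
    by (intro mult_right_mono) (simp_all add: power_abs[symmetric] power_le_one del: power_Suc)
  then show "norm (ramp x \<phi> k s) \<le> norm (\<phi> s) + norm (x - \<phi> 0)"
    unfolding ramp_def by (intro norm_triangle_mono) auto
  assume "s \<noteq> 0"
  then have "norm (1 + s / \<tau>) < 1" using r assms tau by (auto simp: field_simps)
  then have "(\<lambda>k. (1 + s / \<tau>) ^ Suc k) \<longlonglongrightarrow> 0"
    by (intro LIMSEQ_Suc LIMSEQ_power_zero)
  from tendsto_add[OF tendsto_const[of "\<phi> s"] tendsto_scaleR[OF this tendsto_const[of "x - \<phi> 0"]]]
  show "(\<lambda>k. ramp x \<phi> k s) \<longlonglongrightarrow> \<phi> s" by (simp add: ramp_def del: power_Suc)
qed

text \<open>The ramps are bounded uniformly in \<open>k\<close> and fail to converge to \<phi> at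
  most at the point 0. On the square the exceptional set consists of two axis segments, again a null
  set.\<close>

lemma ramp_tendsto:
  assumes c: "continuous_on J \<phi>"
  shows "(\<lambda>k. form_P x (ramp x \<phi> k)) \<longlonglongrightarrow> form_P x \<phi>"
    and "(\<lambda>k. form_D x y (ramp x \<phi> k)) \<longlonglongrightarrow> form_D x y \<phi>"
    and "(\<lambda>k. sq_norm x (ramp x \<phi> k)) \<longlonglongrightarrow> sq_norm x \<phi>"
proof -
  have cr: "continuous_on J (ramp x \<phi> k)" for k
    unfolding ramp_def[abs_def] using tau by (intro continuous_intros c) auto
  have "compact ((\<lambda>s. norm (\<phi> s)) ` J)"
    by (intro compact_continuous_image continuous_intros c compact_J)
  then obtain C0 where C0: "\<And>s. s \<in> J \<Longrightarrow> norm (\<phi> s) \<le> C0"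
    by (fastforce dest: compact_imp_bounded simp: bounded_iff)
  define C where "C = C0 + norm (x - \<phi> 0) + norm x"
  have b: "norm (ramp x \<phi> k s) \<le> C" if "s \<in> J" for k s
    using ramp_bounds(1)[OF that, of x \<phi> k] C0[OF that] norm_ge_zero[of x] unfolding C_def by linarith
  have bx: "norm x \<le> C"
    using order_trans[OF norm_ge_zero C0[of 0]] tau by (simp add: C_def)
  have lim1: "AE s in lborel. s \<in> J \<longrightarrow> (\<lambda>k. ramp x \<phi> k s) \<longlonglongrightarrow> \<phi> s"
    using AE_lborel_singleton[of 0] by eventually_elim (use ramp_bounds(2) in auto)
  then have lim1': "AE s in lborel. s \<in> J \<longrightarrow> (\<lambda>k. ramp x \<phi> k s) \<longlonglongrightarrow> \<phi> s \<and> (\<lambda>k. ramp x \<phi> k s) \<longlonglongrightarrow> \<phi> s"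
    by eventually_elim auto
  have lim1x: "AE s in lborel. s \<in> J \<longrightarrow> (\<lambda>k. x) \<longlonglongrightarrow> x \<and> (\<lambda>k. ramp x \<phi> k s) \<longlonglongrightarrow> \<phi> s"
    using lim1 by eventually_elim auto
  have lim2: "AE z in lborel. z \<in> Q \<longrightarrow> (\<lambda>k. ramp x \<phi> k (fst z)) \<longlonglongrightarrow> \<phi> (fst z)
      \<and> (\<lambda>k. ramp x \<phi> k (snd z)) \<longlonglongrightarrow> \<phi> (snd z)"
    using AE_lborel_Times_nonzero by eventually_elim (use ramp_bounds(2) in auto)
  have t1: "(\<lambda>k. LBINT s:J. ramp x \<phi> k s \<bullet> (M s *v ramp x \<phi> k s)) \<longlonglongrightarrow> (LBINT s:J. \<phi> s \<bullet> (M s *v \<phi> s))"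
    if "set_integrable lborel J M" for M
    using that b lim1' by (intro set_integral_quadratic_tendsto[where C = C] compact_J cr c)
  have t2: "(\<lambda>k. LBINT s:J. x \<bullet> (M s *v ramp x \<phi> k s)) \<longlonglongrightarrow> (LBINT s:J. x \<bullet> (M s *v \<phi> s))"
    if "set_integrable lborel J M" for M
    using that b bx lim1x by (intro set_integral_quadratic_tendsto[where C = C] compact_J cr c continuous_intros)
  have c2: "continuous_on Q (\<lambda>z. f (fst z))" "continuous_on Q (\<lambda>z. f (snd z))"
    if "continuous_on J f" for f :: "real \<Rightarrow> real^'n"
    by (auto intro!: continuous_on_compose2[OF that] continuous_intros)
  have t3: "(\<lambda>k. LBINT z:Q. ramp x \<phi> k (fst z) \<bullet> (M z *v ramp x \<phi> k (snd z)))
      \<longlonglongrightarrow> (LBINT z:Q. \<phi> (fst z) \<bullet> (M z *v \<phi> (snd z)))"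
    if "set_integrable lborel Q M" for M
    using that b lim2 by (intro set_integral_quadratic_tendsto[where C = C] compact_Q cr c c2) auto
  show "(\<lambda>k. form_P x (ramp x \<phi> k)) \<longlonglongrightarrow> form_P x \<phi>"
    unfolding form_P_def
    by (intro tendsto_add tendsto_mult tendsto_const t1 t2 t3 S_integrable R_integrable R0_integrable)
  show "(\<lambda>k. form_D x y (ramp x \<phi> k)) \<longlonglongrightarrow> form_D x y \<phi>"
    unfolding form_D_def
    by (intro tendsto_add tendsto_mult tendsto_const t1 t2 t3 S'_integrable E_integrable S13_integrable)
  have "set_integrable lborel J (\<lambda>_. mat 1 :: real^'n^'n)"
    by (intro set_integrable_compact compact_J continuous_intros)
  from t1[OF this]
  have "(\<lambda>k. LBINT s:J. ramp x \<phi> k s \<bullet> ramp x \<phi> k s) \<longlonglongrightarrow> (LBINT s:J. \<phi> s \<bullet> \<phi> s)" by simp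
  then show "(\<lambda>k. sq_norm x (ramp x \<phi> k)) \<longlonglongrightarrow> sq_norm x \<phi>"
    unfolding sq_norm_def by (intro tendsto_add tendsto_const)
qed

text \<open>Neither form sees \<open>\<phi>(0)\<close>, so the constraint \<open>\<phi>(0) = x\<close> of the state space can be dropped by density.\<close>

lemma form_bounds:
  assumes d: "\<And>s. (\<phi> has_vector_derivative \<phi>' s) (at s)" and c': "continuous_on UNIV \<phi>'"
  shows "\<epsilon> * sq_norm x \<phi> \<le> form_P x \<phi>"
    and "form_D x (\<phi> (-\<tau>)) \<phi> \<le> - \<epsilon> * sq_norm x \<phi>"
proof -
  have c: "continuous_on J \<phi>"
    using d by (auto intro!: continuous_at_imp_continuous_on has_vector_derivative_continuous)
  have W: "ramp x \<phi> k \<in> W2 J" for k by (rule ramp_C1[OF d c'])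
  then have cr: "continuous_on J (ramp x \<phi> k)" for k by (simp add: W2_def)
  have st: "(x, ramp x \<phi> k) \<in> state_space \<tau>" for k
    using W by (simp add: state_space_def ramp_ends)
  have "\<epsilon> * sq_norm x (ramp x \<phi> k) \<le> form_P x (ramp x \<phi> k)" for k
    using bspec[OF P_coercive st[of k]] by (simp add: L2_stack[OF cr] op_P_form[OF cr ramp_ends(1)])
  then show "\<epsilon> * sq_norm x \<phi> \<le> form_P x \<phi>"
    by (intro LIMSEQ_le[OF tendsto_mult[OF tendsto_const ramp_tendsto(3)[OF c]] ramp_tendsto(1)[OF c]]) auto
  have "form_D x (\<phi> (-\<tau>)) (ramp x \<phi> k) \<le> - \<epsilon> * sq_norm x (ramp x \<phi> k)" for k
    using bspec[OF D_negative st[of k]] by (simp add: L2_stack[OF cr] op_D_form[OF cr] ramp_ends)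
  then show "form_D x (\<phi> (-\<tau>)) \<phi> \<le> - \<epsilon> * sq_norm x \<phi>"
    by (intro LIMSEQ_le[OF ramp_tendsto(2)[OF c] tendsto_mult[OF tendsto_const ramp_tendsto(3)[OF c]]]) auto
qed

section \<open>Upper bound for the functional and sign of S(0)\<close>

lemma sq_norm_nonneg: "0 \<le> sq_norm x \<phi>"
proof -
  have "0 \<le> (LBINT s:J. \<phi> s \<bullet> \<phi> s)"
    unfolding set_lebesgue_integral_def by (intro integral_nonneg_AE) auto
  then show ?thesis using tau by (simp add: sq_norm_def)
qed

text \<open>Together with coercivity this makes the functional equivalent to the squared norm, which
  turns dissipation of the norm into exponential decay of the functional. \<open>R\<close> and
  \<open>S\<close> are bounded by compactness, and mixed terms are split by the arithmetic-geometric
  mean inequality.\<close>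

lemma form_P_upper:
  "\<exists>C>0. \<forall>x \<phi>. continuous_on J \<phi> \<longrightarrow> form_P x \<phi> \<le> C * sq_norm x \<phi>"
proof -
  have "compact (R ` Q)" "compact (S ` J)"
    by (intro compact_continuous_image R_cont S_cont compact_Q compact_J)+
  then obtain r \<sigma> where r: "\<And>z. z \<in> Q \<Longrightarrow> norm (R z) \<le> r" and \<sigma>: "\<And>s. s \<in> J \<Longrightarrow> norm (S s) \<le> \<sigma>"
    by (fastforce dest!: compact_imp_bounded simp: bounded_iff)
  have r0: "r \<ge> 0" "\<sigma> \<ge> 0"
    using order_trans[OF norm_ge_zero r[of "(0, 0)"]] order_trans[OF norm_ge_zero \<sigma>[of 0]] tau by auto
  \<comment> \<open>The estimates below add up to \<open>\<tau> * (2 * r + \<sigma>)\<close>. The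
    rest is slack, and the final 1 makes \<open>C\<close> positive even if \<open>R\<close> and
    \<open>S\<close> vanish.\<close>
  define C where "C = \<tau> * (3 * r + 2 * \<sigma>) + 1"
  have "form_P x \<phi> \<le> C * sq_norm x \<phi>" if c: "continuous_on J \<phi>" for x \<phi>
  proof -
    let ?n = "LBINT s:J. \<phi> s \<bullet> \<phi> s"
    have cn: "continuous_on J (\<lambda>s. \<phi> s \<bullet> \<phi> s)" by (intro continuous_intros c)
    have in1: "set_integrable lborel J (\<lambda>s. \<phi> s \<bullet> \<phi> s)" by (intro set_integrable_compact compact_J cn)
    have n0: "?n \<ge> 0" unfolding set_lebesgue_integral_def by (intro integral_nonneg_AE) auto
    have ix: "set_integrable lborel J (\<lambda>s. x \<bullet> x)"
      by (intro set_integrable_compact compact_J continuous_intros)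
    have c2: "continuous_on Q (\<lambda>z. \<phi> (fst z))" "continuous_on Q (\<lambda>z. \<phi> (snd z))"
      by (auto intro!: continuous_on_compose2[OF c] continuous_intros)
    have "norm (R (0, 0) + S 0) \<le> r + \<sigma>" using r[of "(0, 0)"] \<sigma>[of 0] tau by (intro norm_triangle_mono) auto
    from quadratic_form_le[OF this, of x x]
    have "x \<bullet> ((R (0, 0) + S 0) *v x) \<le> (r + \<sigma>) * (x \<bullet> x)" by simp
    then have 1: "\<tau>\<^sup>2 * (x \<bullet> ((R (0, 0) + S 0) *v x)) \<le> \<tau>\<^sup>2 * ((r + \<sigma>) * (x \<bullet> x))"
      by (intro mult_left_mono) auto
    have "(LBINT \<theta>:J. x \<bullet> (R (0, \<theta>) *v \<phi> \<theta>)) \<le> (LBINT \<theta>:J. r / 2 * (x \<bullet> x + \<phi> \<theta> \<bullet> \<phi> \<theta>))"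
    proof (rule set_integral_mono)
      fix \<theta> assume "\<theta> \<in> J"
      then show "x \<bullet> (R (0, \<theta>) *v \<phi> \<theta>) \<le> r / 2 * (x \<bullet> x + \<phi> \<theta> \<bullet> \<phi> \<theta>)"
        using quadratic_form_le[OF r[of "(0, \<theta>)"], of x "\<phi> \<theta>"] tau by simp
    qed (intro set_integrable_quadratic set_integrable_mult_right set_integral_add ix in1 compact_J R0_integrable c continuous_intros)+
    also have "\<dots> = r / 2 * (\<tau> * (x \<bullet> x) + ?n)"
      using tau by (simp add: set_integral_add(2)[OF ix in1] set_integral_const_Icc)
    finally have 2: "2 * \<tau> * (LBINT \<theta>:J. x \<bullet> (R (0, \<theta>) *v \<phi> \<theta>)) \<le> 2 * \<tau> * (r / 2 * (\<tau> * (x \<bullet> x) + ?n))"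
      using tau by (intro mult_left_mono) auto
    have "(LBINT s:J. \<phi> s \<bullet> (S s *v \<phi> s)) \<le> (LBINT s:J. \<sigma> * (\<phi> s \<bullet> \<phi> s))"
    proof (rule set_integral_mono)
      fix s assume "s \<in> J"
      then show "\<phi> s \<bullet> (S s *v \<phi> s) \<le> \<sigma> * (\<phi> s \<bullet> \<phi> s)"
        using quadratic_form_le[OF \<sigma>[of s], of "\<phi> s" "\<phi> s"] by simp
    qed (intro set_integrable_quadratic set_integrable_mult_right in1 compact_J S_integrable c)+
    then have 3: "\<tau> * (LBINT s:J. \<phi> s \<bullet> (S s *v \<phi> s)) \<le> \<tau> * (\<sigma> * ?n)"
      using tau by (intro mult_left_mono) auto
    have "(LBINT z:Q. \<phi> (fst z) \<bullet> (R z *v \<phi> (snd z)))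
        \<le> (LBINT z:Q. r / 2 * (\<phi> (fst z) \<bullet> \<phi> (fst z) + \<phi> (snd z) \<bullet> \<phi> (snd z)))"
    proof (rule set_integral_mono)
      fix z assume "z \<in> Q"
      then show "\<phi> (fst z) \<bullet> (R z *v \<phi> (snd z)) \<le> r / 2 * (\<phi> (fst z) \<bullet> \<phi> (fst z) + \<phi> (snd z) \<bullet> \<phi> (snd z))"
        using quadratic_form_le[OF r[of z], of "\<phi> (fst z)" "\<phi> (snd z)"] by simp
    qed (intro set_integrable_quadratic set_integrable_mult_right set_integral_add compact_Q R_integrable
        set_integral_Times_fst_snd(4,5)[OF cn] c2; use tau in simp)+
    also have "\<dots> = r / 2 * (\<tau> * ?n + \<tau> * ?n)"
      using set_integral_Times_fst_snd[OF cn] tau by (simp add: set_integral_add(2))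
    finally have 4: "(LBINT z:Q. \<phi> (fst z) \<bullet> (R z *v \<phi> (snd z))) \<le> r / 2 * (\<tau> * ?n + \<tau> * ?n)" .
    have "form_P x \<phi> \<le> \<tau>\<^sup>2 * ((r + \<sigma>) * (x \<bullet> x)) + 2 * \<tau> * (r / 2 * (\<tau> * (x \<bullet> x) + ?n))
        + \<tau> * (\<sigma> * ?n) + r / 2 * (\<tau> * ?n + \<tau> * ?n)"
      unfolding form_P_def using 1 2 3 4 by linarith
    also have "\<dots> = (\<tau> * (2 * r + \<sigma>)) * (\<tau> * (x \<bullet> x)) + (\<tau> * (2 * r + \<sigma>)) * ?n"
      by (simp add: power2_eq_square field_simps)
    also have "\<dots> = (\<tau> * (2 * r + \<sigma>)) * sq_norm x \<phi>" by (simp add: sq_norm_def algebra_simps)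
    also have "\<dots> \<le> C * sq_norm x \<phi>"
      using tau r0 by (intro mult_right_mono sq_norm_nonneg) (auto simp: C_def algebra_simps)
    finally show ?thesis .
  qed
  moreover have "C > 0" using tau r0 by (auto simp: C_def intro!: add_nonneg_pos)
  ultimately show ?thesis by blast
qed

text \<open>Testing \<open>form_P\<close> with \<open>x = 0\<close> and functions concentrating at \<open>0\<close>: the multiplication part then dominates
  the integral part, whose kernel is bounded.\<close>

lemma S0_nonneg: "0 \<le> v \<bullet> (S 0 *v v)"
proof (rule ccontr)
  define g where "g s = v \<bullet> (S s *v v)" for s
  assume "\<not> 0 \<le> v \<bullet> (S 0 *v v)"
  then have g0: "g 0 < 0" by (simp add: g_def)
  \<comment> \<open>Half of the supposed negative value, so that continuity keeps \<open>g\<close>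
    below \<open>- c\<close> near 0.\<close>
  define c where "c = - g 0 / 2"
  have c: "c > 0" using g0 by (simp add: c_def)
  have cg: "continuous_on J g" unfolding g_def by (intro continuous_intros S_cont)
  obtain \<delta> where \<delta>: "\<delta> > 0" "\<And>s. s \<in> J \<Longrightarrow> \<bar>s\<bar> < \<delta> \<Longrightarrow> \<bar>g s - g 0\<bar> < c"
    using cg c tau unfolding continuous_on_iff dist_real_def
    by (metis atLeastAtMost_iff diff_zero less_eq_real_def neg_le_0_iff_le order_refl)
  have "compact (g ` J)" "compact ((\<lambda>z. v \<bullet> (R z *v v)) ` Q)"
    by (intro compact_continuous_image cg compact_J compact_Q continuous_intros R_cont)+
  then obtain B K where B: "\<And>s. s \<in> J \<Longrightarrow> \<bar>g s\<bar> \<le> B" and K: "\<And>z. z \<in> Q \<Longrightarrow> \<bar>v \<bullet> (R z *v v)\<bar> \<le> K"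
    by (fastforce dest!: compact_imp_bounded simp: bounded_iff)
  have B0: "B \<ge> 0" using B[of 0] tau by force
  have K0: "K \<ge> 0" using K[of "(0, 0)"] tau by force
  \<comment> \<open>An upper bound for the ramp \<rho> at distance at least \<delta> from 0. The
    maximum covers the case that \<delta> exceeds \<tau>.\<close>
  define q where "q = max 0 (1 - \<delta> / \<tau>)"
  have q: "0 \<le> q" "q < 1" using \<delta> tau by (auto simp: q_def)
  have [simp]: "\<tau> \<noteq> 0" using tau by simp
  define \<rho> where "\<rho> s = 1 + s / \<tau>" for s
  have \<rho>: "0 \<le> \<rho> s" "\<rho> s \<le> 1" if "s \<in> J" for s using that tau by (auto simp: \<rho>_def field_simps)
  have c\<rho>: "continuous_on A (\<lambda>s. \<rho> s ^ m)" for A m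
    unfolding \<rho>_def by (intro continuous_intros) simp
  \<comment> \<open>Positivity of \<open>form_P\<close> at x = 0 and \<phi> = \<rho>^n v, normalised
    so that the part near 0 contributes exactly \<open>c\<close>. The tail decays geometrically and
    the kernel part like 1/n, so the limit contradicts \<open>c\<close> > 0. Taking \<open>n\<close>
    as a successor gives the derivative of \<phi> the exponent \<open>k\<close>.\<close>
  have ineq: "c \<le> (B + c) * ((2 * real n + 1) * q ^ (2 * n)) + K * (2 * inverse (real (Suc n)))" if n: "n = Suc k" for n k
  proof -
    define \<phi> where "\<phi> s = \<rho> s ^ n *\<^sub>R v" for s
    define \<phi>' where "\<phi>' s = ((1 + real k) * (1 / \<tau> * \<rho> s ^ k)) *\<^sub>R v" for s
    have "(\<phi> has_vector_derivative \<phi>' s) (at s)" for s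
    proof -
      have "(\<rho> has_real_derivative 1 / \<tau>) (at s)"
        unfolding \<rho>_def[abs_def] by (auto intro!: derivative_eq_intros)
      from has_vector_derivative_scaleR[OF DERIV_power_Suc[OF this, of k] has_vector_derivative_const[of v]]
      show ?thesis unfolding \<phi>_def[abs_def] \<phi>'_def n by simp
    qed
    moreover have "continuous_on UNIV \<phi>'" unfolding \<phi>'_def by (intro continuous_intros c\<rho>)
    ultimately have "\<epsilon> * sq_norm 0 \<phi> \<le> form_P 0 \<phi>" by (rule form_bounds(1))
    then have pos: "0 \<le> form_P 0 \<phi>"
      using eps sq_norm_nonneg[of 0 \<phi>] by (meson less_imp_le mult_nonneg_nonneg order_trans)
    have e1: "\<phi> s \<bullet> (S s *v \<phi> s) = \<rho> s ^ (2 * n) * g s" for s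
      by (simp add: \<phi>_def g_def matrix_vector_mult_scaleR mult_2 power_add)
    have e2: "\<phi> (fst z) \<bullet> (R z *v \<phi> (snd z)) = (\<rho> (fst z) ^ n * \<rho> (snd z) ^ n) * (v \<bullet> (R z *v v))" for z
      by (simp add: \<phi>_def matrix_vector_mult_scaleR)
    have form: "form_P 0 \<phi> = \<tau> * (LBINT s:J. \<rho> s ^ (2 * n) * g s)
        + (LBINT z:Q. (\<rho> (fst z) ^ n * \<rho> (snd z) ^ n) * (v \<bullet> (R z *v v)))"
      unfolding form_P_def e1 e2 by simp
    \<comment> \<open>One majorant for both regions: near 0 the bound \<open>g\<close> \<le>
      \<open>- c\<close> applies, and elsewhere \<rho> \<le> \<open>q\<close> and \<open>g\<close>
      \<le> \<open>B\<close> make the second summand pay for the missing negativity.\<close>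
    have "(LBINT s:J. \<rho> s ^ (2 * n) * g s) \<le> (LBINT s:J. (- c) * \<rho> s ^ (2 * n) + (B + c) * q ^ (2 * n))"
    proof (rule set_integral_mono)
      fix s assume s: "s \<in> J"
      show "\<rho> s ^ (2 * n) * g s \<le> (- c) * \<rho> s ^ (2 * n) + (B + c) * q ^ (2 * n)"
      proof (cases "\<bar>s\<bar> < \<delta>")
        case True
        have "g s \<le> - c" using \<delta>(2)[OF s True] by (simp add: c_def abs_if split: if_splits)
        then have "\<rho> s ^ (2 * n) * g s \<le> \<rho> s ^ (2 * n) * (- c)"
          using \<rho>[OF s] by (intro mult_left_mono) auto
        moreover have "0 \<le> (B + c) * q ^ (2 * n)" using B0 c q by auto
        ultimately show ?thesis by (simp add: mult.commute)
      next
        case False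
        have "s \<le> - \<delta>" using False s by auto
        then have "s / \<tau> \<le> (- \<delta>) / \<tau>" using tau by (intro divide_right_mono) auto
        then have "\<rho> s \<le> q" by (simp add: \<rho>_def q_def)
        then have "\<rho> s ^ (2 * n) \<le> q ^ (2 * n)" using \<rho>[OF s] by (intro power_mono)
        then have "\<rho> s ^ (2 * n) * (g s + c) \<le> q ^ (2 * n) * (B + c)"
          using B[OF s] B0 c q \<rho>[OF s]
          by (meson add_mono abs_le_D1 add_nonneg_nonneg less_imp_le mult_left_mono mult_right_mono order_refl order_trans zero_le_power)
        then show ?thesis by (simp add: algebra_simps)
      qed
    qed (intro set_integrable_compact compact_J continuous_intros c\<rho> cg)+
    also have "\<dots> = - c * (LBINT s:J. \<rho> s ^ (2 * n)) + \<tau> * ((B + c) * q ^ (2 * n))"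
    proof -
      have i: "set_integrable lborel J (\<lambda>s. \<rho> s ^ (2 * n))" by (intro set_integrable_compact compact_J c\<rho>)
      have "(LBINT s:J. (- c) * \<rho> s ^ (2 * n) + (B + c) * q ^ (2 * n))
          = (LBINT s:J. (- c) * \<rho> s ^ (2 * n)) + (LBINT s:J. (B + c) * q ^ (2 * n))"
        by (intro set_integral_add(2) set_integrable_mult_right i set_integrable_compact compact_J continuous_intros)
      also have "(LBINT s:J. (B + c) * q ^ (2 * n)) = \<tau> * ((B + c) * q ^ (2 * n))"
        using set_integral_const_Icc[of "-\<tau>" 0 "(B + c) * q ^ (2 * n)"] tau by simp
      also have "(LBINT s:J. (- c) * \<rho> s ^ (2 * n)) = - c * (LBINT s:J. \<rho> s ^ (2 * n))"
        by (rule set_integral_mult_right)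
      finally show ?thesis .
    qed
    also have "(LBINT s:J. \<rho> s ^ (2 * n)) = \<tau> / (2 * real n + 1)"
      using polynomial_ramp_integral[OF tau, of "2 * n"] by (simp add: \<rho>_def)
    finally have 1: "\<tau> * (LBINT s:J. \<rho> s ^ (2 * n) * g s)
        \<le> \<tau> * (- c * (\<tau> / (2 * real n + 1)) + \<tau> * ((B + c) * q ^ (2 * n)))"
      using tau by (intro mult_left_mono) auto
    have "(LBINT z:Q. (\<rho> (fst z) ^ n * \<rho> (snd z) ^ n) * (v \<bullet> (R z *v v)))
        \<le> (LBINT z:Q. K * (\<rho> (fst z) ^ n * \<rho> (snd z) ^ n))"
    proof (rule set_integral_mono)
      fix z assume z: "z \<in> Q"
      then have "(\<rho> (fst z) ^ n * \<rho> (snd z) ^ n) * (v \<bullet> (R z *v v)) \<le> (\<rho> (fst z) ^ n * \<rho> (snd z) ^ n) * K"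
        using K[OF z] \<rho>(1) by (intro mult_left_mono mult_nonneg_nonneg zero_le_power) auto
      then show "(\<rho> (fst z) ^ n * \<rho> (snd z) ^ n) * (v \<bullet> (R z *v v)) \<le> K * (\<rho> (fst z) ^ n * \<rho> (snd z) ^ n)"
        by (simp add: mult.commute)
    qed (intro set_integrable_compact compact_Q continuous_intros R_cont
          continuous_on_compose2[OF c\<rho>[of UNIV]] subset_UNIV)+
    also have "\<dots> = K * (\<tau> / (real n + 1))\<^sup>2"
      using set_integral_Times_fst_snd(3)[OF c\<rho>[of J n]] polynomial_ramp_integral[OF tau, of n] tau
      by (simp add: \<rho>_def)
    finally have 2: "(LBINT z:Q. (\<rho> (fst z) ^ n * \<rho> (snd z) ^ n) * (v \<bullet> (R z *v v))) \<le> K * (\<tau> / (real n + 1))\<^sup>2" .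
    let ?m = "2 * real n + 1"
    have "0 \<le> \<tau> * (- c * (\<tau> / ?m) + \<tau> * ((B + c) * q ^ (2 * n))) + K * (\<tau> / (real n + 1))\<^sup>2"
      using pos 1 2 unfolding form by linarith
    \<comment> \<open>The factor (2n + 1) / \<tau>^2 cancels the size of the leading multiplication
      term.\<close>
    then have "0 \<le> ?m / \<tau>\<^sup>2 * (\<tau> * (- c * (\<tau> / ?m) + \<tau> * ((B + c) * q ^ (2 * n))) + K * (\<tau> / (real n + 1))\<^sup>2)"
      by (intro mult_nonneg_nonneg) auto
    also have "\<dots> = - c + (B + c) * (?m * q ^ (2 * n)) + K * (?m / (real n + 1)\<^sup>2)"
    proof -
      have nz: "\<tau> \<noteq> 0" "?m \<noteq> 0" "real n + 1 \<noteq> 0" using tau by auto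
      have a: "?m / \<tau>\<^sup>2 * (\<tau> * (c * (\<tau> / ?m))) = c" using nz by (simp add: power2_eq_square)
      have b: "?m / \<tau>\<^sup>2 * (\<tau> * (\<tau> * w)) = ?m * w" for w using nz by (simp add: power2_eq_square)
      have d: "?m / \<tau>\<^sup>2 * (K * (\<tau> / (real n + 1))\<^sup>2) = K * (?m / (real n + 1)\<^sup>2)"
        using nz by (simp add: power_divide)
      have "?m / \<tau>\<^sup>2 * (\<tau> * (- c * (\<tau> / ?m) + \<tau> * ((B + c) * q ^ (2 * n))) + K * (\<tau> / (real n + 1))\<^sup>2)
        = - (?m / \<tau>\<^sup>2 * (\<tau> * (c * (\<tau> / ?m)))) + ?m / \<tau>\<^sup>2 * (\<tau> * (\<tau> * ((B + c) * q ^ (2 * n))))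
          + ?m / \<tau>\<^sup>2 * (K * (\<tau> / (real n + 1))\<^sup>2)"
        by (simp only: ring_distribs mult_minus_left mult_minus_right)
      then show ?thesis unfolding a b d by (simp only: mult.left_commute[of ?m])
    qed
    also have "?m / (real n + 1)\<^sup>2 \<le> 2 * inverse (real (Suc n))"
    proof -
      have "?m \<le> 2 * (real n + 1)" by simp
      then have "?m / (real n + 1)\<^sup>2 \<le> 2 * (real n + 1) / (real n + 1)\<^sup>2" by (intro divide_right_mono) auto
      also have "2 * (real n + 1) / (real n + 1)\<^sup>2 = 2 * inverse (real (Suc n))"
      proof -
        have "2 * w / w\<^sup>2 = 2 * inverse w" if "w \<noteq> 0" for w :: real
          using that by (simp add: power2_eq_square field_simps)
        from this[of "real (Suc n)"] show ?thesis by (simp only: of_nat_Suc of_nat_eq_0_iff add.commute)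
      qed
      finally show ?thesis .
    qed
    finally show ?thesis using K0 by (simp add: mult_left_mono)
  qed
  have "(\<lambda>n. (B + c) * ((2 * real n + 1) * q ^ (2 * n)) + K * (2 * inverse (real (Suc n)))) \<longlonglongrightarrow> (B + c) * 0 + K * (2 * 0)"
    by (intro tendsto_intros weighted_power_decay q LIMSEQ_inverse_real_of_nat)
  then have "c \<le> (B + c) * 0 + K * (2 * 0)"
    by (rule LIMSEQ_le_const) (use ineq in \<open>metis Suc_le_D One_nat_def\<close>)
  then show False using c by simp
qed

text \<open>The left side is the derivative of the functional when the state moves with velocity
  (\<open>xd\<close>, -\<phi>'), i.e. when \<phi> is transported. Integration by parts moves the
  derivative from \<phi> to \<open>R\<close> and \<open>S\<close>. Boundary terms at -\<tau> become
  terms in A1^T x through the left boundary condition; those at 0 meet the \<phi>(0) part of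
  \<open>xd\<close>. What remains in S(0) is -\<phi>(0)^T S(0) \<phi>(0) + 2 \<phi>(0)^T S(0) x,
  times \<tau>; the term contributed by (1/2) S(0) in \<open>S11\<close> completes it to the
  negative square.\<close>

lemma dissipation_identity:
  fixes x :: "real^'n"
  assumes d: "\<And>s. (\<phi> has_vector_derivative \<phi>' s) (at s)" and c': "continuous_on UNIV \<phi>'"
    and x: "\<phi> (-\<tau>) = \<tau> *\<^sub>R (transpose A1 *v x)"
    and xd: "xd = transpose A0 *v x + (1 / \<tau>) *\<^sub>R \<phi> 0"
  shows "2 * \<tau>\<^sup>2 * (xd \<bullet> ((R (0, 0) + S 0) *v x))
      + 2 * \<tau> * ((LBINT \<theta>:J. xd \<bullet> (R (0, \<theta>) *v \<phi> \<theta>)) - (LBINT \<theta>:J. x \<bullet> (R (0, \<theta>) *v \<phi>' \<theta>)))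
      - \<tau> * (LBINT s:J. \<phi>' s \<bullet> (S s *v \<phi> s) + \<phi> s \<bullet> (S s *v \<phi>' s))
      - 2 * (LBINT z:Q. \<phi>' (fst z) \<bullet> (R z *v \<phi> (snd z)))
    = form_D x (\<phi> (-\<tau>)) \<phi> - \<tau> * ((\<phi> 0 - x) \<bullet> (S 0 *v (\<phi> 0 - x)))"
proof -
  have tau0: "- \<tau> < 0" "\<tau> \<noteq> 0" using tau by auto
  have J: "0 \<in> J" "- \<tau> \<in> J" using tau by auto
  have c: "continuous_on J \<phi>"
    using d by (auto intro!: continuous_at_imp_continuous_on has_vector_derivative_continuous)
  have c'J: "continuous_on J \<phi>'" using c' continuous_on_subset by blast
  \<comment> \<open>The abbreviations from \<open>p\<close> to \<open>e\<close> name the quantities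
    that survive integration by parts, so that the identity finally reduces to scalar
    algebra.\<close>
  define p where "p = transpose A0 *v x"
  define r where "r = transpose A1 *v x"
  define a where "a = (LBINT \<theta>:J. R (0, \<theta>) *v \<phi> \<theta>)"
  define b where "b = (LBINT \<theta>:J. R (-\<tau>, \<theta>) *v \<phi> \<theta>)"
  define k where "k = (LBINT s:J. \<phi> s \<bullet> (R0' s *v x))"
  define m where "m = (LBINT s:J. \<phi> s \<bullet> (S' s *v \<phi> s))"
  define e where "e = (LBINT z:Q. \<phi> (fst z) \<bullet> (kernel_E \<tau> R z *v \<phi> (snd z)))"
  have a: "(LBINT \<theta>:J. w \<bullet> (R (0, \<theta>) *v \<phi> \<theta>)) = w \<bullet> a" for w
    unfolding a_def by (intro set_integral_bounded_linear(2) bounded_linear_inner_right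
        set_integrable_matrix_vector compact_J R0_integrable c)
  have b: "(LBINT \<theta>:J. w \<bullet> (R (-\<tau>, \<theta>) *v \<phi> \<theta>)) = w \<bullet> b" for w
    unfolding b_def by (intro set_integral_bounded_linear(2) bounded_linear_inner_right
        set_integrable_matrix_vector compact_J R0_integrable c)
  have i1: "(LBINT \<theta>:J. x \<bullet> (R (0, \<theta>) *v \<phi>' \<theta>)) = \<phi> 0 \<bullet> (R (0, 0) *v x) - \<tau> * (r \<bullet> (R (-\<tau>, 0) *v x)) - k"
  proof -
    \<comment> \<open>Symmetry replaces R(0, \<theta>) by the transpose of R(\<theta>, 0), since
      \<open>R0'\<close> is the derivative of the section in the first argument.\<close>
    have "(LBINT \<theta>:J. x \<bullet> (R (0, \<theta>) *v \<phi>' \<theta>)) = (LBINT \<theta>:J. \<phi>' \<theta> \<bullet> (R (\<theta>, 0) *v x) + \<phi> \<theta> \<bullet> (R (\<theta>, 0) *v 0))"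
    proof (rule set_lebesgue_integral_cong[OF J_finite(1)], intro allI impI)
      fix \<theta> assume "\<theta> \<in> J"
      from R_symD[OF this J(1)]
      have "\<phi>' \<theta> \<bullet> (R (\<theta>, 0) *v x) = x \<bullet> (R (0, \<theta>) *v \<phi>' \<theta>)" by (simp only: inner_transpose_mult)
      then show "x \<bullet> (R (0, \<theta>) *v \<phi>' \<theta>) = \<phi>' \<theta> \<bullet> (R (\<theta>, 0) *v x) + \<phi> \<theta> \<bullet> (R (\<theta>, 0) *v 0)" by simp
    qed
    also have "\<dots> = \<phi> 0 \<bullet> (R (0, 0) *v x) - \<phi> (-\<tau>) \<bullet> (R (-\<tau>, 0) *v x) - k"
      unfolding k_def
      by (rule weak_integration_by_parts_matrix[OF tau0(1) R0_cont(3) R0'_integrable R0'_weak d c'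
            has_vector_derivative_const continuous_on_const])
    finally show ?thesis by (simp add: x r_def)
  qed
  have i2: "(LBINT s:J. \<phi>' s \<bullet> (S s *v \<phi> s) + \<phi> s \<bullet> (S s *v \<phi>' s))
      = \<phi> 0 \<bullet> (S 0 *v \<phi> 0) - \<tau>\<^sup>2 * (r \<bullet> (S (-\<tau>) *v r)) - m"
    unfolding m_def
    using weak_integration_by_parts_matrix[OF tau0(1) S_cont S'_integrable S'_weak d c' d c']
    by (simp add: x r_def matrix_vector_mult_scaleR power2_eq_square)
  have i3: "2 * (LBINT z:Q. \<phi>' (fst z) \<bullet> (R z *v \<phi> (snd z))) = 2 * (\<phi> 0 \<bullet> a - \<tau> * (r \<bullet> b)) - e"
    using weak_kernel_by_parts[OF tau0(1) R_cont R_partial R_symD d c']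
    by (simp add: a b e_def kernel_E_def x r_def)
  have i4: "(LBINT \<theta>:J. x \<bullet> (S13 \<tau> A0 A1 R \<theta> *v \<phi> \<theta>)) = p \<bullet> a + r \<bullet> b + k"
  proof -
    have "(LBINT \<theta>:J. x \<bullet> (S13 \<tau> A0 A1 R \<theta> *v \<phi> \<theta>))
        = (LBINT \<theta>:J. p \<bullet> (R (0, \<theta>) *v \<phi> \<theta>) + r \<bullet> (R (-\<tau>, \<theta>) *v \<phi> \<theta>) + \<phi> \<theta> \<bullet> (R0' \<theta> *v x))"
      by (simp add: S13_def matrix_vector_mult_add_rdistrib inner_add_right inner_matrix_mult_mult p_def r_def
          inner_transpose_mult del: transpose_matrix_vector)
    also have "\<dots> = (LBINT \<theta>:J. p \<bullet> (R (0, \<theta>) *v \<phi> \<theta>)) + (LBINT \<theta>:J. r \<bullet> (R (-\<tau>, \<theta>) *v \<phi> \<theta>)) + k"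
    proof -
      have j: "set_integrable lborel J (\<lambda>\<theta>. p \<bullet> (R (0, \<theta>) *v \<phi> \<theta>))"
        "set_integrable lborel J (\<lambda>\<theta>. r \<bullet> (R (-\<tau>, \<theta>) *v \<phi> \<theta>))"
        "set_integrable lborel J (\<lambda>\<theta>. \<phi> \<theta> \<bullet> (R0' \<theta> *v x))"
        by (intro set_integrable_quadratic compact_J R0_integrable R0'_integrable c continuous_intros)+
      show ?thesis unfolding k_def by (simp add: set_integral_add j)
    qed
    finally show ?thesis by (simp add: a b)
  qed
  have s11: "x \<bullet> (S11 \<tau> A0 A1 S R *v x)
      = \<tau> * (p \<bullet> ((R (0, 0) + S 0) *v x)) + \<tau> * (r \<bullet> (R (-\<tau>, 0) *v x)) + (1/2) * (x \<bullet> (S 0 *v x))"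
    by (simp add: S11_def matrix_vector_mult_add_rdistrib[of "_ *\<^sub>R _"] matrix_vector_mult_add_rdistrib[of "_ + _" "_ *\<^sub>R _"]
        inner_add_right inner_matrix_mult_mult p_def r_def
        scaleR_matrix_vector_assoc[symmetric] del: transpose_matrix_vector)
  have s12: "x \<bullet> (S12 \<tau> A1 S *v (\<tau> *\<^sub>R r)) = \<tau>\<^sup>2 * (r \<bullet> (S (-\<tau>) *v r))"
    by (simp add: S12_def inner_matrix_mult_mult r_def matrix_vector_mult_scaleR power2_eq_square
        scaleR_matrix_vector_assoc[symmetric] del: transpose_matrix_vector)
  have neg: "(- M) *v w = - (M *v w)" for M :: "real^'n^'n" and w
    by (simp add: vec_eq_iff matrix_vector_mult_def sum_negf)
  have s22: "(\<tau> *\<^sub>R r) \<bullet> (S22 \<tau> S *v (\<tau> *\<^sub>R r)) = - (\<tau>\<^sup>2 * (r \<bullet> (S (-\<tau>) *v r)))"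
    by (simp add: S22_def neg matrix_vector_mult_scaleR power2_eq_square)
  have symS: "x \<bullet> (S 0 *v \<phi> 0) = \<phi> 0 \<bullet> (S 0 *v x)"
    using inner_transpose_mult[of x "S 0" "\<phi> 0"] bspec[OF S_sym J(1)] by (simp only:)
  have N: "w \<bullet> ((R (0, 0) + S 0) *v x) = w \<bullet> (R (0, 0) *v x) + w \<bullet> (S 0 *v x)" for w
    by (simp add: matrix_vector_mult_add_rdistrib inner_add_right)
  have sq: "(\<phi> 0 - x) \<bullet> (S 0 *v (\<phi> 0 - x)) = \<phi> 0 \<bullet> (S 0 *v \<phi> 0) - 2 * (\<phi> 0 \<bullet> (S 0 *v x)) + x \<bullet> (S 0 *v x)"
    by (simp add: matrix_vector_mult_diff_distrib inner_diff_left inner_diff_right symS)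
  have x': "\<phi> (-\<tau>) = \<tau> *\<^sub>R r" by (simp add: x r_def)
  have xd': "xd \<bullet> w = p \<bullet> w + (1 / \<tau>) * (\<phi> 0 \<bullet> w)" for w
    by (simp add: xd p_def inner_add_left del: transpose_matrix_vector)
  have cancel: "\<tau>\<^sup>2 * ((1 / \<tau>) * w) = \<tau> * w" "\<tau> * ((1 / \<tau>) * w) = w" for w
    using tau0 by (simp_all add: power2_eq_square)
  have "2 * \<tau>\<^sup>2 * (xd \<bullet> ((R (0, 0) + S 0) *v x)) = 2 * \<tau>\<^sup>2 * (p \<bullet> ((R (0, 0) + S 0) *v x))
      + 2 * \<tau> * (\<phi> 0 \<bullet> ((R (0, 0) + S 0) *v x))"
    unfolding xd' distrib_left mult.assoc cancel ..
  moreover have "2 * \<tau> * (xd \<bullet> a) = 2 * \<tau> * (p \<bullet> a) + 2 * (\<phi> 0 \<bullet> a)"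
    unfolding xd' distrib_left mult.assoc cancel ..
  ultimately show ?thesis
    unfolding form_D_def x' s12 s22 s11 a i1 i2 i3 i4 sq m_def[symmetric] e_def[symmetric]
    unfolding right_diff_distrib[of "2 * \<tau>"]
    by (simp add: N algebra_simps power2_eq_square)
qed

section \<open>Decay of the transposed system and transfer to the original one\<close>

lemma functional_deriv:
  assumes dy: "\<And>t. (y has_vector_derivative y' t) (at t)" and cy': "continuous_on UNIV y'"
    and dg: "\<And>t. (g has_vector_derivative g' t) (at t)" and cg': "continuous_on UNIV g'"
  shows "((\<lambda>t. form_P (y t) (\<lambda>s. g (t - s))) has_real_derivative
      2 * \<tau>\<^sup>2 * (y' t \<bullet> ((R (0, 0) + S 0) *v y t))
      + 2 * \<tau> * (LBINT \<theta>:J. y' t \<bullet> (R (0, \<theta>) *v g (t - \<theta>)) + y t \<bullet> (R (0, \<theta>) *v g' (t - \<theta>)))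
      + \<tau> * (LBINT s:J. g' (t - s) \<bullet> (S s *v g (t - s)) + g (t - s) \<bullet> (S s *v g' (t - s)))
      + (LBINT z:Q. g' (t - fst z) \<bullet> (R z *v g (t - snd z)) + g (t - fst z) \<bullet> (R z *v g' (t - snd z)))) (at t)"
proof -
  have cy: "continuous_on UNIV y" and cg: "continuous_on UNIV g"
    using dy dg by (auto intro!: continuous_at_imp_continuous_on has_vector_derivative_continuous)
  note cc = continuous_intros continuous_on_compose2[OF cy] continuous_on_compose2[OF cg]
    continuous_on_compose2[OF cy'] continuous_on_compose2[OF cg'] subset_UNIV
  have dsh: "((\<lambda>t. g (t - s)) has_vector_derivative g' (t - s)) (at t)" for s t
  proof -
    have "((\<lambda>t. g (t - s)) has_vector_derivative 1 *\<^sub>R g' (t - s)) (at t)"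
      by (rule vector_diff_chain_at[of "\<lambda>t. t - s", unfolded o_def])
        (auto intro!: derivative_eq_intros dg)
    then show ?thesis by simp
  qed
  have JQ: "J = cbox (-\<tau>) 0" "Q = cbox (-\<tau>, -\<tau>) (0, 0)"
    by (simp_all add: cbox_Pair_eq)
  have 1: "((\<lambda>t. y t \<bullet> ((R (0, 0) + S 0) *v y t)) has_real_derivative 2 * (y' t \<bullet> ((R (0, 0) + S 0) *v y t))) (at t)"
  proof -
    let ?N = "R (0, 0) + S 0"
    have "transpose ?N = ?N"
      using R_symD[of 0 0] S_sym tau by (simp add: vec_eq_iff transpose_def)
    then have sym: "y t \<bullet> (?N *v y' t) = y' t \<bullet> (?N *v y t)"
      using inner_transpose_mult[of "y t" ?N "y' t"] by simp
    have "((\<lambda>t. ?N *v y t) has_vector_derivative ?N *v y' t) (at t)"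
      by (rule bounded_linear.has_vector_derivative[OF _ dy]) simp
    from bounded_bilinear.has_vector_derivative[OF bounded_bilinear_inner dy this]
    show ?thesis using sym by (simp add: has_real_derivative_iff_has_vector_derivative)
  qed
  have 2: "((\<lambda>t. LBINT \<theta>:J. y t \<bullet> (R (0, \<theta>) *v g (t - \<theta>))) has_real_derivative
      (LBINT \<theta>:J. y' t \<bullet> (R (0, \<theta>) *v g (t - \<theta>)) + y t \<bullet> (R (0, \<theta>) *v g' (t - \<theta>)))) (at t)"
    using R0_cont(1) unfolding JQ by (intro leibniz_quadratic dy dsh cc)
  have 3: "((\<lambda>t. LBINT s:J. g (t - s) \<bullet> (S s *v g (t - s))) has_real_derivative
      (LBINT s:J. g' (t - s) \<bullet> (S s *v g (t - s)) + g (t - s) \<bullet> (S s *v g' (t - s)))) (at t)"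
    using S_cont unfolding JQ by (intro leibniz_quadratic dsh cc)
  have 4: "((\<lambda>t. LBINT z:Q. g (t - fst z) \<bullet> (R z *v g (t - snd z))) has_real_derivative
      (LBINT z:Q. g' (t - fst z) \<bullet> (R z *v g (t - snd z)) + g (t - fst z) \<bullet> (R z *v g' (t - snd z)))) (at t)"
    using R_cont unfolding JQ(2) by (intro leibniz_quadratic dsh cc)
  show ?thesis
    unfolding form_P_def
    using DERIV_add[OF DERIV_add[OF DERIV_add[OF DERIV_cmult[OF 1, of "\<tau>\<^sup>2"] DERIV_cmult[OF 2, of "2 * \<tau>"]]
          DERIV_cmult[OF 3, of \<tau>]] 4]
    by (simp only: mult_ac)
qed

text \<open>With n the squared norm of the state and W the functional, \<epsilon> n \<le> W \<le> C
  n and W' \<le> -\<epsilon> n give W' \<le> -(\<epsilon>/C) W. The rate is halved because W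
  controls a square. The trajectory has to be C^1 on the whole line so that every state is C^1, but
  the equation is required only from \<open>T0\<close> on. The rate does not depend on the
  trajectory; only \<open>K\<close> does.\<close>

lemma transposed_decay:
  "\<exists>\<gamma>>0. \<forall>y y' T0. (\<forall>t. (y has_vector_derivative y' t) (at t)) \<longrightarrow> continuous_on UNIV y' \<longrightarrow>
     (\<forall>t\<ge>T0. y' t = transpose A0 *v y t + transpose A1 *v y (t - \<tau>)) \<longrightarrow>
     (\<exists>K\<ge>0. \<forall>t\<ge>T0. norm (y t) \<le> K * exp (- \<gamma> * t))"
proof -
  obtain C where C: "C > 0" "\<And>x \<phi>. continuous_on J \<phi> \<Longrightarrow> form_P x \<phi> \<le> C * sq_norm x \<phi>"
    using form_P_upper by blast
  define c where "c = \<epsilon> / C"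
  have c: "c > 0" "c * C = \<epsilon>" using C eps by (auto simp: c_def)
  have "\<exists>K\<ge>0. \<forall>t\<ge>T0. norm (y t) \<le> K * exp (- (c / 2) * t)"
    if dy: "\<forall>t. (y has_vector_derivative y' t) (at t)" and cy': "continuous_on UNIV y'"
      and ode: "\<forall>t\<ge>T0. y' t = transpose A0 *v y t + transpose A1 *v y (t - \<tau>)" for y y' T0
  proof -
    \<comment> \<open>The state at time t is s -> g(t - s), so time and space derivatives differ
      only by sign. The factor \<tau> offsets the weight that the constant component has in the
      inner product.\<close>
    define g where "g u = \<tau> *\<^sub>R (transpose A1 *v y (u - \<tau>))" for u
    define g' where "g' u = \<tau> *\<^sub>R (transpose A1 *v y' (u - \<tau>))" for u
    have dg: "(g has_vector_derivative g' t) (at t)" for t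
    proof -
      have "((\<lambda>u. y (u - \<tau>)) has_vector_derivative 1 *\<^sub>R y' (t - \<tau>)) (at t)"
        by (rule vector_diff_chain_at[of "\<lambda>t. t - \<tau>", unfolded o_def])
          (use dy in \<open>auto intro!: derivative_eq_intros\<close>)
      then have "((\<lambda>u. transpose A1 *v y (u - \<tau>)) has_vector_derivative transpose A1 *v y' (t - \<tau>)) (at t)"
        by (intro bounded_linear.has_vector_derivative[OF matrix_vector_mul_bounded_linear]) simp
      then show ?thesis
        unfolding g_def[abs_def] g'_def
        by (rule bounded_linear.has_vector_derivative[OF bounded_linear_scaleR_right])
    qed
    have cg': "continuous_on UNIV g'"
      unfolding g'_def by (intro continuous_intros continuous_on_compose2[OF cy']) auto
    define W where "W t = form_P (y t) (\<lambda>s. g (t - s))" for t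
    define n where "n t = sq_norm (y t) (\<lambda>s. g (t - s))" for t
    define W' where "W' t = 2 * \<tau>\<^sup>2 * (y' t \<bullet> ((R (0, 0) + S 0) *v y t))
      + 2 * \<tau> * (LBINT \<theta>:J. y' t \<bullet> (R (0, \<theta>) *v g (t - \<theta>)) + y t \<bullet> (R (0, \<theta>) *v g' (t - \<theta>)))
      + \<tau> * (LBINT s:J. g' (t - s) \<bullet> (S s *v g (t - s)) + g (t - s) \<bullet> (S s *v g' (t - s)))
      + (LBINT z:Q. g' (t - fst z) \<bullet> (R z *v g (t - snd z)) + g (t - fst z) \<bullet> (R z *v g' (t - snd z)))" for t
    have dW: "(W has_real_derivative W' t) (at t)" for t
      unfolding W_def[abs_def] W'_def using dy cy' dg cg' by (intro functional_deriv) auto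
    have d\<phi>: "((\<lambda>s. g (t - s)) has_vector_derivative - g' (t - s)) (at s)" for t s
    proof -
      have "((\<lambda>s. g (t - s)) has_vector_derivative (- 1) *\<^sub>R g' (t - s)) (at s)"
        by (rule vector_diff_chain_at[of "\<lambda>s. t - s", unfolded o_def])
          (auto intro!: derivative_eq_intros dg)
      then show ?thesis by simp
    qed
    have c\<phi>': "continuous_on UNIV (\<lambda>s. - g' (t - s))" for t
      by (intro continuous_intros continuous_on_compose2[OF cg']) auto
    have c\<phi>: "continuous_on A (\<lambda>s. g (t - s))" for A t
      using d\<phi> by (auto intro!: continuous_at_imp_continuous_on has_vector_derivative_continuous)
    have cg'J: "continuous_on A (\<lambda>s. g' (t - s))" for A t
      by (intro continuous_on_compose2[OF cg'] continuous_intros) auto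
    have W'_le: "W' t \<le> - \<epsilon> * n t" if t: "t \<ge> T0" for t
    proof -
      let ?\<phi> = "\<lambda>s. g (t - s)" and ?\<phi>' = "\<lambda>s. - g' (t - s)"
      have neg: "M *v (- w) = - (M *v w)" for M :: "real^'n^'n" and w
        by (rule linear_simps(4)[OF matrix_vector_mul_bounded_linear])
      have left: "?\<phi> (-\<tau>) = \<tau> *\<^sub>R (transpose A1 *v y t)" by (simp add: g_def)
      have xd: "y' t = transpose A0 *v y t + (1 / \<tau>) *\<^sub>R ?\<phi> 0"
        using ode t tau by (simp add: g_def)
      have j1: "(LBINT \<theta>:J. y' t \<bullet> (R (0, \<theta>) *v g (t - \<theta>)) + y t \<bullet> (R (0, \<theta>) *v g' (t - \<theta>)))
        = (LBINT \<theta>:J. y' t \<bullet> (R (0, \<theta>) *v ?\<phi> \<theta>)) - (LBINT \<theta>:J. y t \<bullet> (R (0, \<theta>) *v ?\<phi>' \<theta>))"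
      proof -
        have i: "set_integrable lborel J (\<lambda>\<theta>. y' t \<bullet> (R (0, \<theta>) *v ?\<phi> \<theta>))"
          "set_integrable lborel J (\<lambda>\<theta>. y t \<bullet> (R (0, \<theta>) *v ?\<phi>' \<theta>))"
          by (intro set_integrable_quadratic compact_J R0_integrable c\<phi> cg'J continuous_intros)+
        show ?thesis unfolding set_integral_diff(2)[OF i, symmetric] by (simp add: neg)
      qed
      have j2: "(LBINT s:J. g' (t - s) \<bullet> (S s *v g (t - s)) + g (t - s) \<bullet> (S s *v g' (t - s)))
        = - (LBINT s:J. ?\<phi>' s \<bullet> (S s *v ?\<phi> s) + ?\<phi> s \<bullet> (S s *v ?\<phi>' s))"
      proof -
        have i: "set_integrable lborel J (\<lambda>s. ?\<phi>' s \<bullet> (S s *v ?\<phi> s) + ?\<phi> s \<bullet> (S s *v ?\<phi>' s))"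
          by (intro set_integral_add set_integrable_quadratic compact_J S_integrable c\<phi> cg'J continuous_intros)
        show ?thesis unfolding set_integral_uminus[OF i, symmetric] by (simp add: neg add.commute)
      qed
      have c2: "continuous_on Q (\<lambda>z. f (fst z))" "continuous_on Q (\<lambda>z. f (snd z))"
        if "continuous_on UNIV f" for f :: "real \<Rightarrow> real^'n"
        by (auto intro!: continuous_on_compose2[OF that] continuous_intros)
      have j3: "(LBINT z:Q. g' (t - fst z) \<bullet> (R z *v g (t - snd z)) + g (t - fst z) \<bullet> (R z *v g' (t - snd z)))
        = - 2 * (LBINT z:Q. ?\<phi>' (fst z) \<bullet> (R z *v ?\<phi> (snd z)))"
      proof -
        have i: "set_integrable lborel Q (\<lambda>z. ?\<phi>' (fst z) \<bullet> (R z *v ?\<phi> (snd z)))"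
          "set_integrable lborel Q (\<lambda>z. ?\<phi> (fst z) \<bullet> (R z *v ?\<phi>' (snd z)))"
          using c2[OF c\<phi>[of UNIV t]] c2[OF c\<phi>'[of t]]
          by (intro set_integrable_quadratic compact_Q R_integrable; simp)+
        have "(LBINT z:Q. ?\<phi> (fst z) \<bullet> (R z *v ?\<phi>' (snd z))) = (LBINT z:Q. ?\<phi>' (fst z) \<bullet> (R z *v ?\<phi> (snd z)))"
        proof (rule symmetric_kernel_swap[OF R_cont R_symD c\<phi>])
          show "continuous_on J (\<lambda>s. - g' (t - s))" by (intro continuous_intros cg'J)
        qed auto
        \<comment> \<open>By symmetry of the kernel, the derivative falling on either factor
          contributes the same amount.\<close>
        then have "- 2 * (LBINT z:Q. ?\<phi>' (fst z) \<bullet> (R z *v ?\<phi> (snd z)))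
          = - (LBINT z:Q. ?\<phi>' (fst z) \<bullet> (R z *v ?\<phi> (snd z)) + ?\<phi> (fst z) \<bullet> (R z *v ?\<phi>' (snd z)))"
          by (simp only: set_integral_add(2)[OF i])
        also have "\<dots> = (LBINT z:Q. - (?\<phi>' (fst z) \<bullet> (R z *v ?\<phi> (snd z)) + ?\<phi> (fst z) \<bullet> (R z *v ?\<phi>' (snd z))))"
          by (rule set_integral_uminus[symmetric]) (intro set_integral_add i)
        finally show ?thesis by (simp add: neg add.commute)
      qed
      have "W' t = form_D (y t) (?\<phi> (-\<tau>)) ?\<phi> - \<tau> * ((?\<phi> 0 - y t) \<bullet> (S 0 *v (?\<phi> 0 - y t)))"
        unfolding W'_def j1 j2 j3 dissipation_identity[OF d\<phi> c\<phi>' left xd, symmetric] by simp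
      also have "\<dots> \<le> form_D (y t) (?\<phi> (-\<tau>)) ?\<phi>"
        using S0_nonneg[of "?\<phi> 0 - y t"] tau by simp
      also have "\<dots> \<le> - \<epsilon> * n t"
        unfolding n_def by (rule form_bounds(2)[OF d\<phi> c\<phi>'])
      finally show ?thesis .
    qed
    have Wn: "W t \<le> C * n t" for t unfolding W_def n_def by (rule C(2)[OF c\<phi>])
    define U where "U t = W t * exp (c * t)" for t
    have dU: "(U has_real_derivative (W' t + c * W t) * exp (c * t)) (at t)" for t
      unfolding U_def[abs_def] by (auto intro!: derivative_eq_intros dW simp: algebra_simps)
    have U: "U t \<le> U T0" if t: "t \<ge> T0" for t
    proof (rule DERIV_nonpos_imp_nonincreasing[OF t])
      fix u assume u: "T0 \<le> u" "u \<le> t"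
      have "c * W u \<le> \<epsilon> * n u"
        using mult_left_mono[OF Wn[of u], of c] c by (simp add: mult.assoc[symmetric])
      with W'_le[OF u(1)] have "W' u + c * W u \<le> 0" by linarith
      then show "\<exists>d. (U has_real_derivative d) (at u) \<and> d \<le> 0"
        using dU by (intro exI[of _ "(W' u + c * W u) * exp (c * u)"]) (simp add: mult_nonpos_nonneg)
    qed
    \<comment> \<open>The constant component alone contributes \<tau> times the squared norm of y(t)
      to the squared norm of the state, so \<epsilon> \<tau> times that square is at most W.\<close>
    define K where "K = sqrt (\<bar>U T0\<bar> / (\<epsilon> * \<tau>))"
    have et: "\<epsilon> * \<tau> > 0" using eps tau by simp
    have "norm (y t) \<le> K * exp (- (c / 2) * t)" if t: "t \<ge> T0" for t
    proof -
      have "0 \<le> (LBINT s:J. g (t - s) \<bullet> g (t - s))"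
        unfolding set_lebesgue_integral_def by (intro integral_nonneg_AE) auto
      then have "\<tau> * (norm (y t))\<^sup>2 \<le> n t" by (simp add: n_def sq_norm_def power2_norm_eq_inner)
      then have "\<epsilon> * (\<tau> * (norm (y t))\<^sup>2) \<le> \<epsilon> * n t" using eps by (intro mult_left_mono) auto
      also have "\<dots> \<le> W t" unfolding n_def W_def by (rule form_bounds(1)[OF d\<phi> c\<phi>'])
      also have "W t = U t * exp (- c * t)" by (simp add: U_def exp_minus)
      also have "\<dots> \<le> \<bar>U T0\<bar> * exp (- c * t)" using U[OF t] by (intro mult_right_mono) auto
      finally have "(norm (y t))\<^sup>2 \<le> \<bar>U T0\<bar> / (\<epsilon> * \<tau>) * exp (- c * t)"
        using et by (simp add: field_simps)
      also have "\<dots> = (K * exp (- (c / 2) * t))\<^sup>2"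
      proof -
        have "(exp (- (c / 2) * t))\<^sup>2 = exp (- c * t)"
          unfolding power2_eq_square mult_exp_exp by simp
        moreover have "K\<^sup>2 = \<bar>U T0\<bar> / (\<epsilon> * \<tau>)" using et by (simp add: K_def)
        ultimately show ?thesis unfolding power_mult_distrib by simp
      qed
      finally show ?thesis by (rule power2_le_imp_le) (use et in \<open>simp add: K_def\<close>)
    qed
    moreover have "K \<ge> 0" using et by (simp add: K_def)
    ultimately show ?thesis by blast
  qed
  then show ?thesis using c(1) by (intro exI[of _ "c / 2"]) auto
qed

text \<open>The fundamental solution is smooth enough only after time \<tau>, so its early part is
  replaced by a tangent line. The decay result applies to the modified function, which agrees with
  the original at all late times. Boundedness on the remaining compact interval enlarges the
  constant without changing the rate.\<close>

lemma fundamental_solution_decay: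
  "\<exists>\<gamma>>0. \<forall>e. \<exists>Y M. continuous_on UNIV Y \<and> (\<forall>t\<le>0. Y t = 0) \<and>
    (\<forall>t\<ge>0. (Y has_vector_derivative (e + transpose A0 *v Y t + transpose A1 *v Y (t - \<tau>))) (at t within {0..})) \<and>
    M \<ge> 0 \<and> (\<forall>t\<ge>0. norm (e + transpose A0 *v Y t + transpose A1 *v Y (t - \<tau>)) \<le> M * exp (- \<gamma> * t))"
proof -
  obtain \<gamma> where \<gamma>: "\<gamma> > 0" and dec: "\<And>y y' T0. (\<forall>t. (y has_vector_derivative y' t) (at t)) \<Longrightarrow>
      continuous_on UNIV y' \<Longrightarrow> (\<forall>t\<ge>T0. y' t = transpose A0 *v y t + transpose A1 *v y (t - \<tau>)) \<Longrightarrow>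
      (\<exists>K\<ge>0. \<forall>t\<ge>T0. norm (y t) \<le> K * exp (- \<gamma> * t))"
    using transposed_decay by blast
  have "\<exists>Y M. continuous_on UNIV Y \<and> (\<forall>t\<le>0. Y t = 0) \<and>
    (\<forall>t\<ge>0. (Y has_vector_derivative (e + transpose A0 *v Y t + transpose A1 *v Y (t - \<tau>))) (at t within {0..})) \<and>
    M \<ge> 0 \<and> (\<forall>t\<ge>0. norm (e + transpose A0 *v Y t + transpose A1 *v Y (t - \<tau>)) \<le> M * exp (- \<gamma> * t))" for e
  proof -
    obtain Y where Yc: "continuous_on UNIV Y" and Y0: "\<forall>t\<le>0. Y t = 0"
      and Yd: "\<forall>t\<ge>0. (Y has_vector_derivative (e + transpose A0 *v Y t + transpose A1 *v Y (t - \<tau>))) (at t within {0..})"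
      using delay_equation_exists[OF tau, of e "transpose A0" "transpose A1"] by blast
    define y where "y t = e + transpose A0 *v Y t + transpose A1 *v Y (t - \<tau>)" for t
    define D where "D t = transpose A0 *v y t + transpose A1 *v y (t - \<tau>)" for t
    have cy: "continuous_on UNIV y"
      unfolding y_def by (intro continuous_intros continuous_on_compose2[OF Yc]) auto
    have cD: "continuous_on UNIV D"
      unfolding D_def by (intro continuous_intros continuous_on_compose2[OF cy]) auto
    have dY: "(Y has_vector_derivative y t) (at t)" if "t > 0" for t
    proof -
      have "at t within {0..} = at t" using that by (intro at_within_interior) auto
      then show ?thesis using Yd[rule_format, of t] that by (simp add: y_def)
    qed
    have mv: "((\<lambda>t. B *v f t) has_vector_derivative B *v f') F"
      if "(f has_vector_derivative f') F" for B :: "real^'n^'n" and f f' F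
      by (rule bounded_linear.has_vector_derivative[OF _ that]) simp
    have dy: "(y has_vector_derivative D t) (at t)" if "t > \<tau>" for t
    proof -
      have "((\<lambda>t. Y (t - \<tau>)) has_vector_derivative (1::real) *\<^sub>R y (t - \<tau>)) (at t)"
        by (rule vector_diff_chain_at[of "\<lambda>t. t - \<tau>", unfolded o_def])
          (use dY[of "t - \<tau>"] that in \<open>auto intro!: derivative_eq_intros\<close>)
      then have 2: "((\<lambda>t. Y (t - \<tau>)) has_vector_derivative y (t - \<tau>)) (at t)" by simp
      have 1: "(Y has_vector_derivative y t) (at t)" using that tau by (intro dY) auto
      have "(y has_vector_derivative 0 + transpose A0 *v y t + transpose A1 *v y (t - \<tau>)) (at t)"
        unfolding y_def
        by (intro has_vector_derivative_add has_vector_derivative_const mv 1[unfolded y_def] 2[unfolded y_def])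
      then show ?thesis by (simp add: D_def)
    qed
    \<comment> \<open>A time strictly past \<tau>, where \<open>Y\<close> shifted by the delay no
      longer has its corner and \<open>D\<close> is the derivative of \<open>y\<close>.\<close>
    define T where "T = 2 * \<tau>"
    \<comment> \<open>Continuing \<open>y\<close> to the left of \<open>T\<close> by its tangent
      gives a C^1 function on the whole line.\<close>
    define z where "z t = (if t \<in> {T..} then y t else y T + (t - T) *\<^sub>R D T)" for t
    define z' where "z' t = D (max t T)" for t
    have dz: "(z has_vector_derivative z' t) (at t)" for t
    proof -
      have "(z has_vector_derivative (if t \<in> {T..} then D t else D T)) (at t within UNIV)"
        unfolding z_def[abs_def]
      proof (rule has_vector_derivative_If_within_closures)
        show "t \<in> {T..} \<union> {..<T}" "UNIV = {T..} \<union> {..<T}" by auto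
        show "(y has_vector_derivative D t) (at t within {T..} \<union> closure {T..} \<inter> closure {..<T})"
          if "t \<in> {T..} \<union> closure {T..} \<inter> closure {..<T}"
        proof (rule has_vector_derivative_at_within[OF dy])
          have "T \<le> t" using that by auto
          then show "\<tau> < t" using tau by (simp add: T_def)
        qed
        show "((\<lambda>t. y T + (t - T) *\<^sub>R D T) has_vector_derivative D T) (at t within {..<T} \<union> closure {T..} \<inter> closure {..<T})"
        proof -
          have "((\<lambda>t. (t - T) *\<^sub>R D T) has_vector_derivative (t - T) *\<^sub>R 0 + 1 *\<^sub>R D T) (at t)"
            by (rule has_vector_derivative_scaleR) (auto intro!: derivative_eq_intros)
          then have "((\<lambda>t. y T + (t - T) *\<^sub>R D T) has_vector_derivative 0 + D T) (at t)"
            by (intro has_vector_derivative_add has_vector_derivative_const) simp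
          then show ?thesis by (simp add: has_vector_derivative_at_within)
        qed
        assume "t \<in> closure {T..}" "t \<in> closure {..<T}"
        then have "t = T" by auto
        then show "y t = y T + (t - T) *\<^sub>R D T" "D t = D T" by auto
      qed
      then show ?thesis by (cases "T \<le> t") (simp_all add: z'_def max_absorb1 max_absorb2)
    qed
    have cz': "continuous_on UNIV z'"
      unfolding z'_def by (intro continuous_on_compose2[OF cD] continuous_intros) auto
    \<comment> \<open>The equation needs both t and t - \<tau> on the unmodified side, hence the
      start at T + \<tau>.\<close>
    have ode: "\<forall>t\<ge>T + \<tau>. z' t = transpose A0 *v z t + transpose A1 *v z (t - \<tau>)"
    proof (intro allI impI)
      fix t assume "t \<ge> T + \<tau>"
      then have "t \<ge> T" "t - \<tau> \<ge> T" using tau by auto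
      then show "z' t = transpose A0 *v z t + transpose A1 *v z (t - \<tau>)"
        by (simp add: z'_def z_def D_def max_absorb1)
    qed
    obtain K where K: "K \<ge> 0" "\<And>t. t \<ge> T + \<tau> \<Longrightarrow> norm (z t) \<le> K * exp (- \<gamma> * t)"
      using dec[OF _ cz' ode] dz by blast
    have "compact (y ` {0..T + \<tau>})"
      by (intro compact_continuous_image continuous_on_subset[OF cy] compact_Icc) auto
    then obtain B where B: "\<And>t. t \<in> {0..T + \<tau>} \<Longrightarrow> norm (y t) \<le> B"
      by (fastforce dest!: compact_imp_bounded simp: bounded_iff)
    have B0: "B \<ge> 0" using order_trans[OF norm_ge_zero B[of 0]] tau by (simp add: T_def)
    \<comment> \<open>The exponential compensates exp(-\<gamma> t) on the initial interval, where
      only the bound \<open>B\<close> is available.\<close>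
    define M where "M = K + B * exp (\<gamma> * (T + \<tau>))"
    have "norm (y t) \<le> M * exp (- \<gamma> * t)" if t: "t \<ge> 0" for t
    proof (cases "t \<ge> T + \<tau>")
      case True
      then have "norm (y t) \<le> K * exp (- \<gamma> * t)" using K(2)[OF True] tau by (simp add: z_def)
      also have "\<dots> \<le> M * exp (- \<gamma> * t)" using B0 by (intro mult_right_mono) (auto simp: M_def)
      finally show ?thesis .
    next
      case False
      then have "norm (y t) \<le> B * 1" using B[of t] t by simp
      also have "\<dots> \<le> B * (exp (\<gamma> * (T + \<tau>)) * exp (- \<gamma> * t))"
        using False \<gamma> B0 by (intro mult_left_mono) (auto simp: mult_exp_exp right_diff_distrib[symmetric])
      also have "\<dots> \<le> M * exp (- \<gamma> * t)"
        unfolding mult.assoc[symmetric] using K(1) by (intro mult_right_mono) (auto simp: M_def)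
      finally show ?thesis .
    qed
    moreover have "M \<ge> 0" using K B0 by (simp add: M_def)
    ultimately show ?thesis using Yc Y0 Yd unfolding y_def by blast
  qed
  then show ?thesis using \<gamma> by blast
qed

text \<open>Applying the duality estimate to each coordinate vector \<open>e\<close> bounds every
  coordinate of the solution with the same rate. The norm is at most the sum of the coordinates in
  absolute value, so the constants of the finitely many basis vectors are added up; the extra 1
  makes the total positive.\<close>

lemma stable: "exponentially_stable \<tau> A0 A1"
proof -
  obtain \<gamma> where \<gamma>: "\<gamma> > 0" and "\<forall>e. \<exists>Y M. continuous_on UNIV Y \<and> (\<forall>t\<le>0. Y t = 0) \<and>
    (\<forall>t\<ge>0. (Y has_vector_derivative (e + transpose A0 *v Y t + transpose A1 *v Y (t - \<tau>))) (at t within {0..})) \<and>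
    M \<ge> 0 \<and> (\<forall>t\<ge>0. norm (e + transpose A0 *v Y t + transpose A1 *v Y (t - \<tau>)) \<le> M * exp (- \<gamma> * t))"
    using fundamental_solution_decay by blast
  then obtain Y M where Y: "\<And>e. continuous_on UNIV (Y e)" "\<And>e. \<forall>t\<le>0. Y e t = 0"
    "\<And>e. \<forall>t\<ge>0. (Y e has_vector_derivative (e + transpose A0 *v Y e t + transpose A1 *v Y e (t - \<tau>))) (at t within {0..})"
    and M: "\<And>e. M e \<ge> 0"
    "\<And>e t. t \<ge> 0 \<Longrightarrow> norm (e + transpose A0 *v Y e t + transpose A1 *v Y e (t - \<tau>)) \<le> M e * exp (- \<gamma> * t)"
    by metis
  define L where "L = 1 + \<tau> * norm A1 * exp (\<gamma> * \<tau>)"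
  define N where "N = (\<Sum>i\<in>UNIV. M (axis i 1) * L)"
  have L: "L \<ge> 0" using tau by (simp add: L_def)
  have N: "N \<ge> 0" unfolding N_def using M L by (intro sum_nonneg mult_nonneg_nonneg)
  show ?thesis
    unfolding exponentially_stable_def
  proof (rule exI[of _ "N + 1"], intro conjI, goal_cases)
    case 2
    show ?case
    proof (rule exI[of _ \<gamma>], intro conjI allI impI)
      fix \<phi>0 x and t :: real
      assume \<phi>0: "continuous_on {-\<tau>..0} \<phi>0" and x: "delay_solution \<tau> A0 A1 \<phi>0 x" and t: "0 \<le> t"
      define m where "m = (SUP s\<in>{-\<tau>..0}. norm (\<phi>0 s))"
      have "compact ((\<lambda>s. norm (\<phi>0 s)) ` {-\<tau>..0})"
        by (intro compact_continuous_image continuous_intros \<phi>0 compact_Icc)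
      then have "bdd_above ((\<lambda>s. norm (\<phi>0 s)) ` {-\<tau>..0})"
        by (intro bounded_imp_bdd_above compact_imp_bounded)
      then have "norm (\<phi>0 0) \<le> m" unfolding m_def using tau by (intro cSUP_upper) auto
      then have m: "m \<ge> 0" using order_trans[OF norm_ge_zero] by blast
      have comp: "\<bar>x t $ i\<bar> \<le> M (axis i 1) * L * (exp (- \<gamma> * t) * m)" for i
      proof -
        have "\<bar>axis i 1 \<bullet> x t\<bar> \<le> M (axis i 1) * L * exp (- \<gamma> * t) * m"
          unfolding L_def m_def using \<gamma>
          by (intro component_decay[OF tau x \<phi>0 Y(1)[of "axis i 1"] Y(2) Y(3) M(2) _ t]) auto
        then show ?thesis by (simp add: inner_axis' mult.assoc)
      qed
      have "norm (x t) \<le> (\<Sum>i\<in>UNIV. \<bar>x t $ i\<bar>)" by (rule norm_le_l1_cart)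
      also have "\<dots> \<le> (\<Sum>i\<in>UNIV. M (axis i 1) * L * (exp (- \<gamma> * t) * m))"
        by (intro sum_mono comp)
      also have "\<dots> = N * (exp (- \<gamma> * t) * m)" by (simp add: N_def sum_distrib_right)
      also have "\<dots> \<le> (N + 1) * (exp (- \<gamma> * t) * m)" using m by (intro mult_right_mono) auto
      finally show "norm (x t) \<le> (N + 1) * exp (- \<gamma> * t) * (SUP s\<in>{-\<tau>..0}. norm (\<phi>0 s))"
        by (simp add: m_def mult.assoc)
    qed (rule \<gamma>)
  qed (use N in simp)
qed

end

theorem theorem3:
  fixes \<tau> \<epsilon> :: real
    and A0 A1 :: "real^'n^'n"
    and S :: "real \<Rightarrow> real^'n^'n"
    and R :: "real \<times> real \<Rightarrow> real^'n^'n"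
  assumes "\<tau> > 0" and "\<epsilon> > 0"
    and "S \<in> W2 {-\<tau>..0}"
    and "R \<in> W2 ({-\<tau>..0} \<times> {-\<tau>..0})"
    and "(\<lambda>s. R (s, 0)) \<in> W2 {-\<tau>..0}"
    and "(\<lambda>s. R (0, s)) \<in> W2 {-\<tau>..0}"
    and "(\<lambda>s. R (-\<tau>, s)) \<in> W2 {-\<tau>..0}"
    and "\<forall>s\<in>{-\<tau>..0}. \<forall>\<theta>\<in>{-\<tau>..0}. R (s, \<theta>) = transpose (R (\<theta>, s))"
    and "\<forall>s\<in>{-\<tau>..0}. transpose (S s) = S s"
    and "\<forall>z\<in>state_space \<tau>.
           L2_inner \<tau> (stack z) (op_P \<tau> S R z) \<ge> \<epsilon> * (L2_norm \<tau> (stack z))\<^sup>2"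
    and "\<forall>(x, \<phi>)\<in>state_space \<tau>.
           L2_inner \<tau> (stack ((x, \<phi> (-\<tau>)), \<phi>)) (op_D \<tau> A0 A1 S R ((x, \<phi> (-\<tau>)), \<phi>))
             \<le> - \<epsilon> * (L2_norm \<tau> (stack (x, \<phi>)))\<^sup>2"
  shows "exponentially_stable \<tau> A0 A1"
  using assms by (intro dual_lyapunov.stable[of \<tau> \<epsilon> A0 A1 S R] dual_lyapunov.intro)

end
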